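(* Let $M$ be a smooth $m$-dimensional submanifold of $\mathbb{R}^n$ ($m\ge 1$), with associated supercurrent $[M]_s$. Then the supercurrent $[M]_s\wedge\beta^{m-1}$ is $d$-closed, i.e. $d([M]_s\wedge\beta^{m-1})=0$, if and only if $M$ is a minimal submanifold, i.e. its mean curvature vector $\vec H$ vanishes identically.
   Context: Superforms: let $x=(x_1,\dots,x_n)$ be orthonormal coordinates on $\mathbb{R}^n$ and $\xi=(\xi_1,\dots,\xi_n)$ coordinates on a second copy of $\mathbb{R}^n$. A superform is a differential form $a=\sum a_{I,J}(x)\,dx_I\wedge d\xi_J$ on $\mathbb{R}^n_s=\mathbb{R}^n\oplus\mathbb{R}^n$ whose coefficients do not depend on $\xi$; it has bidegree $(p,q)$ if $|I|=p$, $|J|=q$. $J$ is the multiplicative operator on forms with $J(dx_i)=d\xi_i$, $J(d\xi_i)=-dx_i$; for $a$ of bidegree $(p,0)$ write $a^{\#}=J(a)$. Put $da=\sum \frac{\partial a_{I,J}}{\partial x_k}dx_k\wedge dx_I\wedge d\xi_J$. The superintegral of an $(n,n)$-form is $\int_{\mathbb{R}^n_s}a_0\,dx_1\wedge d\xi_1\wedge\dots\wedge dx_n\wedge d\xi_n=\int_{\mathbb{R}^n}a_0\,d\lambda$ ($\lambda$ Lebesgue measure). Supercurrents of bidegree $(p,q)$ (bidimension $(n-p,n-q)$) are the continuous linear functionals on smooth superforms of bidegree $(n-p,n-q)$ with compact support in $x$; equivalently superforms with distribution coefficients, acting by $T.\alpha=\int T\wedge\alpha$. The operator $d$ extends to supercurrents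 coefficientwise. $\beta=\sum_j dx_j\wedge d\xi_j$. The supercurrent $[M]_s$: let $M\subset\mathbb{R}^n$ be a smooth submanifold (without boundary, closed in the open set considered, so that its current of integration is $d$-closed) of dimension $m$ and codimension $p=n-m$. Locally choose defining functions $\rho_1,\dots,\rho_p$ such that $n_j:=d\rho_j$ are orthonormal at the points of $M$; put $n=n_1\wedge\dots\wedge n_p$, $c_p=(-1)^{p(p-1)/2}$. Then $[M]_s=c_p\,n\wedge n^{\#}*dS_M$, where $dS_M$ is surface measure on $M$ and, for a measure $\mu$, $*\mu$ is the bidegree $(0,0)$ supercurrent with $*\mu.(\alpha_0\,dx_1\wedge d\xi_1\wedge\dots\wedge dx_n\wedge d\xi_n)=\int\alpha_0\,d\mu$. This does not depend on the choice of $\rho_j$. Mean curvature: $F_j:=d n_j^{\#}$ is a $(1,1)$-form; $H_j$ is the trace of the restriction of $F_j$ to the tangent spaces of $M$, equivalently $F_j\wedge[M]_s\wedge\beta^{m-1}/(m-1)!=H_j\,[M]_s\wedge\beta^m/m!$; the mean curvature vector is $\vec H=\sum_jH_j\vec n_j$, where $\vec n_j$ is the vector dual to $n_j$. *)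

theory Defs
  imports "HOL-Analysis.Analysis"
begin

section \<open>Smooth functions\<close>

text \<open>Meant for open \<open>S\<close>; on finite-dimensional spaces this is the class of k times continuously
  differentiable maps, as continuity of all directional derivatives is continuity of the derivative.\<close>

primrec Ck_on :: "nat \<Rightarrow> 'a::real_normed_vector set \<Rightarrow> ('a \<Rightarrow> 'b::real_normed_vector) \<Rightarrow> bool" where
  "Ck_on 0 S f \<longleftrightarrow> continuous_on S f"
| "Ck_on (Suc k) S f \<longleftrightarrow>
     (\<forall>x\<in>S. f differentiable (at x)) \<and> (\<forall>v. Ck_on k S (\<lambda>x. frechet_derivative f (at x) v))"

definition smooth_on :: "'a::real_normed_vector set \<Rightarrow> ('a \<Rightarrow> 'b::real_normed_vector) \<Rightarrow> bool" where
  "smooth_on S f \<longleftrightarrow> (\<forall>k. Ck_on k S f)"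

definition partial :: "'n \<Rightarrow> (real^'n::finite \<Rightarrow> real) \<Rightarrow> real^'n \<Rightarrow> real" where
  "partial k f x = frechet_derivative f (at x) (axis k 1)"


section \<open>Superforms\<close>

text \<open>\<open>a I J\<close> is the coefficient of \<open>dx_I \<and> d\<xi>_J\<close>, where \<open>dx_I\<close> and \<open>d\<xi>_J\<close> are the wedge products
  over \<open>I\<close> and \<open>J\<close> in increasing order of the (linearly ordered) index type. A superform
  on a subset of \<open>\<real>^n\<close> is a function from points to such coefficient families; being independent
  of \<open>\<xi>\<close> is built in.\<close>

type_synonym 'n sform = "'n set \<Rightarrow> 'n set \<Rightarrow> real"

text \<open>\<open>dx_I \<and> dx_K = eps I K dx_{I \<union> K}\<close> for disjoint \<open>I\<close>, \<open>K\<close>, and hence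
  \<open>(dx_I \<and> d\<xi>_J) \<and> (dx_K \<and> d\<xi>_L) = wedge_sign I J K L dx_{I \<union> K} \<and> d\<xi>_{J \<union> L}\<close>.\<close>

definition eps :: "'n::linorder set \<Rightarrow> 'n set \<Rightarrow> real" where
  "eps I K = (-1) ^ card {(i, k). i \<in> I \<and> k \<in> K \<and> k < i}"

definition wedge_sign :: "'n::linorder set \<Rightarrow> 'n set \<Rightarrow> 'n set \<Rightarrow> 'n set \<Rightarrow> real" where
  "wedge_sign I J K L = (-1) ^ (card J * card K) * eps I K * eps J L"

definition swedge :: "'n::{finite,linorder} sform \<Rightarrow> 'n sform \<Rightarrow> 'n sform" (infixl "\<and>\<^sub>s" 70) where
  "a \<and>\<^sub>s b = (\<lambda>I J. \<Sum>K\<in>Pow I. \<Sum>L\<in>Pow J. wedge_sign K L (I - K) (J - L) * (a K L * b (I - K) (J - L)))"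

definition sscalar :: "real \<Rightarrow> 'n sform" where
  "sscalar c = (\<lambda>I J. if I = {} \<and> J = {} then c else 0)"

definition dx :: "'n \<Rightarrow> 'n sform" where
  "dx k = (\<lambda>I J. if I = {k} \<and> J = {} then 1 else 0)"

definition dxi :: "'n \<Rightarrow> 'n sform" where
  "dxi k = (\<lambda>I J. if I = {} \<and> J = {k} then 1 else 0)"

primrec swedge_power :: "'n::{finite,linorder} sform \<Rightarrow> nat \<Rightarrow> 'n sform" where
  "swedge_power a 0 = sscalar 1"
| "swedge_power a (Suc k) = a \<and>\<^sub>s swedge_power a k"

definition beta :: "'n::{finite,linorder} sform" where
  "beta = (\<lambda>I J. \<Sum>k\<in>UNIV. (dx k \<and>\<^sub>s dxi k) I J)"

text \<open>The multiplicative operator with \<open>J(dx_i) = d\<xi>_i\<close> and \<open>J(d\<xi>_i) = - dx_i\<close>: it maps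
  \<open>dx_K \<and> d\<xi>_I\<close> to \<open>(-1)^|I| d\<xi>_K \<and> dx_I = (-1)^(|I| + |I||K|) dx_I \<and> d\<xi>_K\<close>.\<close>

definition Jop :: "'n sform \<Rightarrow> 'n sform" where
  "Jop a = (\<lambda>I K. (-1) ^ (card I + card I * card K) * a K I)"

definition sd :: "(real^'n::{finite,linorder} \<Rightarrow> 'n sform) \<Rightarrow> real^'n::{finite,linorder} \<Rightarrow> 'n sform" where
  "sd a x = (\<lambda>I J. \<Sum>k\<in>UNIV. (dx k \<and>\<^sub>s (\<lambda>K L. partial k (\<lambda>y. a y K L) x)) I J)"

text \<open>\<open>dx_1 \<and> d\<xi>_1 \<and> \<dots> \<and> dx_p \<and> d\<xi>_p = csign p dx_1 \<and> \<dots> \<and> dx_p \<and> d\<xi>_1 \<and> \<dots> \<and> d\<xi>_p\<close>\<close>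

definition csign :: "nat \<Rightarrow> real" where
  "csign p = (-1) ^ (p * (p - 1) div 2)"

definition test_superform :: "(real^'n) set \<Rightarrow> (real^'n::finite \<Rightarrow> 'n sform) \<Rightarrow> bool" where
  "test_superform \<Omega> \<alpha> \<longleftrightarrow>
     (\<forall>I J. smooth_on UNIV (\<lambda>x. \<alpha> x I J)) \<and>
     (\<exists>C. compact C \<and> C \<subseteq> \<Omega> \<and> (\<forall>x. x \<notin> C \<longrightarrow> (\<forall>I J. \<alpha> x I J = 0)))"


section \<open>Supercurrents\<close>

text \<open>Supercurrents are superforms with distribution coefficients: \<open>T I J\<close> is the distribution
  multiplying \<open>dx_I \<and> d\<xi>_J\<close>. A distribution is represented by the underlying functional; only its
  values on test functions of the open set considered matter, and equations between
  supercurrents are tested on test superforms (see \<open>scurrent_zero_on\<close>). No continuity is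
  built into the type. The product of a distribution \<open>u\<close> with a function \<open>f\<close> is
  \<open>\<phi> \<mapsto> u (f \<phi>)\<close>, and its partial derivatives are \<open>\<phi> \<mapsto> - u (\<partial>_k \<phi>)\<close>.\<close>

type_synonym 'n scurrent = "'n set \<Rightarrow> 'n set \<Rightarrow> (real^'n \<Rightarrow> real) \<Rightarrow> real"

definition form_wedge_current ::
  "(real^'n::{finite,linorder} \<Rightarrow> 'n sform) \<Rightarrow> 'n scurrent \<Rightarrow> 'n scurrent" where
  "form_wedge_current a T = (\<lambda>I J \<phi>.
     \<Sum>K\<in>Pow I. \<Sum>L\<in>Pow J. wedge_sign K L (I - K) (J - L) * T (I - K) (J - L) (\<lambda>x. a x K L * \<phi> x))"

definition current_wedge_form ::
  "'n::{finite,linorder} scurrent \<Rightarrow> (real^'n::{finite,linorder} \<Rightarrow> 'n sform) \<Rightarrow> 'n scurrent" where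
  "current_wedge_form T a = (\<lambda>I J \<phi>.
     \<Sum>K\<in>Pow I. \<Sum>L\<in>Pow J. wedge_sign K L (I - K) (J - L) * T K L (\<lambda>x. a x (I - K) (J - L) * \<phi> x))"

definition current_d :: "'n::{finite,linorder} scurrent \<Rightarrow> 'n scurrent" where
  "current_d T = (\<lambda>I J \<phi>.
     \<Sum>k\<in>UNIV. form_wedge_current (\<lambda>_. dx k) (\<lambda>K L \<psi>. - T K L (partial k \<psi>)) I J \<phi>)"

text \<open>\<open>T.\<alpha> = \<integral> T \<and> \<alpha>\<close>. By the normalisation of the superintegral, the integral of
  \<open>u dx_1 \<and> \<dots> \<and> dx_n \<and> d\<xi>_1 \<and> \<dots> \<and> d\<xi>_n\<close> is \<open>csign n\<close> times the total mass \<open>u 1\<close> of the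
  compactly supported distribution \<open>u\<close>. Only the part of \<open>\<alpha>\<close> of bidegree complementary to that of \<open>T\<close>
  contributes.\<close>

definition current_apply ::
  "'n::{finite,linorder} scurrent \<Rightarrow> (real^'n::{finite,linorder} \<Rightarrow> 'n sform) \<Rightarrow> real" where
  "current_apply T \<alpha> = csign CARD('n) * current_wedge_form T \<alpha> UNIV UNIV (\<lambda>_. 1)"

definition scurrent_zero_on :: "(real^'n::{finite,linorder}) set \<Rightarrow> 'n::{finite,linorder} scurrent \<Rightarrow> bool" where
  "scurrent_zero_on \<Omega> T \<longleftrightarrow> (\<forall>\<alpha>. test_superform \<Omega> \<alpha> \<longrightarrow> current_apply T \<alpha> = 0)"

definition d_closed_on :: "(real^'n::{finite,linorder}) set \<Rightarrow> 'n::{finite,linorder} scurrent \<Rightarrow> bool" where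
  "d_closed_on \<Omega> T \<longleftrightarrow> scurrent_zero_on \<Omega> (current_d T)"

definition star_measure :: "(real^'n) measure \<Rightarrow> 'n::finite scurrent" where
  "star_measure \<mu> = (\<lambda>I J \<phi>. if I = {} \<and> J = {} then (\<integral>x. \<phi> x \<partial>\<mu>) else 0)"


section \<open>Submanifolds and surface measure\<close>

definition conormal :: "(real^'n::{finite,linorder} \<Rightarrow> real) \<Rightarrow> real^'n::{finite,linorder} \<Rightarrow> 'n sform" where
  "conormal \<rho> = sd (\<lambda>x. sscalar (\<rho> x))"

definition dual_vector :: "'n sform \<Rightarrow> real^'n::finite" where
  "dual_vector a = (\<chi> k. a {k} {})"

definition zero_set_of ::
  "nat \<Rightarrow> (real^'n) set \<Rightarrow> (real^'n) set \<Rightarrow> (nat \<Rightarrow> real^'n::finite \<Rightarrow> real) \<Rightarrow> bool" where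
  "zero_set_of p M U \<rho> \<longleftrightarrow>
     open U \<and> (\<forall>j<p. smooth_on U (\<rho> j)) \<and> M \<inter> U = {x \<in> U. \<forall>j<p. \<rho> j x = 0}"

definition smooth_submanifold :: "nat \<Rightarrow> (real^'n::{finite,linorder}) set \<Rightarrow> bool" where
  "smooth_submanifold m M \<longleftrightarrow> m \<le> CARD('n) \<and>
     (\<forall>x\<in>M. \<exists>U \<rho>. x \<in> U \<and> zero_set_of (CARD('n) - m) M U \<rho> \<and>
        (\<forall>y\<in>M \<inter> U. \<forall>c. (\<Sum>j<CARD('n) - m. c j *\<^sub>R dual_vector (conormal (\<rho> j) y)) = 0
                      \<longrightarrow> (\<forall>j<CARD('n) - m. c j = 0)))"

definition local_parametrization ::
  "(real^'n::finite) set \<Rightarrow> (real^'m) set \<Rightarrow> (real^'m::finite \<Rightarrow> real^'n) \<Rightarrow> bool" where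
  "local_parametrization M V f \<longleftrightarrow>
     open V \<and> smooth_on V f \<and> (\<forall>y\<in>V. inj (frechet_derivative f (at y))) \<and>
     openin (top_of_set M) (f ` V) \<and> (\<exists>g. homeomorphism V (f ` V) f g)"

definition area_density :: "(real^'m::finite \<Rightarrow> real^'n::finite) \<Rightarrow> real^'m \<Rightarrow> real" where
  "area_density f y =
     (let A = matrix (frechet_derivative f (at y)) in sqrt (det (transpose A ** A)))"

text \<open>The dimension of \<open>M\<close> is \<open>CARD('m)\<close>. The surface measure is the Borel measure concentrated on \<open>M\<close>
  that is given by the area density in every local parametrization; it exists and is unique for
  every smooth submanifold that is relatively closed in an open set.\<close>

definition is_surface_measure ::
  "'m::finite itself \<Rightarrow> (real^'n::finite) set \<Rightarrow> (real^'n) measure \<Rightarrow> bool" where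
  "is_surface_measure _ M \<mu> \<longleftrightarrow>
     sets \<mu> = sets borel \<and> emeasure \<mu> (- M) = 0 \<and>
     (\<forall>V (f :: real^'m \<Rightarrow> real^'n). local_parametrization M V f \<longrightarrow>
        (\<forall>A\<in>sets borel. emeasure \<mu> (A \<inter> f ` V) =
           (\<integral>\<^sup>+y\<in>V. (ennreal (area_density f y) * indicator A (f y)) \<partial>lborel)))"

definition surface_measure ::
  "'m::finite itself \<Rightarrow> (real^'n::finite) set \<Rightarrow> (real^'n) measure" where
  "surface_measure t M = (THE \<mu>. is_surface_measure t M \<mu>)"


section \<open>The supercurrent of a submanifold and mean curvature\<close>

text \<open>Near \<open>x\<close>, \<open>M\<close> is the zero set of \<open>\<rho> 0, \<dots>, \<rho> (p - 1)\<close>, whose differentials are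
  orthonormal at the points of \<open>M\<close>. The forms and vectors defined below do not depend on the
  local choice of \<open>\<rho>\<close> made by \<open>unit_defining\<close>.\<close>

definition unit_defining_at ::
  "nat \<Rightarrow> (real^'n::{finite,linorder}) set \<Rightarrow> real^'n::{finite,linorder} \<Rightarrow> (nat \<Rightarrow> real^'n::{finite,linorder} \<Rightarrow> real) \<Rightarrow> bool" where
  "unit_defining_at p M x \<rho> \<longleftrightarrow>
     (\<exists>U. x \<in> U \<and> zero_set_of p M U \<rho> \<and>
        (\<forall>y\<in>M \<inter> U. \<forall>i<p. \<forall>j<p.
           dual_vector (conormal (\<rho> i) y) \<bullet> dual_vector (conormal (\<rho> j) y) = (if i = j then 1 else 0)))"

definition unit_defining ::
  "nat \<Rightarrow> (real^'n::{finite,linorder}) set \<Rightarrow> real^'n::{finite,linorder} \<Rightarrow> nat \<Rightarrow> real^'n::{finite,linorder} \<Rightarrow> real" where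
  "unit_defining p M x = (SOME \<rho>. unit_defining_at p M x \<rho>)"

primrec conormal_wedge ::
  "(nat \<Rightarrow> real^'n::{finite,linorder} \<Rightarrow> real) \<Rightarrow> nat \<Rightarrow> real^'n::{finite,linorder} \<Rightarrow> 'n sform" where
  "conormal_wedge \<rho> 0 x = sscalar 1"
| "conormal_wedge \<rho> (Suc p) x = conormal_wedge \<rho> p x \<and>\<^sub>s conormal (\<rho> p) x"

text \<open>\<open>c_p n \<and> n^#\<close> at the points of \<open>M\<close>, extended by 0 (immaterial, as the surface measure is
  concentrated on \<open>M\<close>).\<close>

definition normal_form :: "nat \<Rightarrow> (real^'n::{finite,linorder}) set \<Rightarrow> real^'n::{finite,linorder} \<Rightarrow> 'n sform" where
  "normal_form p M x =
     (if x \<in> M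
      then (let n = conormal_wedge (unit_defining p M x) p x in sscalar (csign p) \<and>\<^sub>s (n \<and>\<^sub>s Jop n))
      else sscalar 0)"

definition submanifold_current ::
  "'m::finite itself \<Rightarrow> (real^'n::{finite,linorder}) set \<Rightarrow> 'n::{finite,linorder} scurrent" where
  "submanifold_current t M =
     form_wedge_current (normal_form (CARD('n) - CARD('m)) M) (star_measure (surface_measure t M))"

text \<open>Trace on \<open>T\<close> of the bilinear form \<open>(v, w) \<mapsto> \<Sum> F_{kl} v_k w_l\<close> given by a (1,1)-form
  \<open>F = \<Sum> F_{kl} dx_k \<and> d\<xi>_l\<close>; it does not depend on the orthonormal basis \<open>B\<close> of \<open>T\<close>.\<close>

definition trace_on :: "(real^'n::finite) set \<Rightarrow> 'n sform \<Rightarrow> real" where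
  "trace_on T F =
     (let B = (SOME B. B \<subseteq> T \<and> pairwise orthogonal B \<and> (\<forall>b\<in>B. norm b = 1) \<and> span B = T)
      in \<Sum>b\<in>B. \<Sum>k\<in>UNIV. \<Sum>l\<in>UNIV. F {k} {l} * b $ k * b $ l)"

definition mean_curvature :: "nat \<Rightarrow> (real^'n::{finite,linorder}) set \<Rightarrow> real^'n::{finite,linorder} \<Rightarrow> real^'n::{finite,linorder}" where
  "mean_curvature m M x =
     (let p = CARD('n) - m;
          \<rho> = unit_defining p M x;
          T = {v. \<forall>j<p. dual_vector (conormal (\<rho> j) x) \<bullet> v = 0}
      in \<Sum>j<p. trace_on T (sd (\<lambda>y. Jop (conormal (\<rho> j) y)) x) *\<^sub>R dual_vector (conormal (\<rho> j) x))"

definition minimal_submanifold :: "nat \<Rightarrow> (real^'n::{finite,linorder}) set \<Rightarrow> bool" where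
  "minimal_submanifold m M \<longleftrightarrow> smooth_submanifold m M \<and> (\<forall>x\<in>M. mean_curvature m M x = 0)"

end

theory Submission imports Defs begin

text \<open>Expanding \<open>[M]\<^sub>s\<close> in an orthonormal coframe shows that, up to a non-zero constant,
  \<open>d([M]\<^sub>s \<and> \<beta>\<^sup>m\<^sup>-\<^sup>1)\<close> tested against \<open>\<Sum>\<^sub>l \<phi>\<^sub>l d\<xi>\<^sub>l\<close> is \<open>\<Sum>\<^sub>k\<^sub>l \<integral>\<^sub>M P\<^sub>k\<^sub>l \<partial>\<^sub>k\<phi>\<^sub>l dS\<close>, where \<open>P\<close> is
  the orthogonal projection onto the tangent space; test forms of other bidegree give 0. This is the
  first variation of area: integration by parts in a chart turns it into \<open>\<integral>\<^sub>M H \<bullet> \<phi> dS\<close> for every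
  \<open>\<phi>\<close> supported in that chart. Hence it vanishes if \<open>H = 0\<close>, by a partition of unity, and conversely
  testing with bump functions forces \<open>H = 0\<close>.\<close>

section \<open>Functions of class C^k\<close>

text \<open>Two features of the definitions shape the work. \<open>normal_form\<close> and
  \<open>mean_curvature\<close> use defining functions picked by \<open>SOME\<close> separately at
  each point, so not even continuity in the point is visible. The choice is eliminated: each n_j
  \<and> n_j^# is even and squares to 0, hence c_p n \<and> n^# is the p-th power of their sum
  divided by p!, and that sum is the (1,1)-form with matrix 1 - P. In a chart f the matrix P is a
  smooth expression in the derivative of f, and H_l is minus the tangential divergence of the l-th
  column of P. Secondly, \<open>surface_measure\<close> is a \<open>THE\<close>, usable only once
  existence and uniqueness are proved; this is why charts, transition maps and the change of
  variables formula appear. The square-zero calculus also explains the constant: next to n \<and>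
  n^# only the m tangential summands of \<beta> survive, and comparing powers of this partial sum
  with \<beta>^n gives m!/(m n!) times the top coefficient of \<beta>^n.\<close>

lemma frechet_derivative_eqI:
  "(f has_derivative f') (at x) \<Longrightarrow> frechet_derivative f (at x) = f'"
  using frechet_derivative_at by metis

lemma frechet_derivative_cong_open:
  assumes "open S" "x \<in> S" "\<And>y. y \<in> S \<Longrightarrow> f y = g y"
  shows "frechet_derivative f (at x) = frechet_derivative g (at x)"
proof -
  have "(f has_derivative f') (at x) \<longleftrightarrow> (g has_derivative f') (at x)" for f'
    using has_derivative_transform_within_open[OF _ assms(1,2), of f f' UNIV g]
          has_derivative_transform_within_open[OF _ assms(1,2), of g f' UNIV f] assms(3) by auto
  then show ?thesis unfolding frechet_derivative_def by simp
qed

lemma Ck_on_cong: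
  assumes "open S" "\<And>x. x \<in> S \<Longrightarrow> f x = g x"
  shows "Ck_on k S f \<longleftrightarrow> Ck_on k S g"
  using assms(2)
proof (induction k arbitrary: f g)
  case 0
  then show ?case using continuous_on_cong[of S S f g] by simp
next
  case (Suc k)
  have 1: "f differentiable (at x) \<longleftrightarrow> g differentiable (at x)" if "x \<in> S" for x
    using has_derivative_transform_within_open[OF _ assms(1) that, of f _ UNIV g]
          has_derivative_transform_within_open[OF _ assms(1) that, of g _ UNIV f] Suc.prems
    unfolding differentiable_def by auto
  have 2: "Ck_on k S (\<lambda>x. frechet_derivative f (at x) v) \<longleftrightarrow> Ck_on k S (\<lambda>x. frechet_derivative g (at x) v)" for v
    by (rule Suc.IH) (simp add: frechet_derivative_cong_open[OF assms(1) _ Suc.prems])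
  show ?case using 1 2 by simp
qed

lemma Ck_on_subset: "Ck_on k S f \<Longrightarrow> T \<subseteq> S \<Longrightarrow> Ck_on k T f"
  by (induction k arbitrary: f) (auto intro: continuous_on_subset)

text \<open>The recursion in \<open>Ck_on\<close> speaks of \<open>frechet_derivative\<close>; on an
  open set any explicit derivative agrees with it, so inductions on k can work with closed formulas
  \<open>f' x v\<close>.\<close>

lemma Ck_on_SucI:
  assumes "open S" "\<And>x. x \<in> S \<Longrightarrow> (f has_derivative f' x) (at x)"
    and "\<And>v. Ck_on k S (\<lambda>x. f' x v)"
  shows "Ck_on (Suc k) S f"
proof -
  have "Ck_on k S (\<lambda>x. frechet_derivative f (at x) v) = Ck_on k S (\<lambda>x. f' x v)" for v
    by (rule Ck_on_cong[OF assms(1)]) (simp add: frechet_derivative_eqI[OF assms(2)])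
  then show ?thesis using assms by (auto simp: differentiable_def)
qed

lemma Ck_on_SucD:
  assumes "Ck_on (Suc k) S f" "x \<in> S"
  shows "(f has_derivative frechet_derivative f (at x)) (at x)"
  using assms by (simp add: frechet_derivative_works)

lemma Ck_on_continuous: "Ck_on k S f \<Longrightarrow> continuous_on S f"
  by (cases k) (auto intro!: continuous_at_imp_continuous_on differentiable_imp_continuous_within)

lemma Ck_on_Suc_imp: "Ck_on (Suc k) S f \<Longrightarrow> Ck_on k S f"
proof (induction k arbitrary: f)
  case 0
  then show ?case using Ck_on_continuous Ck_on.simps(1) by blast
qed auto

lemma Ck_on_const [simp]: "open S \<Longrightarrow> Ck_on k S (\<lambda>x. c)"
proof (induction k arbitrary: c)
  case (Suc k)
  show ?case by (rule Ck_on_SucI[where f'="\<lambda>_ _. 0"]) (use Suc in auto)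
qed auto

lemma Ck_on_bounded_linear:
  assumes "bounded_linear L" "open S"
  shows "Ck_on k S L"
proof (cases k)
  case 0
  then show ?thesis using assms by (simp add: linear_continuous_on)
next
  case (Suc j)
  show ?thesis unfolding Suc
    by (rule Ck_on_SucI[where f'="\<lambda>_. L"])
      (use assms in \<open>auto intro: bounded_linear_imp_has_derivative\<close>)
qed

lemma Ck_on_add:
  "open S \<Longrightarrow> Ck_on k S f \<Longrightarrow> Ck_on k S g \<Longrightarrow> Ck_on k S (\<lambda>x. f x + g x)"
proof (induction k arbitrary: f g)
  case 0 then show ?case by (simp add: continuous_on_add)
next
  case (Suc k)
  show ?case
  proof (rule Ck_on_SucI[OF Suc.prems(1)])
    show "((\<lambda>x. f x + g x) has_derivative
      (\<lambda>v. frechet_derivative f (at x) v + frechet_derivative g (at x) v)) (at x)" if "x \<in> S" for x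
      by (intro has_derivative_add Ck_on_SucD[OF Suc.prems(2) that] Ck_on_SucD[OF Suc.prems(3) that])
    show "Ck_on k S (\<lambda>x. frechet_derivative f (at x) v + frechet_derivative g (at x) v)" for v
      by (rule Suc.IH) (use Suc.prems in auto)
  qed
qed

text \<open>The product rule expresses the derivative by the same map \<open>bb\<close>, so one
  induction on k serves scalar, inner and real products.\<close>

lemma Ck_on_bilinear:
  assumes "bounded_bilinear bb" "open S" "Ck_on k S f" "Ck_on k S g"
  shows "Ck_on k S (\<lambda>x. bb (f x) (g x))"
  using assms(3,4)
proof (induction k arbitrary: f g)
  case 0 then show ?case by (simp add: bounded_bilinear.continuous_on[OF assms(1)])
next
  case (Suc k)
  show ?case
  proof (rule Ck_on_SucI[OF assms(2)])
    show "((\<lambda>x. bb (f x) (g x)) has_derivative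
       (\<lambda>h. bb (f x) (frechet_derivative g (at x) h) + bb (frechet_derivative f (at x) h) (g x))) (at x)" if "x \<in> S" for x
      by (intro bounded_bilinear.FDERIV[OF assms(1)] Ck_on_SucD[OF Suc.prems(1) that] Ck_on_SucD[OF Suc.prems(2) that])
    show "Ck_on k S (\<lambda>x. bb (f x) (frechet_derivative g (at x) v) + bb (frechet_derivative f (at x) v) (g x))" for v
      using Suc.prems Ck_on_Suc_imp[OF Suc.prems(1)] Ck_on_Suc_imp[OF Suc.prems(2)]
      by (intro Ck_on_add assms Suc.IH) simp_all
  qed
qed

lemmas Ck_on_scaleR = Ck_on_bilinear[OF bounded_bilinear_scaleR]
lemmas Ck_on_inner = Ck_on_bilinear[OF bounded_bilinear_inner]

lemma Ck_on_mult: 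
  fixes f g :: "'a::real_normed_vector \<Rightarrow> real"
  shows "open S \<Longrightarrow> Ck_on k S f \<Longrightarrow> Ck_on k S g \<Longrightarrow> Ck_on k S (\<lambda>x. f x * g x)"
  by (rule Ck_on_bilinear[OF bounded_bilinear_mult])

lemma Ck_on_sum:
  "open S \<Longrightarrow> (\<And>i. i \<in> I \<Longrightarrow> Ck_on k S (f i)) \<Longrightarrow> Ck_on k S (\<lambda>x. \<Sum>i\<in>I. f i x)"
  by (induction I rule: infinite_finite_induct) (auto intro: Ck_on_add)

lemma Ck_on_prod:
  fixes f :: "'i \<Rightarrow> 'a::real_normed_vector \<Rightarrow> real"
  shows "open S \<Longrightarrow> (\<And>i. i \<in> I \<Longrightarrow> Ck_on k S (f i)) \<Longrightarrow> Ck_on k S (\<lambda>x. \<Prod>i\<in>I. f i x)"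
  by (induction I rule: infinite_finite_induct) (auto intro: Ck_on_mult)

text \<open>In the chain rule the direction \<open>frechet_derivative f (at x) v\<close> varies with
  x, whereas \<open>Ck_on\<close> speaks of fixed directions. Expanding it in \<open>Basis\<close>
  leaves derivatives of g in constant directions b, covered by the induction hypothesis, times
  scalar coefficients.\<close>

lemma Ck_on_compose:
  fixes f :: "'a::real_normed_vector \<Rightarrow> 'b::euclidean_space" and g :: "'b \<Rightarrow> 'c::real_normed_vector"
  assumes "open S" "open T" "Ck_on k S f" "Ck_on k T g" "f ` S \<subseteq> T"
  shows "Ck_on k S (\<lambda>x. g (f x))"
  using assms(3,4,5)
proof (induction k arbitrary: g)
  case 0 then show ?case using continuous_on_compose2[of T g S f] by simp
next
  case (Suc k)
  have df: "(f has_derivative frechet_derivative f (at x)) (at x)" if "x \<in> S" for x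
    using Ck_on_SucD[OF Suc.prems(1) that] .
  have dg: "(g has_derivative frechet_derivative g (at (f x))) (at (f x))" if "x \<in> S" for x
    using Ck_on_SucD[OF Suc.prems(2), of "f x"] that Suc.prems(3) by auto
  have lin: "frechet_derivative g (at (f x)) w = (\<Sum>b\<in>Basis. (w \<bullet> b) *\<^sub>R frechet_derivative g (at (f x)) b)"
    if "x \<in> S" for x w
  proof -
    have l: "linear (frechet_derivative g (at (f x)))"
      using dg[OF that] has_derivative_linear by blast
    show ?thesis
      by (subst euclidean_representation[of w, symmetric], subst linear_sum[OF l])
        (simp only: linear_scale[OF l] euclidean_representation)
  qed
  show ?case
  proof (rule Ck_on_SucI[OF assms(1)])
    show "((\<lambda>x. g (f x)) has_derivative
      (\<lambda>v. \<Sum>b\<in>Basis. (frechet_derivative f (at x) v \<bullet> b) *\<^sub>R frechet_derivative g (at (f x)) b)) (at x)"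
      if "x \<in> S" for x
      using has_derivative_compose[OF df[OF that] dg[OF that]] by (simp add: lin[OF that, symmetric])
    show "Ck_on k S (\<lambda>x. \<Sum>b\<in>Basis. (frechet_derivative f (at x) v \<bullet> b) *\<^sub>R frechet_derivative g (at (f x)) b)" for v
    proof (intro Ck_on_sum Ck_on_scaleR Ck_on_inner Ck_on_const assms(1))
      show "Ck_on k S (\<lambda>x. frechet_derivative f (at x) v)" using Suc.prems by simp
      show "Ck_on k S (\<lambda>x. frechet_derivative g (at (f x)) b)" for b
        by (rule Suc.IH[OF Ck_on_Suc_imp[OF Suc.prems(1)] _ Suc.prems(3)]) (use Suc.prems(2) in simp)
    qed
  qed
qed

text \<open>Used for functions glued from formulas on different open sets, above all extensions by
  0.\<close>

lemma Ck_on_local: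
  assumes "open S" "\<And>x. x \<in> S \<Longrightarrow> \<exists>U. open U \<and> x \<in> U \<and> Ck_on k U f"
  shows "Ck_on k S f"
  using assms(2)
proof (induction k arbitrary: f)
  case 0
  have "continuous (at x) f" if "x \<in> S" for x
    using 0[OF that] by (auto simp: continuous_on_eq_continuous_at)
  then show ?case by (simp add: continuous_at_imp_continuous_on)
next
  case (Suc k)
  show ?case unfolding Ck_on.simps
  proof (intro conjI ballI allI)
    show "f differentiable at x" if "x \<in> S" for x
      using Suc.prems[OF that] unfolding Ck_on.simps by blast
    show "Ck_on k S (\<lambda>x. frechet_derivative f (at x) v)" for v
      
    proof (rule Suc.IH)
      fix x assume "x \<in> S"
      from Suc.prems[OF this] show "\<exists>U. open U \<and> x \<in> U \<and> Ck_on k U (\<lambda>x. frechet_derivative f (at x) v)"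
        unfolding Ck_on.simps by blast
    qed
  qed
qed

lemma Ck_on_vec:
  fixes f :: "'a::real_normed_vector \<Rightarrow> real^'n"
  assumes "open S" "\<And>i. Ck_on k S (\<lambda>x. f x $ i)"
  shows "Ck_on k S f"
proof -
  have eq: "f x = (\<Sum>i\<in>UNIV. (f x $ i) *\<^sub>R axis i 1)" for x
    by (simp add: vec_eq_iff axis_def if_distrib cong: if_cong)
  have "Ck_on k S (\<lambda>x. \<Sum>i\<in>UNIV. (f x $ i) *\<^sub>R axis i 1)"
    by (intro Ck_on_sum Ck_on_scaleR Ck_on_const assms)
  with Ck_on_cong[OF assms(1), of f, OF eq] show ?thesis by blast
qed

lemma Ck_on_vec_nth:
  fixes f :: "'a::real_normed_vector \<Rightarrow> real^'n"
  assumes "open S" "Ck_on k S f"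
  shows "Ck_on k S (\<lambda>x. f x $ i)"
  using Ck_on_compose[OF assms(1) open_UNIV assms(2) Ck_on_bounded_linear[OF bounded_linear_vec_nth[of i] open_UNIV]] by simp

lemma Ck_on_powr:
  assumes "open S" "Ck_on k S f" "\<And>x. x \<in> S \<Longrightarrow> f x > 0"
  shows "Ck_on k S (\<lambda>x. f x powr a :: real)"
proof -
  \<comment> \<open>The factor c makes the family closed under differentiation, so all exponents are
    treated in one induction.\<close>
  have "Ck_on k {0<..} (\<lambda>t. c * t powr a)" for a c :: real
  proof (induction k arbitrary: c a)
    case 0 then show ?case by (auto intro!: continuous_intros)
  next
    case (Suc k)
    show ?case
    proof (rule Ck_on_SucI[where f'="\<lambda>t v. ((c * a) * t powr (a - 1)) * v"])
      show "((\<lambda>t. c * t powr a) has_derivative (\<lambda>v. c * a * t powr (a - 1) * v)) (at t)" if "t \<in> {0<..}" for t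
        using that by (auto intro!: derivative_eq_intros simp: field_simps powr_diff fun_eq_iff)
      show "Ck_on k {0<..} (\<lambda>t. c * a * t powr (a - 1) * v)" for v
        by (rule Ck_on_mult[OF _ Suc.IH]) auto
    qed auto
  qed
  from this[of 1 a] Ck_on_compose[OF assms(1) _ assms(2), of "{0<..}" "\<lambda>t. t powr a"] assms(3)
  show ?thesis by auto
qed

lemma Ck_on_inverse:
  assumes "open S" "Ck_on k S f" "\<And>x. x \<in> S \<Longrightarrow> f x \<noteq> (0::real)"
  shows "Ck_on k S (\<lambda>x. inverse (f x))"
proof -
  \<comment> \<open>\<open>Ck_on_powr\<close> needs a positive base and f may be negative: 1/f is
    written as f times a power of its square.\<close>
  have "Ck_on k S (\<lambda>x. f x * (f x * f x) powr (-1))"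
    using assms by (intro Ck_on_mult Ck_on_powr) (auto simp: zero_less_mult_iff not_less less_le)
  moreover have "f x * (f x * f x) powr (-1) = inverse (f x)" if "x \<in> S" for x
    using assms(3)[OF that] by (simp add: powr_minus field_simps)
  ultimately show ?thesis
    using Ck_on_cong[OF assms(1), of "\<lambda>x. f x * (f x * f x) powr (-1)" "\<lambda>x. inverse (f x)" k] by blast
qed

lemma Ck_on_divide:
  assumes "open S" "Ck_on k S f" "Ck_on k S g" "\<And>x. x \<in> S \<Longrightarrow> g x \<noteq> (0::real)"
  shows "Ck_on k S (\<lambda>x. f x / g x)"
  using Ck_on_mult[OF assms(1,2) Ck_on_inverse[OF assms(1,3,4)]] by (simp add: field_simps)

lemma Ck_on_det:
  fixes A :: "'a::real_normed_vector \<Rightarrow> real^'n^'n"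
  assumes "open S" "\<And>i j. Ck_on k S (\<lambda>x. A x $ i $ j)"
  shows "Ck_on k S (\<lambda>x. det (A x))"
  unfolding det_def using assms by (intro Ck_on_sum Ck_on_mult Ck_on_prod Ck_on_const) auto

text \<open>Cramer's rule exhibits the entries of the inverse as quotients of polynomials in the
  entries of A, which is how smoothness passes to the inverse.\<close>

lemma matrix_inv_cramer:
  fixes A :: "real^'n^'n"
  assumes "det A \<noteq> 0"
  shows "matrix_inv A $ k $ l = det (\<chi> i j. if j = k then (if i = l then 1 else 0) else A $ i $ j) / det A"
proof -
  have "A ** matrix_inv A = mat 1"
    using assms matrix_inv_def[of A] someI_ex[of "\<lambda>B. A ** B = mat 1 \<and> B ** A = mat 1"]
    unfolding invertible_det_nz[symmetric] invertible_def by simp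
  then have "A *v column l (matrix_inv A) = axis l 1"
    by (metis matrix_vector_mul_assoc matrix_vector_mul_lid matrix_vector_mult_basis)
  then have "column l (matrix_inv A) = (\<chi> k. det (\<chi> i j. if j = k then axis l 1 $ i else A $ i $ j) / det A)"
    using cramer[OF assms] by simp
  then have "column l (matrix_inv A) $ k = det (\<chi> i j. if j = k then axis l 1 $ i else A $ i $ j) / det A"
    by simp
  moreover have "(\<chi> i j. if j = k then axis l 1 $ i else A $ i $ j) =
      (\<chi> i j. if j = k then (if i = l then 1 else 0) else A $ i $ j)"
    by (simp add: vec_eq_iff axis_def)
  ultimately show ?thesis by (simp add: column_def)
qed

lemma Ck_on_matrix_inv:
  fixes A :: "'a::real_normed_vector \<Rightarrow> real^'n^'n"
  assumes "open S" "\<And>i j. Ck_on k S (\<lambda>x. A x $ i $ j)" "\<And>x. x \<in> S \<Longrightarrow> det (A x) \<noteq> 0"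
  shows "Ck_on k S (\<lambda>x. matrix_inv (A x) $ i $ j)"
proof -
  have "Ck_on k S (\<lambda>x. det (\<chi> i' j'. if j' = i then (if i' = j then 1 else 0) else A x $ i' $ j') / det (A x))"
  proof (intro Ck_on_divide Ck_on_det assms)
    fix i' j'
    show "Ck_on k S (\<lambda>x. (\<chi> i' j'. if j' = i then (if i' = j then 1 else 0) else A x $ i' $ j') $ i' $ j')"
      by (cases "j' = i") (use assms in auto)
  qed auto
  then show ?thesis
    by (subst Ck_on_cong[OF assms(1) matrix_inv_cramer[OF assms(3)]]) auto
qed

lemma smooth_on_Ck: "smooth_on S f \<Longrightarrow> Ck_on k S f"
  by (simp add: smooth_on_def)

lemma smooth_on_frechet_derivative:
  assumes "smooth_on S f"
  shows "smooth_on S (\<lambda>x. frechet_derivative f (at x) v)"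
  unfolding smooth_on_def
proof
  fix k show "Ck_on k S (\<lambda>x. frechet_derivative f (at x) v)"
    using smooth_on_Ck[OF assms, of "Suc k"] by simp
qed

lemma smooth_on_has_derivative:
  assumes "smooth_on S f" "x \<in> S"
  shows "(f has_derivative frechet_derivative f (at x)) (at x)"
  using Ck_on_SucD[OF smooth_on_Ck[OF assms(1)] assms(2)] .

lemma smooth_on_partial: "smooth_on S f \<Longrightarrow> smooth_on S (partial k f)"
  unfolding partial_def[abs_def] by (rule smooth_on_frechet_derivative)

lemma smooth_on_continuous: "smooth_on S f \<Longrightarrow> continuous_on S f"
  using Ck_on_continuous smooth_on_Ck by blast

lemma smooth_on_subset: "smooth_on S f \<Longrightarrow> T \<subseteq> S \<Longrightarrow> smooth_on T f"
  unfolding smooth_on_def using Ck_on_subset by blast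

text \<open>The second difference of f over the parallelogram spanned by h u and h v is symmetric in
  u and v. Two applications of the mean value theorem turn it into h^2 times either mixed derivative
  at points near x, and continuity of the second derivatives lets h tend to 0.\<close>

lemma second_derivative_symmetric:
  fixes f :: "'a::real_normed_vector \<Rightarrow> real"
  assumes S: "open S" "x \<in> S" and f: "Ck_on (Suc (Suc 0)) S f"
  shows "frechet_derivative (\<lambda>y. frechet_derivative f (at y) u) (at x) v
       = frechet_derivative (\<lambda>y. frechet_derivative f (at y) v) (at x) u"
proof -
  define D where "D w y = frechet_derivative f (at y) w" for w y
  define DD where "DD w z y = frechet_derivative (D w) (at y) z" for w z y
  have dirder: "((\<lambda>t. g (p + t *\<^sub>R w)) has_field_derivative frechet_derivative g (at (p + t *\<^sub>R w)) w) (at t)"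
    if "Ck_on (Suc 0) S g" "p + t *\<^sub>R w \<in> S" for g :: "'a \<Rightarrow> real" and p w t
  proof -
    have d: "(g has_derivative frechet_derivative g (at (p + t *\<^sub>R w))) (at (p + t *\<^sub>R w))"
      by (rule Ck_on_SucD[OF that])
    have "((\<lambda>t. p + t *\<^sub>R w) has_derivative (\<lambda>h. h *\<^sub>R w)) (at t)"
      using has_derivative_add[OF has_derivative_const bounded_linear_imp_has_derivative[OF bounded_linear_scaleR_left]]
      by simp
    from has_derivative_compose[OF this d]
    have "((\<lambda>t. g (p + t *\<^sub>R w)) has_derivative (\<lambda>h. frechet_derivative g (at (p + t *\<^sub>R w)) (h *\<^sub>R w))) (at t)" .
    moreover have "(\<lambda>h. frechet_derivative g (at (p + t *\<^sub>R w)) (h *\<^sub>R w)) = (*) (frechet_derivative g (at (p + t *\<^sub>R w)) w)"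
      using linear_scale[OF has_derivative_linear[OF d]] by (auto simp: fun_eq_iff)
    ultimately show ?thesis by (simp only: has_field_derivative_def)
  qed
  have CD: "Ck_on (Suc 0) S (D w)" for w
    using f unfolding D_def[abs_def] by simp
  have main: "\<exists>p. dist p x \<le> h * (norm u + norm v) \<and>
      f (x + h *\<^sub>R u + h *\<^sub>R v) - f (x + h *\<^sub>R u) - f (x + h *\<^sub>R v) + f x = h * h * DD u v p"
    if h: "h > 0" "cball x (h * (norm u + norm v)) \<subseteq> S" for h u v
  proof -
    have inS: "x + s *\<^sub>R u + t *\<^sub>R v \<in> cball x (h * (norm u + norm v))" if "0 \<le> s" "s \<le> h" "0 \<le> t" "t \<le> h" for s t
    proof -
      have "norm (s *\<^sub>R u + t *\<^sub>R v) \<le> s * norm u + t * norm v"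
        by (rule order_trans[OF norm_triangle_ineq]) (use that in auto)
      also have "\<dots> \<le> h * norm u + h * norm v" using that by (intro add_mono mult_right_mono) auto
      finally have "norm (s *\<^sub>R u + t *\<^sub>R v) \<le> h * (norm u + norm v)" by (simp add: distrib_left)
      moreover have "x - (x + s *\<^sub>R u + t *\<^sub>R v) = - (s *\<^sub>R u + t *\<^sub>R v)" by simp
      ultimately show ?thesis by (simp only: mem_cball dist_norm norm_minus_cancel)
    qed
    define \<phi> where "\<phi> s = f ((x + h *\<^sub>R v) + s *\<^sub>R u) - f (x + s *\<^sub>R u)" for s
    have "(\<phi> has_field_derivative D u ((x + h *\<^sub>R v) + s *\<^sub>R u) - D u (x + s *\<^sub>R u)) (at s)"
      if "0 \<le> s" "s \<le> h" for s
    proof -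
      have e: "(x + h *\<^sub>R v) + s *\<^sub>R u = x + s *\<^sub>R u + h *\<^sub>R v" by simp
      have m1: "(x + h *\<^sub>R v) + s *\<^sub>R u \<in> S" unfolding e using inS[OF that, of h] h by auto
      have m2: "x + s *\<^sub>R u \<in> S" using inS[OF that, of 0] h by auto
      show ?thesis
        unfolding \<phi>_def D_def
        by (rule DERIV_diff[OF dirder[OF Ck_on_Suc_imp[OF f] m1] dirder[OF Ck_on_Suc_imp[OF f] m2]])
    qed
    from MVT2[OF h(1), of \<phi>, OF this] obtain s where s: "0 < s" "s < h" and 1: "\<phi> h - \<phi> 0 = (h - 0) * (D u ((x + h *\<^sub>R v) + s *\<^sub>R u) - D u (x + s *\<^sub>R u))"
      by auto
    have "((\<lambda>t. D u ((x + s *\<^sub>R u) + t *\<^sub>R v)) has_field_derivative DD u v ((x + s *\<^sub>R u) + t *\<^sub>R v)) (at t)"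
      if "0 \<le> t" "t \<le> h" for t
    proof -
      have m: "(x + s *\<^sub>R u) + t *\<^sub>R v \<in> S" using h(2) inS[of s t] s that by auto
      show ?thesis unfolding DD_def by (rule dirder[OF CD m])
    qed
    from MVT2[OF h(1), of "\<lambda>t. D u ((x + s *\<^sub>R u) + t *\<^sub>R v)", OF this] obtain t where t: "0 < t" "t < h" and 2: "D u ((x + s *\<^sub>R u) + h *\<^sub>R v) - D u ((x + s *\<^sub>R u) + 0 *\<^sub>R v) = (h - 0) * DD u v ((x + s *\<^sub>R u) + t *\<^sub>R v)"
      by auto
    have 3: "D u ((x + h *\<^sub>R v) + s *\<^sub>R u) - D u (x + s *\<^sub>R u) = h * DD u v ((x + s *\<^sub>R u) + t *\<^sub>R v)"
      using 2 by (simp add: add.assoc add.commute[of "s *\<^sub>R u"])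
    show ?thesis
    proof (intro exI conjI)
      show "dist ((x + s *\<^sub>R u) + t *\<^sub>R v) x \<le> h * (norm u + norm v)"
        using inS[of s t] s t by (simp add: dist_commute)
      have "f (x + h *\<^sub>R u + h *\<^sub>R v) - f (x + h *\<^sub>R u) - f (x + h *\<^sub>R v) + f x = \<phi> h - \<phi> 0"
        unfolding \<phi>_def by (simp add: algebra_simps)
      then show "f (x + h *\<^sub>R u + h *\<^sub>R v) - f (x + h *\<^sub>R u) - f (x + h *\<^sub>R v) + f x
         = h * h * DD u v ((x + s *\<^sub>R u) + t *\<^sub>R v)"
        using 1 3 by simp
    qed
  qed
  have contDD: "continuous_on S (DD w z)" for w z
    using CD[of w] unfolding DD_def[abs_def] by simp
  have "\<not> \<bar>DD u v x - DD v u x\<bar> > e" if "e > 0" for e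
  proof -
    define N where "N = norm u + norm v + 1"
    have N: "N > 0" unfolding N_def by (simp add: add_nonneg_pos)
    have near: "\<exists>d>0. \<forall>y\<in>S. dist y x < d \<longrightarrow> dist (DD w z y) (DD w z x) < e / 2" for w z
      by (rule contDD[of w z, unfolded continuous_on_iff, rule_format, OF S(2)]) (simp add: that)
    obtain d1 where d1: "d1 > 0" "\<forall>y\<in>S. dist y x < d1 \<longrightarrow> dist (DD u v y) (DD u v x) < e / 2"
      using near[of u v] by blast
    obtain d2 where d2: "d2 > 0" "\<forall>y\<in>S. dist y x < d2 \<longrightarrow> dist (DD v u y) (DD v u x) < e / 2"
      using near[of v u] by blast
    obtain d3 where d3: "d3 > 0" "ball x d3 \<subseteq> S" using S openE by blast
    \<comment> \<open>Half the smallest radius, divided by a number exceeding |u| + |v|, keeps the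
      whole parallelogram where all three estimates hold.\<close>
    define h where "h = min d1 (min d2 d3) / (2 * N)"
    have h: "h > 0" unfolding h_def using d1 d2 d3 N by simp
    have "h * (norm u + norm v) \<le> h * N" using h unfolding N_def by (intro mult_left_mono) auto
    also have "\<dots> = min d1 (min d2 d3) / 2" unfolding h_def using N by simp
    also have "\<dots> < min d1 (min d2 d3)" using d1(1) d2(1) d3(1) by (auto simp: min_def)
    finally have hN: "h * (norm u + norm v) < min d1 (min d2 d3)" .
    then have sub: "cball x (h * (norm u + norm v)) \<subseteq> S" using d3(2) by (auto simp: subset_eq)
    obtain p where p: "dist p x \<le> h * (norm u + norm v)" "f (x + h *\<^sub>R u + h *\<^sub>R v) - f (x + h *\<^sub>R u) - f (x + h *\<^sub>R v) + f x = h * h * DD u v p"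
      using main[OF h sub] by blast
    obtain q where q: "dist q x \<le> h * (norm v + norm u)" "f (x + h *\<^sub>R v + h *\<^sub>R u) - f (x + h *\<^sub>R v) - f (x + h *\<^sub>R u) + f x = h * h * DD v u q"
      using main[OF h, of v u] sub by (auto simp: add.commute)
    have "h * h * DD u v p = h * h * DD v u q" using p(2) q(2) by (simp add: algebra_simps)
    then have "DD u v p = DD v u q" using h by simp
    moreover have "p \<in> S" "q \<in> S" using sub p(1) q(1) by (auto simp: dist_commute add.commute)
    moreover have "dist p x < d1" "dist q x < d2" using p q hN by (auto simp: add.commute)
    ultimately have "dist (DD u v p) (DD u v x) < e / 2" "dist (DD u v p) (DD v u x) < e / 2"
      using d1(2) d2(2) by auto
    then show ?thesis unfolding dist_real_def by linarith
  qed
  then have "\<bar>DD u v x - DD v u x\<bar> \<le> 0 + e" if "e > 0" for e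
    using that by (simp add: not_less)
  then have "\<bar>DD u v x - DD v u x\<bar> \<le> 0" by (rule field_le_epsilon)
  then have "DD u v x = DD v u x" by simp
  then show ?thesis unfolding DD_def D_def[abs_def] .
qed

section \<open>Smooth bump functions\<close>

definition flat_exp :: "nat \<Rightarrow> real \<Rightarrow> real" where
  "flat_exp k t = (if t > 0 then inverse t ^ k * exp (- inverse t) else 0)"

lemma flat_exp_tendsto: "(flat_exp k \<longlongrightarrow> 0) (at 0)"
proof -
  have "((\<lambda>t. inverse t ^ k / exp (inverse t)) \<longlongrightarrow> 0) (at_right (0::real))"
    by (rule filterlim_compose[OF tendsto_power_div_exp_0 filterlim_inverse_at_top_right])
  then have r: "(flat_exp k \<longlongrightarrow> 0) (at_right 0)"
    by (rule Lim_transform_eventually)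
      (auto simp: flat_exp_def eventually_at_right_field exp_minus field_simps intro!: exI[of _ 1])
  have l: "(flat_exp k \<longlongrightarrow> 0) (at_left 0)"
    by (rule Lim_transform_eventually[OF tendsto_const])
      (auto simp: flat_exp_def eventually_at_left_field intro!: exI[of _ "-1"])
  show ?thesis using filterlim_split_at[OF l r] .
qed

text \<open>The family is closed under differentiation up to linear combinations; this is why k is
  carried along although bumps use \<open>flat_exp 0\<close>. At 0 the difference quotient of
  \<open>flat_exp k\<close> is \<open>flat_exp (Suc k)\<close>, which tends to 0.\<close>

lemma flat_exp_deriv:
  "(flat_exp k has_field_derivative - real k * flat_exp (Suc k) t + flat_exp (Suc (Suc k)) t) (at t)"
proof -
  consider "t > 0" | "t < 0" | "t = 0" by linarith
  then show ?thesis
  proof cases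
    case 1
    have "((\<lambda>t. inverse t ^ k * exp (- inverse t)) has_field_derivative
       - real k * flat_exp (Suc k) t + flat_exp (Suc (Suc k)) t) (at t)"
      using 1
      apply (cases k)
       apply (auto intro!: derivative_eq_intros simp: flat_exp_def field_simps power2_eq_square)
      apply (metis Suc_pred power_Suc gr0I)
      done
    then show ?thesis
      by (rule has_field_derivative_transform_within_open[of _ _ _ "{0<..}"]) (use 1 in \<open>auto simp: flat_exp_def\<close>)
  next
    case 2
    have "((\<lambda>t. 0) has_field_derivative 0) (at t)" by simp
    then have "(flat_exp k has_field_derivative 0) (at t)"
      by (rule has_field_derivative_transform_within_open[of _ _ _ "{..<0}"]) (use 2 in \<open>auto simp: flat_exp_def\<close>)
    then show ?thesis using 2 by (simp add: flat_exp_def)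
  next
    case 3
    have "((\<lambda>h. (flat_exp k (0 + h) - flat_exp k 0) / h) \<longlongrightarrow> 0) (at 0)"
      by (rule Lim_transform_eventually[OF flat_exp_tendsto[of "Suc k"]])
        (auto simp: eventually_at flat_exp_def field_simps intro!: exI[of _ 1])
    then show ?thesis using 3 by (simp add: DERIV_def flat_exp_def)
  qed
qed

lemma Ck_on_flat_exp: "Ck_on j UNIV (flat_exp k)"
proof (induction j arbitrary: k)
  case 0
  show ?case by (simp add: DERIV_continuous_on[OF has_field_derivative_at_within[OF flat_exp_deriv]])
next
  case (Suc j)
  show ?case
    by (rule Ck_on_SucI[OF open_UNIV flat_exp_deriv[unfolded has_field_derivative_def]])
      (intro Ck_on_mult Ck_on_add Ck_on_const Suc.IH open_UNIV)
qed

text \<open>The squared distance is polynomial in x, so no smoothness of the norm at the centre is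
  at stake.\<close>

definition bump :: "'a::euclidean_space \<Rightarrow> real \<Rightarrow> 'a \<Rightarrow> real" where
  "bump a r x = flat_exp 0 (r\<^sup>2 - (x - a) \<bullet> (x - a))"

lemma Ck_on_bump: "Ck_on k UNIV (bump a r)"
proof -
  have "Ck_on k UNIV (\<lambda>x. x)" by (rule Ck_on_bounded_linear[OF bounded_linear_ident open_UNIV])
  from Ck_on_add[OF open_UNIV this, of "\<lambda>_. - a"]
  have 1: "Ck_on k UNIV (\<lambda>x. x - a)" by simp
  have "Ck_on k UNIV (\<lambda>x. r\<^sup>2 + (- 1) * ((x - a) \<bullet> (x - a)))"
    by (intro Ck_on_add Ck_on_mult Ck_on_const Ck_on_inner 1 open_UNIV)
  from Ck_on_compose[OF open_UNIV open_UNIV this Ck_on_flat_exp[of k 0]]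
  show ?thesis by (simp add: bump_def[abs_def])
qed

lemma bump_nonneg: "bump a r x \<ge> 0" by (simp add: bump_def flat_exp_def)

lemma bump_pos_iff:
  assumes "r > 0"
  shows "bump a r x > 0 \<longleftrightarrow> x \<in> ball a r"
proof -
  have "(x - a) \<bullet> (x - a) = (dist a x)\<^sup>2"
    by (simp add: power2_norm_eq_inner[symmetric] dist_norm norm_minus_commute)
  moreover have "r\<^sup>2 \<le> (dist a x)\<^sup>2 \<longleftrightarrow> r \<le> dist a x"
    using assms by (intro power_mono_iff) auto
  ultimately have "(x - a) \<bullet> (x - a) < r\<^sup>2 \<longleftrightarrow> dist a x < r" by linarith
  then show ?thesis by (simp add: bump_def flat_exp_def)
qed

lemma bump_eq_0: "r > 0 \<Longrightarrow> x \<notin> ball a r \<Longrightarrow> bump a r x = 0"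
  using bump_pos_iff[of r a x] bump_nonneg[of a r x] by simp

text \<open>Bootstrapping: the C^1 theorem yields an inverse g whose derivative at y is the inverse
  of the derivative of f at g y. By Cramer's rule its entries are C^k as soon as g is, so g is
  C^(k+1). The normalised derivative at \<open>x0\<close> is what the flattening map in
  \<open>local_parametrization_exists\<close> provides.\<close>

theorem smooth_inverse_function:
  fixes f :: "real^'n \<Rightarrow> real^'n"
  assumes "open U" "x0 \<in> U" "smooth_on U f" "frechet_derivative f (at x0) = (\<lambda>v. v)"
  obtains U' V g where "open U'" "U' \<subseteq> U" "x0 \<in> U'" "open V" "homeomorphism U' V f g" "smooth_on V g"
    "\<And>y. y \<in> V \<Longrightarrow> (g has_derivative frechet_derivative g (at y)) (at y)"
proof -
  define f' where "f' x = Blinfun (frechet_derivative f (at x))" for x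
  have bl: "bounded_linear (frechet_derivative f (at x))" if "x \<in> U" for x
    using smooth_on_has_derivative[OF assms(3) that] has_derivative_bounded_linear by blast
  have f': "blinfun_apply (f' x) = frechet_derivative f (at x)" if "x \<in> U" for x
    unfolding f'_def using bl[OF that] by (simp add: bounded_linear_Blinfun_apply)
  have derf: "(f has_derivative blinfun_apply (f' x)) (at x)" if "x \<in> U" for x
    using smooth_on_has_derivative[OF assms(3) that] f'[OF that] by simp
  have contf: "continuous_on U f'"
  proof (rule continuous_on_blinfun_componentwise)
    fix i :: "real^'n"
    show "continuous_on U (\<lambda>x. blinfun_apply (f' x) i)"
      by (rule continuous_on_eq[OF smooth_on_continuous[OF smooth_on_frechet_derivative[OF assms(3), of i]]])
        (simp add: f')
  qed
  have inv: "id_blinfun o\<^sub>L f' x0 = id_blinfun"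
    by (rule blinfun_eqI) (simp add: f'[OF assms(2)] assms(4))
  obtain U' V g g' where *: "open U'" "U' \<subseteq> U" "x0 \<in> U'" "open V" "f x0 \<in> V" "homeomorphism U' V f g"
    and g: "\<And>y. y \<in> V \<Longrightarrow> (g has_derivative (g' y)) (at y)"
    and g': "\<And>y. y \<in> V \<Longrightarrow> g' y = inv (blinfun_apply (f'(g y)))"
    and bij: "\<And>y. y \<in> V \<Longrightarrow> bij (blinfun_apply (f'(g y)))"
    using inverse_function_theorem[OF assms(1) derf contf assms(2) inv] by metis
  have gU: "g ` V \<subseteq> U" using *(2,6) unfolding homeomorphism_def by blast
  define M where "M x = matrix (frechet_derivative f (at x))" for x
  have lin: "linear (frechet_derivative f (at (g y)))" if "y \<in> V" for y
    using bl[of "g y"] gU that bounded_linear.linear by blast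
  have Minv: "g' y = (*v) (matrix_inv (M (g y)))" "det (M (g y)) \<noteq> 0" if "y \<in> V" for y
  proof -
    have gy: "g y \<in> U" using gU that by auto
    have b: "bij (frechet_derivative f (at (g y)))" using bij[OF that] f'[OF gy] by simp
    have Mv: "frechet_derivative f (at (g y)) = (*v) (M (g y))"
      unfolding M_def using matrix_vector_mul(2)[OF lin[OF that]] by simp
    have i: "invertible (M (g y))" using b unfolding Mv invertible_eq_bij .
    then show "det (M (g y)) \<noteq> 0" by (simp add: invertible_det_nz)
    have "M (g y) ** matrix_inv (M (g y)) = mat 1"
      using i matrix_inv_def[of "M (g y)"] someI_ex[of "\<lambda>B. M (g y) ** B = mat 1 \<and> B ** M (g y) = mat 1"]
      unfolding invertible_def by simp
    then have "frechet_derivative f (at (g y)) (matrix_inv (M (g y)) *v v) = v" for v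
      by (simp add: Mv matrix_vector_mul_assoc)
    then have "inv (frechet_derivative f (at (g y))) v = matrix_inv (M (g y)) *v v" for v
      using b by (metis bij_inv_eq_iff)
    then show "g' y = (*v) (matrix_inv (M (g y)))" using g'[OF that] f'[OF gy] by (auto simp: fun_eq_iff)
  qed
  have "Ck_on k V g" for k
  proof (induction k)
    case 0 then show ?case using *(6) by (simp add: homeomorphism_def)
  next
    case (Suc k)
    show ?case
    proof (rule Ck_on_SucI[OF *(4) g])
      fix v
      have M: "Ck_on k V (\<lambda>y. M (g y) $ i $ j)" for i j
      proof -
        have "Ck_on k U (\<lambda>x. frechet_derivative f (at x) (axis j 1) $ i)"
          by (intro Ck_on_vec_nth smooth_on_Ck smooth_on_frechet_derivative assms)
        from Ck_on_compose[OF *(4) assms(1) Suc this gU]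
        show ?thesis by (simp add: M_def matrix_def)
      qed
      have "Ck_on k V (\<lambda>y. matrix_inv (M (g y)) *v v)"
      proof (rule Ck_on_vec[OF *(4)])
        fix i
        show "Ck_on k V (\<lambda>y. (matrix_inv (M (g y)) *v v) $ i)"
          unfolding matrix_vector_mult_def vec_lambda_beta
          by (intro Ck_on_sum Ck_on_mult Ck_on_matrix_inv Ck_on_const *(4) M Minv(2))
      qed
      then show "Ck_on k V (\<lambda>y. g' y v)"
        using Ck_on_cong[OF *(4), of "\<lambda>y. g' y v" "\<lambda>y. matrix_inv (M (g y)) *v v" k] Minv(1) by auto
    qed
  qed
  then have "smooth_on V g" by (simp add: smooth_on_def)
  then show ?thesis using that[OF *(1,2,3,4,6)] smooth_on_has_derivative by blast
qed

section \<open>The algebra of superforms\<close>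

lemma eps_Un_left:
  fixes I :: "'n::{finite,linorder} set"
  assumes "I \<inter> I' = {}"
  shows "eps (I \<union> I') K = eps I K * eps I' K"
proof -
  have "{(i, k). i \<in> I \<union> I' \<and> k \<in> K \<and> k < i}
      = {(i, k). i \<in> I \<and> k \<in> K \<and> k < i} \<union> {(i, k). i \<in> I' \<and> k \<in> K \<and> k < i}" by auto
  moreover have "{(i, k). i \<in> I \<and> k \<in> K \<and> k < i} \<inter> {(i, k). i \<in> I' \<and> k \<in> K \<and> k < i} = {}"
    using assms by auto
  ultimately show ?thesis by (simp add: eps_def card_Un_disjoint power_add)
qed

lemma eps_Un_right:
  fixes I :: "'n::{finite,linorder} set"
  assumes "K \<inter> K' = {}"
  shows "eps I (K \<union> K') = eps I K * eps I K'"
proof -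
  have "{(i, k). i \<in> I \<and> k \<in> K \<union> K' \<and> k < i}
      = {(i, k). i \<in> I \<and> k \<in> K \<and> k < i} \<union> {(i, k). i \<in> I \<and> k \<in> K' \<and> k < i}" by auto
  moreover have "{(i, k). i \<in> I \<and> k \<in> K \<and> k < i} \<inter> {(i, k). i \<in> I \<and> k \<in> K' \<and> k < i} = {}"
    using assms by auto
  ultimately show ?thesis by (simp add: eps_def card_Un_disjoint power_add)
qed

lemma eps_empty [simp]: "eps {} K = 1" "eps I {} = 1" by (simp_all add: eps_def)

lemma wedge_sign_Un_left:
  fixes I :: "'n::{finite,linorder} set"
  assumes "I \<inter> I' = {}" "J \<inter> J' = {}"
  shows "wedge_sign (I \<union> I') (J \<union> J') K L = wedge_sign I J K L * wedge_sign I' J' K L"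
  using assms by (simp add: wedge_sign_def eps_Un_left card_Un_disjoint power_add distrib_right)

lemma wedge_sign_Un_right:
  fixes I :: "'n::{finite,linorder} set"
  assumes "K \<inter> K' = {}" "L \<inter> L' = {}"
  shows "wedge_sign I J (K \<union> K') (L \<union> L') = wedge_sign I J K L * wedge_sign I J K' L'"
  using assms by (simp add: wedge_sign_def eps_Un_right card_Un_disjoint power_add distrib_left)

lemma wedge_sign_empty [simp]: "wedge_sign {} {} K L = 1" "wedge_sign I J {} {} = 1"
  by (simp_all add: wedge_sign_def)

lemma wedge_sign_ne_0 [simp]: "wedge_sign I J K L \<noteq> 0"
  by (simp add: wedge_sign_def eps_def)

text \<open>Both sides run over the ordered decompositions of I into three disjoint blocks, indexed
  by a chain K \<subseteq> M \<subseteq> I on the left and by the first two blocks on the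
  right.\<close>

lemma sum_Pow_Pow:
  fixes F :: "'n::finite set \<Rightarrow> 'n set \<Rightarrow> 'n set \<Rightarrow> 'a::comm_monoid_add"
  shows "(\<Sum>M\<in>Pow I. \<Sum>K\<in>Pow M. F K (M - K) (I - M)) = (\<Sum>K\<in>Pow I. \<Sum>M\<in>Pow (I - K). F K M (I - K - M))"
proof -
  have "(\<Sum>(M, K)\<in>Sigma (Pow I) Pow. F K (M - K) (I - M)) = (\<Sum>(K, M)\<in>Sigma (Pow I) (\<lambda>K. Pow (I - K)). F K M (I - K - M))"
    by (rule sum.reindex_bij_witness[of _ "\<lambda>(K, M). (K \<union> M, K)" "\<lambda>(M, K). (K, M - K)"])
      (auto intro!: arg_cong2[of _ _ _ _ "\<lambda>a b. F _ a b"] simp: Un_absorb1)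
  then show ?thesis by (simp add: sum.Sigma)
qed

text \<open>\<open>wedge_sign\<close> is multiplicative under disjoint unions on either side, so
  each bracketing is the sum over decompositions of I and J into three blocks with the product of
  the three pairwise signs.\<close>

lemma swedge_assoc: "(a \<and>\<^sub>s b) \<and>\<^sub>s c = a \<and>\<^sub>s (b \<and>\<^sub>s c)"
proof (intro ext)
  fix I J :: "'a set"
  define F where "F K L M N A B = wedge_sign K L M N * wedge_sign K L A B * wedge_sign M N A B * a K L * b M N * c A B"
    for K L M N A B
  have "((a \<and>\<^sub>s b) \<and>\<^sub>s c) I J = (\<Sum>M\<in>Pow I. \<Sum>N\<in>Pow J. \<Sum>K\<in>Pow M. \<Sum>L\<in>Pow N. F K L (M - K) (N - L) (I - M) (J - N))"
    unfolding swedge_def[of "a \<and>\<^sub>s b"]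
  proof (intro sum.cong refl)
    fix M N assume MN: "M \<in> Pow I" "N \<in> Pow J"
    have "wedge_sign M N (I - M) (J - N) * (wedge_sign K L (M - K) (N - L) * (a K L * b (M - K) (N - L))) * c (I - M) (J - N)
       = F K L (M - K) (N - L) (I - M) (J - N)" if "K \<in> Pow M" "L \<in> Pow N" for K L
    proof -
      have "wedge_sign M N (I - M) (J - N) = wedge_sign K L (I - M) (J - N) * wedge_sign (M - K) (N - L) (I - M) (J - N)"
        using wedge_sign_Un_left[of K "M - K" L "N - L" "I - M" "J - N"] that by (simp add: Un_absorb1 Diff_partition)
      then show ?thesis by (simp add: F_def)
    qed
    note H = this
    show "wedge_sign M N (I - M) (J - N) * ((a \<and>\<^sub>s b) M N * c (I - M) (J - N)) =
       (\<Sum>K\<in>Pow M. \<Sum>L\<in>Pow N. F K L (M - K) (N - L) (I - M) (J - N))"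
      unfolding swedge_def sum_distrib_left sum_distrib_right
      by (intro sum.cong refl) (use H in \<open>simp add: mult.assoc\<close>)
  qed
  also have "\<dots> = (\<Sum>M\<in>Pow I. \<Sum>K\<in>Pow M. \<Sum>N\<in>Pow J. \<Sum>L\<in>Pow N. F K L (M - K) (N - L) (I - M) (J - N))"
    by (rule sum.cong[OF refl], rule sum.swap)
  also have "\<dots> = (\<Sum>K\<in>Pow I. \<Sum>M\<in>Pow (I - K). \<Sum>N\<in>Pow J. \<Sum>L\<in>Pow N. F K L M (N - L) (I - K - M) (J - N))"
    by (rule sum_Pow_Pow)
  also have "\<dots> = (\<Sum>K\<in>Pow I. \<Sum>M\<in>Pow (I - K). \<Sum>L\<in>Pow J. \<Sum>N\<in>Pow (J - L). F K L M N (I - K - M) (J - L - N))"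
    by (intro sum.cong refl sum_Pow_Pow)
  also have "\<dots> = (\<Sum>K\<in>Pow I. \<Sum>L\<in>Pow J. \<Sum>M\<in>Pow (I - K). \<Sum>N\<in>Pow (J - L). F K L M N (I - K - M) (J - L - N))"
    by (rule sum.cong[OF refl], rule sum.swap)
  also have "\<dots> = (a \<and>\<^sub>s (b \<and>\<^sub>s c)) I J"
    unfolding swedge_def[of a]
  proof (intro sum.cong refl)
    fix K L assume KL: "K \<in> Pow I" "L \<in> Pow J"
    have "F K L M N (I - K - M) (J - L - N) = wedge_sign K L (I - K) (J - L) *
       (a K L * (wedge_sign M N (I - K - M) (J - L - N) * (b M N * c (I - K - M) (J - L - N))))"
      if "M \<in> Pow (I - K)" "N \<in> Pow (J - L)" for M N
    proof -
      have "M \<union> (I - K - M) = I - K" "N \<union> (J - L - N) = J - L" using that by auto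
      then have "wedge_sign K L (I - K) (J - L) = wedge_sign K L M N * wedge_sign K L (I - K - M) (J - L - N)"
        using wedge_sign_Un_right[of M "I - K - M" N "J - L - N" K L] by auto
      then show ?thesis by (simp add: F_def)
    qed
    note H = this
    show "(\<Sum>M\<in>Pow (I - K). \<Sum>N\<in>Pow (J - L). F K L M N (I - K - M) (J - L - N)) =
       wedge_sign K L (I - K) (J - L) * (a K L * (b \<and>\<^sub>s c) (I - K) (J - L))"
      unfolding swedge_def sum_distrib_left by (intro sum.cong refl) (use H in simp)
  qed
  finally show "((a \<and>\<^sub>s b) \<and>\<^sub>s c) I J = (a \<and>\<^sub>s (b \<and>\<^sub>s c)) I J" .
qed

lemma swedge_sscalar_left: "sscalar c \<and>\<^sub>s a = (\<lambda>I J. c * a I J)"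
proof (intro ext)
  fix I J :: "'a set"
  have "(sscalar c \<and>\<^sub>s a) I J = (\<Sum>K\<in>{{}}. \<Sum>L\<in>{{}}. wedge_sign K L (I - K) (J - L) * (sscalar c K L * a (I - K) (J - L)))"
    unfolding swedge_def
    by (intro sum.mono_neutral_cong_right) (auto simp: sscalar_def intro!: sum.neutral)
  then show "(sscalar c \<and>\<^sub>s a) I J = c * a I J" by (simp add: sscalar_def)
qed

lemma swedge_sscalar_right: "a \<and>\<^sub>s sscalar c = (\<lambda>I J. c * a I J)"
proof (intro ext)
  fix I J :: "'a set"
  have "(a \<and>\<^sub>s sscalar c) I J = (\<Sum>K\<in>{I}. \<Sum>L\<in>{J}. wedge_sign K L (I - K) (J - L) * (a K L * sscalar c (I - K) (J - L)))"
    unfolding swedge_def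
    by (intro sum.mono_neutral_cong_right) (auto simp: sscalar_def intro!: sum.neutral split: if_splits)
  then show "(a \<and>\<^sub>s sscalar c) I J = c * a I J" by (simp add: sscalar_def)
qed

text \<open>A copy of \<open>sform\<close> on which \<open>\<and>\<^sub>s\<close> can be made the multiplication of a real algebra.\<close>

typedef 'n superform = "UNIV :: ('n set \<Rightarrow> 'n set \<Rightarrow> real) set"
  morphisms coeff_of Superform by simp

setup_lifting type_definition_superform

instantiation superform :: ("{finite,linorder}") real_algebra_1
begin

lift_definition zero_superform :: "'a superform" is "\<lambda>_ _. 0" .
lift_definition one_superform :: "'a superform" is "sscalar 1" .
lift_definition plus_superform :: "'a superform \<Rightarrow> 'a superform \<Rightarrow> 'a superform" is "\<lambda>a b I J. a I J + b I J" .
lift_definition minus_superform :: "'a superform \<Rightarrow> 'a superform \<Rightarrow> 'a superform" is "\<lambda>a b I J. a I J - b I J" .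
lift_definition uminus_superform :: "'a superform \<Rightarrow> 'a superform" is "\<lambda>a I J. - a I J" .
lift_definition times_superform :: "'a superform \<Rightarrow> 'a superform \<Rightarrow> 'a superform" is swedge .
lift_definition scaleR_superform :: "real \<Rightarrow> 'a superform \<Rightarrow> 'a superform" is "\<lambda>c a I J. c * a I J" .

instance
proof
  fix a b c :: "'a superform" and r s :: real
  show "a * b * c = a * (b * c)" by transfer (rule swedge_assoc)
  show "1 * a = a" by transfer (simp add: swedge_sscalar_left)
  show "a * 1 = a" by transfer (simp add: swedge_sscalar_right)
  show "(a + b) * c = a * c + b * c"
    by transfer (simp add: swedge_def fun_eq_iff sum.distrib algebra_simps)
  show "a * (b + c) = a * b + a * c"
    by transfer (simp add: swedge_def fun_eq_iff sum.distrib algebra_simps)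
  show "(0::'a superform) \<noteq> 1" by transfer (auto simp: sscalar_def fun_eq_iff)
  show "r *\<^sub>R a * b = r *\<^sub>R (a * b)"
    by transfer (simp add: swedge_def fun_eq_iff sum_distrib_left ac_simps)
  show "a * r *\<^sub>R b = r *\<^sub>R (a * b)"
    by transfer (simp add: swedge_def fun_eq_iff sum_distrib_left ac_simps)
qed (transfer; simp add: fun_eq_iff algebra_simps)+

end

lemma coeff_of_sum: "coeff_of (\<Sum>i\<in>A. f i) I J = (\<Sum>i\<in>A. coeff_of (f i) I J)"
  by (induction A rule: infinite_finite_induct) (auto simp: zero_superform.rep_eq plus_superform.rep_eq)

lemma coeff_of_power: "coeff_of (a ^ k) = swedge_power (coeff_of a) k"
  by (induction k) (auto simp: one_superform.rep_eq times_superform.rep_eq)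

text \<open>The monomial dx_A \<and> d\<xi>_B. Commutation rules are checked on monomials and then
  extended bilinearly.\<close>

lift_definition smono :: "'n::{finite,linorder} set \<Rightarrow> 'n set \<Rightarrow> 'n superform" is
  "\<lambda>A B I J. if I = A \<and> J = B then 1 else 0" .

abbreviation "X k \<equiv> smono {k} {}"
abbreviation "Y k \<equiv> smono {} {k}"

lemma coeff_of_X: "coeff_of (X k) = dx k" by transfer (auto simp: dx_def)
lemma coeff_of_Y: "coeff_of (Y k) = dxi k" by transfer (auto simp: dxi_def)

lemma smono_mult:
  "smono A B * smono C D = (if A \<inter> C = {} \<and> B \<inter> D = {} then wedge_sign A B C D *\<^sub>R smono (A \<union> C) (B \<union> D) else 0)"
proof (transfer, intro ext)
  fix A B C D I J :: "'a set"
  define c where "c = (if I - A = C \<and> J - B = D then wedge_sign A B C D else 0)"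
  have "(\<Sum>L\<in>Pow J. wedge_sign K L (I - K) (J - L) *
      ((if K = A \<and> L = B then 1 else 0) * (if I - K = C \<and> J - L = D then 1 else 0)))
     = (if K = A then (if B \<subseteq> J then c else 0) else 0)" for K
  proof (cases "K = A")
    case True
    have "(\<Sum>L\<in>Pow J. wedge_sign K L (I - K) (J - L) *
      ((if K = A \<and> L = B then 1 else 0) * (if I - K = C \<and> J - L = D then 1 else 0)))
      = (\<Sum>L\<in>Pow J. if L = B then c else 0)"
      by (intro sum.cong refl) (auto simp: True c_def)
    then show ?thesis using True by simp
  qed simp
  then have "((\<lambda>I J. if I = A \<and> J = B then 1 else 0) \<and>\<^sub>s (\<lambda>I J. if I = C \<and> J = D then 1 else 0)) I J
     = (if A \<subseteq> I \<and> B \<subseteq> J \<and> I - A = C \<and> J - B = D then wedge_sign A B C D else 0)"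
    by (simp add: swedge_def sum.delta c_def)
  also have "\<dots> = (if A \<inter> C = {} \<and> B \<inter> D = {} then \<lambda>I J. wedge_sign A B C D * (if I = A \<union> C \<and> J = B \<union> D then 1 else 0) else (\<lambda>_ _. 0)) I J"
    by (auto simp: Un_Diff)
  finally show "((\<lambda>I J. if I = A \<and> J = B then 1 else 0) \<and>\<^sub>s (\<lambda>I J. if I = C \<and> J = D then 1 else 0)) I J = 
    (if A \<inter> C = {} \<and> B \<inter> D = {} then \<lambda>I J. wedge_sign A B C D * (if I = A \<union> C \<and> J = B \<union> D then 1 else 0) else (\<lambda>_ _. 0)) I J" .
qed

lemma eps_singleton: "eps {i} {k} = (if k < i then - 1 else 1)"
proof -
  have "{(a, b). a \<in> {i} \<and> b \<in> {k} \<and> b < a} = (if k < i then {(i, k)} else {})" by auto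
  then show ?thesis by (simp add: eps_def)
qed

lemma X_X: "X j * X k = - (X k * X j)"
  by (cases "j = k") (auto simp: smono_mult wedge_sign_def eps_singleton insert_commute)
lemma Y_Y: "Y j * Y k = - (Y k * Y j)"
  by (cases "j = k") (auto simp: smono_mult wedge_sign_def eps_singleton insert_commute)
lemma Y_X: "Y j * X k = - (X k * Y j)"
  by (auto simp: smono_mult wedge_sign_def)

text \<open>\<open>xform v\<close> is the 1-form with coefficients v, and \<open>yform v\<close> is
  its image under J (see \<open>Jop_xform\<close>).\<close>

definition xform :: "real^'n::{finite,linorder} \<Rightarrow> 'n superform" where
  "xform v = (\<Sum>k\<in>UNIV. v $ k *\<^sub>R X k)"
definition yform :: "real^'n::{finite,linorder} \<Rightarrow> 'n superform" where
  "yform v = (\<Sum>k\<in>UNIV. v $ k *\<^sub>R Y k)"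

lemma xform_mult_xform: "xform v * xform w = - (xform w * xform v)"
proof -
  have "xform v * xform w = (\<Sum>j\<in>UNIV. \<Sum>k\<in>UNIV. (v $ j * w $ k) *\<^sub>R (X j * X k))"
    unfolding xform_def by (simp add: sum_product mult.commute)
  also have "\<dots> = (\<Sum>k\<in>UNIV. \<Sum>j\<in>UNIV. (v $ j * w $ k) *\<^sub>R (X j * X k))" by (rule sum.swap)
  also have "\<dots> = - (xform w * xform v)"
    unfolding xform_def sum_product sum_negf[symmetric]
    by (intro sum.cong refl, subst X_X, simp add: mult.commute)
  finally show ?thesis .
qed

lemma yform_mult_yform: "yform v * yform w = - (yform w * yform v)"
proof -
  have "yform v * yform w = (\<Sum>j\<in>UNIV. \<Sum>k\<in>UNIV. (v $ j * w $ k) *\<^sub>R (Y j * Y k))"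
    unfolding yform_def by (simp add: sum_product mult.commute)
  also have "\<dots> = (\<Sum>k\<in>UNIV. \<Sum>j\<in>UNIV. (v $ j * w $ k) *\<^sub>R (Y j * Y k))" by (rule sum.swap)
  also have "\<dots> = - (yform w * yform v)"
    unfolding yform_def sum_product sum_negf[symmetric]
    by (intro sum.cong refl, subst Y_Y, simp add: mult.commute)
  finally show ?thesis .
qed

lemma yform_mult_xform: "yform v * xform w = - (xform w * yform v)"
proof -
  have "yform v * xform w = (\<Sum>j\<in>UNIV. \<Sum>k\<in>UNIV. (v $ j * w $ k) *\<^sub>R (Y j * X k))"
    unfolding yform_def xform_def by (simp add: sum_product mult.commute)
  also have "\<dots> = (\<Sum>k\<in>UNIV. \<Sum>j\<in>UNIV. (v $ j * w $ k) *\<^sub>R (Y j * X k))" by (rule sum.swap)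
  also have "\<dots> = - (xform w * yform v)"
    unfolding yform_def xform_def sum_product sum_negf[symmetric]
    by (intro sum.cong refl, subst Y_X, simp add: mult.commute)
  finally show ?thesis .
qed

section \<open>Powers of beta and orthonormal coframes\<close>

text \<open>Terms of degree at least 2 in z vanish, so only the first two terms of the binomial
  formula remain.\<close>

lemma power_add_square_zero:
  fixes s z :: "'a::real_algebra_1"
  assumes "s * z = z * s" "z * z = 0"
  shows "(s + z) ^ Suc k = s ^ Suc k + real (Suc k) *\<^sub>R (s ^ k * z)"
proof (induction k)
  case (Suc k)
  have c: "s ^ k * z = z * s ^ k" for k using power_commuting_commutes[OF assms(1)] .
  have zz: "z * (z * a) = 0" for a using assms(2) by (simp flip: mult.assoc)
  have "(s + z) ^ Suc (Suc k) = (s + z) * (s ^ Suc k + real (Suc k) *\<^sub>R (s ^ k * z))"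
    by (metis Suc power_Suc)
  also have "\<dots> = s * s ^ Suc k + z * s ^ Suc k + real (Suc k) *\<^sub>R (s * (s ^ k * z) + z * (s ^ k * z))"
    by (simp only: distrib_left distrib_right mult_scaleR_right scaleR_add_right)
  also have "z * s ^ Suc k = s ^ Suc k * z" by (rule c[symmetric])
  also have "z * (s ^ k * z) = 0" unfolding c by (rule zz)
  also have "s * (s ^ k * z) = s ^ Suc k * z" by (simp add: mult.assoc)
  also have "s * s ^ Suc k + s ^ Suc k * z + real (Suc k) *\<^sub>R (s ^ Suc k * z + 0)
      = s ^ Suc (Suc k) + real (Suc (Suc k)) *\<^sub>R (s ^ Suc k * z)"
    unfolding of_nat_Suc[of "Suc k"] scaleR_add_left by (simp only: add_0_right scaleR_one add.assoc power_Suc)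
  finally show ?case .
qed simp

lemma commute_sum:
  fixes e :: "'i \<Rightarrow> 'a::semiring_0"
  assumes "\<And>i. i \<in> S \<Longrightarrow> e i * z = z * e i"
  shows "(\<Sum>i\<in>S. e i) * z = z * (\<Sum>i\<in>S. e i)"
  using assms by (simp add: sum_distrib_left sum_distrib_right)

text \<open>A product of more factors than there are summands repeats one of them. The induction
  splits off one summand; both remaining binomial terms contain the vanishing power of the
  rest.\<close>

lemma sum_square_zero_nilpotent:
  fixes e :: "'i \<Rightarrow> 'a::real_algebra_1"
  assumes "finite S" "\<And>i j. e i * e j = e j * e i" "\<And>i. e i * e i = 0"
  shows "(\<Sum>i\<in>S. e i) ^ Suc (card S) = 0"
  using assms(1)
proof (induction S)
  case (insert i S)
  let ?s = "\<Sum>j\<in>S. e j"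
  have c: "?s * e i = e i * ?s" by (rule commute_sum) (rule assms(2))
  have "(?s + e i) ^ Suc (Suc (card S)) = ?s * ?s ^ Suc (card S) + real (Suc (Suc (card S))) *\<^sub>R (?s ^ Suc (card S) * e i)"
    using power_add_square_zero[OF c assms(3), of "Suc (card S)"] by simp
  also have "\<dots> = 0" unfolding insert.IH by simp
  finally show ?case using insert by (simp add: add.commute)
qed simp

text \<open>Only square-free products survive, and the product of all r elements arises in r!
  orders. \<open>prod_list\<close> appears because the ambient algebra is not commutative; it is the
  e i that commute with each other.\<close>

lemma sum_square_zero_power:
  fixes e :: "nat \<Rightarrow> 'a::real_algebra_1"
  assumes "\<And>i j. e i * e j = e j * e i" "\<And>i. e i * e i = 0"
  shows "(\<Sum>i\<in>{a..<a + r}. e i) ^ r = fact r *\<^sub>R prod_list (map e [a..<a + r])"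
proof (induction r)
  case (Suc r)
  let ?s = "\<Sum>j\<in>{a..<a + r}. e j"
  have c: "?s * e i = e i * ?s" for i by (rule commute_sum) (rule assms(1))
  have 0: "?s ^ Suc r = 0"
    using sum_square_zero_nilpotent[of "{a..<a + r}" e] assms by simp
  have "(\<Sum>i\<in>{a..<a + Suc r}. e i) = ?s + e (a + r)"
    by simp
  then have "(\<Sum>i\<in>{a..<a + Suc r}. e i) ^ Suc r = real (Suc r) *\<^sub>R (?s ^ r * e (a + r))"
    using power_add_square_zero[OF c assms(2), of "a + r" r] 0 by (simp only: add_0)
  also have "\<dots> = fact (Suc r) *\<^sub>R prod_list (map e [a..<a + Suc r])"
    unfolding Suc.IH by (simp add: mult.commute)
  finally show ?case .
qed simp

lemma self_neg_eq_0: 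
  fixes a :: "'a::real_vector"
  assumes "a = - a"
  shows "a = 0"
proof -
  have "2 *\<^sub>R a = a + a" by (rule scaleR_2)
  also have "\<dots> = 0" using assms by (metis add.right_inverse)
  finally show ?thesis by simp
qed

abbreviation eform :: "real^'n::{finite,linorder} \<Rightarrow> 'n superform" where
  "eform v \<equiv> xform v * yform v"

lemma xform_square: "xform v * xform v = 0" by (rule self_neg_eq_0) (rule xform_mult_xform)
lemma yform_square: "yform v * yform v = 0" by (rule self_neg_eq_0) (rule yform_mult_yform)

lemma eform_xform: "eform v * xform w = xform w * eform v"
proof -
  have "eform v * xform w = - (xform v * xform w) * yform v"
    by (simp add: mult.assoc yform_mult_xform)
  also have "\<dots> = xform w * xform v * yform v" by (subst xform_mult_xform) simp
  finally show ?thesis by (simp add: mult.assoc)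
qed

lemma eform_yform: "eform v * yform w = yform w * eform v"
proof -
  have "eform v * yform w = - (xform v * yform w * yform v)"
    by (simp add: mult.assoc yform_mult_yform[of v w])
  also have "\<dots> = yform w * xform v * yform v" by (simp add: yform_mult_xform)
  finally show ?thesis by (simp add: mult.assoc)
qed

lemma eform_eform: "eform v * eform w = eform w * eform v"
proof -
  have "eform v * eform w = (eform v * xform w) * yform w" by (simp only: mult.assoc)
  also have "\<dots> = (xform w * eform v) * yform w" by (simp only: eform_xform)
  also have "\<dots> = xform w * (eform v * yform w)" by (simp only: mult.assoc)
  also have "\<dots> = xform w * (yform w * eform v)" by (simp only: eform_yform)
  also have "\<dots> = eform w * eform v" by (simp only: mult.assoc)
  finally show ?thesis .
qed

lemma eform_xform_self: "eform v * xform v = 0"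
  unfolding eform_xform by (simp add: xform_square flip: mult.assoc)

lemma eform_yform_self: "eform v * yform v = 0"
  by (simp add: yform_square mult.assoc)

lemma eform_square: "eform v * eform v = 0"
  by (simp add: eform_xform_self flip: mult.assoc)

text \<open>\<open>csign p\<close> is the sign of the shuffle that pairs each x-factor with its
  y-factor: in the induction the new x-factor passes p odd factors on its way to its
  partner.\<close>

lemma prod_xform_yform:
  "csign p *\<^sub>R (prod_list (map (\<lambda>i. xform (w i)) [0..<p]) * prod_list (map (\<lambda>i. yform (w i)) [0..<p]))
    = prod_list (map (\<lambda>i. eform (w i)) [0..<p])"
proof (induction p)
  case 0 then show ?case by (simp add: csign_def)
next
  case (Suc p)
  let ?U = "prod_list (map (\<lambda>i. xform (w i)) [0..<p])" and ?V = "prod_list (map (\<lambda>i. yform (w i)) [0..<p])"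
  have com: "xform x * prod_list (map (\<lambda>i. yform (w i)) [0..<q])
      = (-1) ^ q *\<^sub>R (prod_list (map (\<lambda>i. yform (w i)) [0..<q]) * xform x)" for x q
  proof (induction q)
    case (Suc q)
    let ?W = "prod_list (map (\<lambda>i. yform (w i)) [0..<q])"
    have "xform x * (?W * yform (w q)) = (-1) ^ q *\<^sub>R (?W * (xform x * yform (w q)))"
      using Suc by (simp flip: mult.assoc)
    also have "xform x * yform (w q) = - (yform (w q) * xform x)" by (simp add: yform_mult_xform)
    finally show ?case by (simp add: mult.assoc)
  qed simp
  \<comment> \<open>Passing p odd factors adds p to the exponent; p = 0 is separate because of
    truncated subtraction.\<close>
  have "(Suc p * (Suc p - 1)) div 2 = p * (p - 1) div 2 + p"
  proof (cases p)
    case (Suc q)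
    have "Suc p * (Suc p - 1) = p * (p - 1) + 2 * p" unfolding Suc by (simp add: algebra_simps)
    then show ?thesis by simp
  qed simp
  then have c: "csign (Suc p) = csign p * (-1) ^ p" by (simp add: csign_def power_add)
  have "(?U * xform (w p)) * (?V * yform (w p)) = ?U * ((xform (w p) * ?V) * yform (w p))"
    by (simp only: mult.assoc)
  also have "\<dots> = (-1) ^ p *\<^sub>R ((?U * ?V) * eform (w p))"
    unfolding com by (simp add: mult.assoc)
  finally have "csign (Suc p) *\<^sub>R ((?U * xform (w p)) * (?V * yform (w p)))
      = (csign p * ((-1) ^ p * (-1) ^ p)) *\<^sub>R ((?U * ?V) * eform (w p))"
    by (simp add: c mult.assoc)
  also have "\<dots> = (csign p *\<^sub>R (?U * ?V)) * eform (w p)"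
    by (simp add: power_mult_distrib[symmetric])
  finally show ?case using Suc by simp
qed

definition pform :: "('n \<Rightarrow> 'n \<Rightarrow> real) \<Rightarrow> 'n::{finite,linorder} superform" where
  "pform P = (\<Sum>k\<in>UNIV. \<Sum>l\<in>UNIV. P k l *\<^sub>R (X k * Y l))"

lemma sum_eform: "(\<Sum>i\<in>S. eform (w i)) = pform (\<lambda>k l. \<Sum>i\<in>S. w i $ k * w i $ l)"
proof -
  have "(\<Sum>i\<in>S. eform (w i)) = (\<Sum>i\<in>S. \<Sum>k\<in>UNIV. \<Sum>l\<in>UNIV. (w i $ k * w i $ l) *\<^sub>R (X k * Y l))"
    unfolding xform_def yform_def sum_product by (simp add: mult.commute)
  also have "\<dots> = (\<Sum>k\<in>UNIV. \<Sum>l\<in>UNIV. \<Sum>i\<in>S. (w i $ k * w i $ l) *\<^sub>R (X k * Y l))"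
    by (subst sum.swap) (intro sum.cong refl sum.swap)
  finally show ?thesis by (simp add: pform_def scaleR_left.sum)
qed

lemma coeff_of_beta: "coeff_of (pform (\<lambda>k l. if k = l then 1 else 0)) = (beta :: 'n::{finite,linorder} sform)"
proof (intro ext)
  fix I J :: "'n set"
  have eq: "pform (\<lambda>k l. if k = l then 1 else 0) = (\<Sum>k\<in>UNIV. X k * Y k :: 'n superform)"
    by (simp add: pform_def if_distrib[of "\<lambda>c. c *\<^sub>R _"] cong: if_cong)
  show "coeff_of (pform (\<lambda>k l. if k = l then 1 else 0)) I J = beta I J"
    unfolding eq by (simp add: coeff_of_sum beta_def times_superform.rep_eq coeff_of_X coeff_of_Y)
qed

text \<open>By induction over S, the partial sum over S raised to \<open>card S\<close> is a
  non-zero multiple of the monomial with index sets S and S: the new summand squares to 0 and enters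
  linearly, with the factor card S + 1. Signs stay unevaluated, as only non-vanishing is
  claimed.\<close>

lemma beta_power_top: "coeff_of (pform (\<lambda>k l. if k = l then 1 else 0) ^ CARD('n)) UNIV (UNIV::'n::{finite,linorder} set) \<noteq> 0"
proof -
  have "\<exists>c. c \<noteq> 0 \<and> (\<Sum>k\<in>S. X k * Y k) ^ card S = c *\<^sub>R smono S S" if "finite S" for S :: "'n set"
    using that
  proof (induction S)
    case empty
    have "1 = (smono {} {} :: 'n superform)" by transfer (auto simp: sscalar_def)
    then show ?case by (auto intro!: exI[of _ 1])
  next
    case (insert i S)
    let ?e = "\<lambda>k. X k * Y k :: 'n superform" and ?s = "\<Sum>k\<in>S. X k * Y k :: 'n superform"
    have com: "?e j * ?e k = ?e k * ?e j" for j k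
    proof -
      have "?e v = eform (axis v 1)" for v
        by (simp add: xform_def yform_def axis_def if_distrib[of "\<lambda>c. c *\<^sub>R _"] cong: if_cong)
      then show ?thesis using eform_eform by metis
    qed
    have sq: "?e j * ?e j = 0" for j
      by (simp add: smono_mult)
    have c: "?s * ?e i = ?e i * ?s" by (rule commute_sum) (rule com)
    obtain c where c0: "c \<noteq> 0" "?s ^ card S = c *\<^sub>R smono S S" using insert by auto
    have "?s ^ Suc (card S) = 0"
      by (rule sum_square_zero_nilpotent[OF insert(1) com sq])
    then have "(?s + ?e i) ^ Suc (card S) = real (Suc (card S)) *\<^sub>R (?s ^ card S * ?e i)"
      using power_add_square_zero[OF c sq, of "card S"] by simp
    also have "\<dots> = (real (Suc (card S)) * c) *\<^sub>R (smono S S * ?e i)"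
      by (simp add: c0(2))
    also have "smono S S * ?e i = (wedge_sign {i} {} {} {i} * wedge_sign S S {i} {i}) *\<^sub>R smono (insert i S) (insert i S)"
      using insert by (simp add: smono_mult)
    finally have "(?s + ?e i) ^ Suc (card S) = (real (Suc (card S)) * c * (wedge_sign {i} {} {} {i} * wedge_sign S S {i} {i})) *\<^sub>R smono (insert i S) (insert i S)"
      by simp
    moreover have "real (Suc (card S)) * c * (wedge_sign {i} {} {} {i} * wedge_sign S S {i} {i}) \<noteq> 0"
      using c0 by simp
    ultimately show ?case
      unfolding sum.insert[OF insert(1,2)] card_insert_disjoint[OF insert(1,2)] add.commute[of "?e i" ?s] by blast
  qed
  from this[of UNIV] obtain c where "c \<noteq> 0" "(\<Sum>k\<in>UNIV. X k * Y k) ^ CARD('n) = c *\<^sub>R smono UNIV (UNIV::'n set)"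
    by auto
  moreover have "pform (\<lambda>k l. if k = l then 1 else 0) = (\<Sum>k\<in>UNIV. X k * Y k :: 'n superform)"
    by (simp add: pform_def if_distrib[of "\<lambda>c. c *\<^sub>R _"] cong: if_cong)
  ultimately show ?thesis by (simp add: scaleR_superform.rep_eq smono.rep_eq)
qed

text \<open>Induction on the number of missing vectors: p < DIM vectors cannot span, so some
  non-zero vector is orthogonal to all of them; it is normalised and appended.\<close>

lemma extend_orthonormal:
  fixes w :: "nat \<Rightarrow> 'a::euclidean_space"
  assumes "p \<le> DIM('a)" "\<forall>i<p. \<forall>j<p. w i \<bullet> w j = (if i = j then 1 else 0)"
  shows "\<exists>w'. (\<forall>i<DIM('a). \<forall>j<DIM('a). w' i \<bullet> w' j = (if i = j then 1 else 0)) \<and> (\<forall>i<p. w' i = w i)"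
  using assms
proof (induction "DIM('a) - p" arbitrary: p w)
  case 0
  then show ?case by (auto intro!: exI[of _ w])
next
  case (Suc d)
  have "dim (w ` {..<p}) \<le> card (w ` {..<p})" by (intro dim_le_card') auto
  also have "\<dots> \<le> p" using card_image_le[of "{..<p}" w] by simp
  also have "p < DIM('a)" using Suc(2) by simp
  finally obtain x where x: "x \<noteq> 0" "\<And>y. y \<in> span (w ` {..<p}) \<Longrightarrow> orthogonal x y"
    using orthogonal_to_subspace_exists by blast
  define w1 where "w1 = w(p := x /\<^sub>R norm x)"
  have o: "x \<bullet> w i = 0" if "i < p" for i
    using x(2)[of "w i"] that span_base[of "w i" "w ` {..<p}"] by (auto simp: orthogonal_def)
  have xx: "(x /\<^sub>R norm x) \<bullet> (x /\<^sub>R norm x) = 1"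
    using x(1) by (simp add: dot_square_norm power2_eq_square)
  have "\<exists>w'. (\<forall>i<DIM('a). \<forall>j<DIM('a). w' i \<bullet> w' j = (if i = j then 1 else 0)) \<and> (\<forall>i<Suc p. w' i = w1 i)"
  proof (rule Suc(1))
    show "d = DIM('a) - Suc p" using Suc(2) by simp
    show "Suc p \<le> DIM('a)" using Suc(2) by simp
    show "\<forall>i<Suc p. \<forall>j<Suc p. w1 i \<bullet> w1 j = (if i = j then 1 else 0)"
    proof (intro allI impI)
      fix i j assume "i < Suc p" "j < Suc p"
      then consider "i < p" "j < p" | "i = p" "j < p" | "i < p" "j = p" | "i = p" "j = p" by linarith
      then show "w1 i \<bullet> w1 j = (if i = j then 1 else 0)"
        by cases (use Suc(4) o xx in \<open>simp_all add: w1_def inner_commute[of "w i" x]\<close>)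
    qed
  qed
  then obtain w' where w': "\<forall>i<DIM('a). \<forall>j<DIM('a). w' i \<bullet> w' j = (if i = j then 1 else 0)" "\<forall>i<Suc p. w' i = w1 i"
    by blast
  have "\<forall>i<p. w' i = w i" using w'(2) by (simp add: w1_def)
  with w'(1) show ?case by blast
qed

lemma orthonormal_full:
  fixes w :: "nat \<Rightarrow> 'a::euclidean_space"
  assumes "\<forall>i<DIM('a). \<forall>j<DIM('a). w i \<bullet> w j = (if i = j then 1 else 0)"
  shows "(\<Sum>i<DIM('a). (x \<bullet> w i) *\<^sub>R w i) = x"
proof -
  let ?B = "w ` {..<DIM('a)}"
  have inj: "inj_on w {..<DIM('a)}"
  proof (rule inj_onI)
    fix i j assume "i \<in> {..<DIM('a)}" "j \<in> {..<DIM('a)}" "w i = w j"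
    then show "i = j" using assms by (metis lessThan_iff zero_neq_one)
  qed
  have po: "pairwise orthogonal ?B"
    using assms inj by (auto simp: pairwise_def orthogonal_def)
  have nm: "norm i = 1" if "i \<in> ?B" for i
    using that assms by (auto simp: norm_eq_1)
  have "independent ?B"
    by (rule pairwise_orthogonal_independent[OF po]) (use nm in fastforce)
  moreover have "card ?B = DIM('a)" using inj by (simp add: card_image)
  ultimately have "span ?B = UNIV"
    by (metis dim_UNIV dim_eq_card_independent dim_eq_full)
  then have "(\<Sum>b\<in>?B. (x \<bullet> b) *\<^sub>R b) = x"
    by (intro orthonormal_basis_expand po nm) auto
  then show ?thesis by (simp add: sum.reindex[OF inj])
qed

section \<open>Conormal forms, the operator J and the form n \<and> n^#\<close>

definition grad :: "(real^'n \<Rightarrow> real) \<Rightarrow> real^'n::finite \<Rightarrow> real^'n" where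
  "grad \<rho> x = (\<chi> k. partial k \<rho> x)"

lemma partial_const [simp]: "partial k (\<lambda>_. c) x = 0"
  by (simp add: partial_def)

lemma partial_sscalar: "partial k (\<lambda>y. sscalar (f y) K L) x = sscalar (partial k f x) K L"
  by (cases "K = {}"; cases "L = {}") (simp_all add: sscalar_def)

lemma conormal_eq: "conormal \<rho> x = coeff_of (xform (grad \<rho> x))"
proof (intro ext)
  fix I J :: "'a set"
  show "conormal \<rho> x I J = coeff_of (xform (grad \<rho> x)) I J"
    unfolding conormal_def sd_def xform_def coeff_of_sum
    by (simp add: partial_sscalar swedge_sscalar_right scaleR_superform.rep_eq coeff_of_X grad_def)
qed

lemma coeff_of_xform: "coeff_of (xform v) I J = (\<Sum>k\<in>UNIV. if I = {k} \<and> J = {} then v $ k else 0)"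
  unfolding xform_def coeff_of_sum
  by (intro sum.cong refl) (simp add: scaleR_superform.rep_eq smono.rep_eq)

lemma coeff_of_yform: "coeff_of (yform v) I J = (\<Sum>k\<in>UNIV. if I = {} \<and> J = {k} then v $ k else 0)"
  unfolding yform_def coeff_of_sum
  by (intro sum.cong refl) (simp add: scaleR_superform.rep_eq smono.rep_eq)

lemma dual_vector_conormal: "dual_vector (conormal \<rho> x) = grad \<rho> x"
  by (simp add: dual_vector_def conormal_eq coeff_of_xform vec_eq_iff)

lemma Jop_xform: "Jop (coeff_of (xform v)) = coeff_of (yform v)"
proof (intro ext)
  fix I K :: "'a set"
  show "Jop (coeff_of (xform v)) I K = coeff_of (yform v) I K"
    by (cases "I = {}") (auto simp: Jop_def coeff_of_xform coeff_of_yform)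
qed

text \<open>On forms without d\<xi>, J merely moves the coefficient of dx_K to d\<xi>_K: for I = {}
  the sign in \<open>Jop\<close> is 1, so nothing obstructs multiplicativity. The second conclusion
  keeps the hypothesis available for further factors.\<close>

lemma Jop_swedge:
  assumes "\<And>I J. J \<noteq> {} \<Longrightarrow> a I J = 0" "\<And>I J. J \<noteq> {} \<Longrightarrow> b I J = 0"
  shows "Jop (a \<and>\<^sub>s b) = Jop a \<and>\<^sub>s Jop b" "\<And>I J. J \<noteq> {} \<Longrightarrow> (a \<and>\<^sub>s b) I J = 0"
proof -
  show z: "(a \<and>\<^sub>s b) I J = 0" if "J \<noteq> {}" for I J
    unfolding swedge_def
  proof (intro sum.neutral ballI)
    fix K L assume "L \<in> Pow J"
    then have "L \<noteq> {} \<or> J - L \<noteq> {}" using that by auto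
    then show "wedge_sign K L (I - K) (J - L) * (a K L * b (I - K) (J - L)) = 0"
      using assms(1)[where I=K and J=L] assms(2)[where I="I - K" and J="J - L"] by auto
  qed
  show "Jop (a \<and>\<^sub>s b) = Jop a \<and>\<^sub>s Jop b"
  proof (intro ext)
    fix I K :: "'a set"
    have Ja: "I \<noteq> {} \<Longrightarrow> Jop a I K = 0" "I \<noteq> {} \<Longrightarrow> Jop b I K = 0" for I K
      using assms by (auto simp: Jop_def)
    show "Jop (a \<and>\<^sub>s b) I K = (Jop a \<and>\<^sub>s Jop b) I K"
    proof (cases "I = {}")
      case True
      have "Jop (a \<and>\<^sub>s b) I K = (\<Sum>M\<in>Pow K. eps M (K - M) * (a M {} * b (K - M) {}))"
        using True by (simp add: Jop_def swedge_def wedge_sign_def)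
      also have "\<dots> = (Jop a \<and>\<^sub>s Jop b) I K"
        using True by (simp add: Jop_def swedge_def wedge_sign_def)
      finally show ?thesis .
    next
      case False
      have "(Jop a \<and>\<^sub>s Jop b) I K = 0"
        unfolding swedge_def
      proof (intro sum.neutral ballI)
        fix M L assume "M \<in> Pow I"
        then have "M \<noteq> {} \<or> I - M \<noteq> {}" using False by auto
        then show "wedge_sign M L (I - M) (K - L) * (Jop a M L * Jop b (I - M) (K - L)) = 0"
          using Ja(1)[of M L] Ja(2)[of "I - M" "K - L"] by auto
      qed
      then show ?thesis using z[of I K] False by (simp add: Jop_def z)
    qed
  qed
qed

lemma conormal_wedge_eq:
  "conormal_wedge \<rho> p x = coeff_of (prod_list (map (\<lambda>i. xform (grad (\<rho> i) x)) [0..<p]))"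
  by (induction p) (simp_all add: one_superform.rep_eq times_superform.rep_eq conormal_eq)

text \<open>The vanishing of all coefficients involving d\<xi> is carried through the induction
  because \<open>Jop_swedge\<close> needs it for the next factor.\<close>

lemma Jop_prod_xform:
  "Jop (coeff_of (prod_list (map (\<lambda>i. xform (w i)) [0..<p]))) = coeff_of (prod_list (map (\<lambda>i. yform (w i)) [0..<p]))
   \<and> (\<forall>I J. J \<noteq> {} \<longrightarrow> coeff_of (prod_list (map (\<lambda>i. xform (w i)) [0..<p])) I J = 0)"
proof (induction p)
  case 0
  have "Jop (sscalar 1) = (sscalar 1 :: 'a sform)" by (auto simp: Jop_def sscalar_def fun_eq_iff)
  then show ?case by (auto simp: one_superform.rep_eq sscalar_def)
next
  case (Suc p)
  let ?U = "coeff_of (prod_list (map (\<lambda>i. xform (w i)) [0..<p]))" and ?u = "coeff_of (xform (w p))"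
  have 1: "\<And>I J. J \<noteq> {} \<Longrightarrow> ?U I J = 0" using Suc by blast
  have 2: "\<And>I J. J \<noteq> {} \<Longrightarrow> ?u I J = 0" by (simp add: coeff_of_xform)
  have J1: "Jop (?U \<and>\<^sub>s ?u) = Jop ?U \<and>\<^sub>s Jop ?u" by (rule Jop_swedge(1)) (use 1 2 in auto)
  have J2: "(?U \<and>\<^sub>s ?u) I J = 0" if "J \<noteq> {}" for I J by (rule Jop_swedge(2)) (use 1 2 that in auto)
  show ?case using J1 J2 Suc by (simp add: times_superform.rep_eq Jop_xform)
qed

lemma normal_wedge_eq:
  "sscalar (csign p) \<and>\<^sub>s (conormal_wedge \<rho> p x \<and>\<^sub>s Jop (conormal_wedge \<rho> p x))
   = coeff_of (prod_list (map (\<lambda>i. eform (grad (\<rho> i) x)) [0..<p]))"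
  unfolding conormal_wedge_eq conjunct1[OF Jop_prod_xform] prod_xform_yform[symmetric]
  by (simp add: swedge_sscalar_left scaleR_superform.rep_eq times_superform.rep_eq fun_eq_iff)

text \<open>By the square-zero formula the product depends on the w i only through the matrix \<Sum>
  w_i w_i^T. For orthonormal w this is the projection onto their span, independent of the
  frame.\<close>

lemma prod_eform:
  "prod_list (map (\<lambda>i. eform (w i)) [0..<p])
    = (1 / fact p) *\<^sub>R pform (\<lambda>k l. \<Sum>i<p. w i $ k * w i $ l) ^ p"
  using sum_square_zero_power[of "\<lambda>i. eform (w i)" 0 p, OF eform_eform eform_square]
  by (simp add: sum_eform atLeast0LessThan)

text \<open>A square matrix with orthonormal rows has orthonormal columns: expand
  \<open>axis k 1\<close> in the basis w and read off one coordinate.\<close>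

lemma orthonormal_full_coords:
  fixes w :: "nat \<Rightarrow> real^'n"
  assumes "\<forall>i<CARD('n). \<forall>j<CARD('n). w i \<bullet> w j = (if i = j then 1 else 0)"
  shows "(\<Sum>i<CARD('n). w i $ k * w i $ l) = (if k = l then 1 else 0)"
proof -
  have "(\<Sum>i<DIM(real^'n). (axis k 1 \<bullet> w i) *\<^sub>R w i) = axis k 1"
    by (rule orthonormal_full) (use assms in simp)
  from arg_cong[OF this, of "\<lambda>v. v $ l"] have "(\<Sum>i<CARD('n). w i $ k * w i $ l) = axis k 1 $ l"
    by (simp add: inner_axis')
  then show ?thesis by (simp add: axis_def)
qed

text \<open>The idea: in an orthonormal coframe \<open>u\<^sub>i\<close> extending \<open>u\<^sub>0, \<dots>, u\<^sub>p\<^sub>-\<^sub>1\<close>, with \<open>e\<^sub>i = u\<^sub>i \<and> u\<^sub>i\<^sup>#\<close>, only the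
  terms \<open>e\<^sub>i\<close> with \<open>i \<ge> p\<close> survive in \<open>e\<^sub>0 \<dots> e\<^sub>p\<^sub>-\<^sub>1 \<beta>\<^sup>m\<^sup>-\<^sup>1 dx\<^sub>k d\<xi>\<^sub>l\<close>.\<close>

lemma prod_eform_beta_power:
  fixes w :: "nat \<Rightarrow> real^'n::{finite,linorder}"
  assumes on: "\<forall>i<CARD('n). \<forall>j<CARD('n). w i \<bullet> w j = (if i = j then 1 else 0)"
    and pm: "p + m = CARD('n)" "m \<ge> 1"
  defines "N \<equiv> prod_list (map (\<lambda>i. eform (w i)) [0..<p])"
    and "\<beta> \<equiv> pform (\<lambda>k l. if k = l then 1 else 0)"
  shows "N * \<beta> ^ (m - 1) * (X k * Y l)
      = ((\<Sum>i\<in>{p..<CARD('n)}. w i $ k * w i $ l) * (fact m / (real m * fact CARD('n)))) *\<^sub>R \<beta> ^ CARD('n)"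
proof -
  define e where "e i = eform (w i)" for i
  have ee: "e i * e j = e j * e i" for i j unfolding e_def by (rule eform_eform)
  have sq: "e i * e i = 0" for i unfolding e_def by (rule eform_square)
  note exp = orthonormal_full_coords[OF on]
  have beta: "\<beta> = (\<Sum>i\<in>{0..<CARD('n)}. e i)"
    unfolding e_def sum_eform \<beta>_def by (simp add: exp atLeast0LessThan)
  define t where "t = (\<Sum>i\<in>{p..<CARD('n)}. e i)"
  have Ncom: "N * e i = e i * N" for i
  proof -
    have "prod_list (map e L) * e i = e i * prod_list (map e L)" for L
    proof (induction L)
      case (Cons a L)
      have "e a * (prod_list (map e L) * e i) = (e a * e i) * prod_list (map e L)"
        unfolding Cons by (simp add: mult.assoc)
      then show ?case by (simp add: ee[of a i] mult.assoc)
    qed simp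
    then show ?thesis by (simp add: N_def e_def[abs_def])
  qed
  \<comment> \<open>N contains the factor e i, which can be moved next to z since the e's
    commute.\<close>
  have Nz: "N * z = 0" if z: "e i * z = 0" and i: "i < p" for i z
  proof -
    have "prod_list (map e L) * z = 0" if "i \<in> set L" for L
      using that
    proof (induction L)
      case (Cons a L)
      show ?case
      proof (cases "i \<in> set L")
        case False
        have "prod_list (map e L) * (e i) = e i * prod_list (map e L)" for L
        proof (induction L)
          case (Cons a L)
          have "e a * (prod_list (map e L) * e i) = (e a * e i) * prod_list (map e L)"
            unfolding Cons by (simp add: mult.assoc)
          then show ?case by (simp add: ee[of a i] mult.assoc)
        qed simp
        then have "e a * prod_list (map e L) * z = prod_list (map e L) * (e i * z)"
          using False Cons(2) by (simp add: mult.assoc[symmetric])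
        then show ?thesis using z by simp
      qed (use Cons in \<open>simp add: mult.assoc\<close>)
    qed simp
    from this[of "[0..<p]"] i show ?thesis by (simp add: N_def e_def[abs_def])
  qed
  have t_com: "t * e i = e i * t" for i unfolding t_def by (rule commute_sum) (rule ee)
  \<comment> \<open>\<beta> splits into its normal part, killed by N, and the tangential part
    t.\<close>
  have bt: "N * \<beta> ^ q = N * t ^ q" for q
  proof (induction q)
    case (Suc q)
    have "\<beta> = (\<Sum>i<p. e i) + t"
      unfolding beta t_def using sum.atLeastLessThan_concat[of 0 p "CARD('n)" e] pm by (simp add: atLeast0LessThan)
    moreover have "N * (\<Sum>i<p. e i) = 0"
      unfolding sum_distrib_left by (rule sum.neutral) (auto intro: Nz sq)
    ultimately have Nb: "N * \<beta> = N * t" by (simp add: distrib_left)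
    have Nt: "N * t = t * N" unfolding t_def using commute_sum[of _ e N] Ncom by metis
    have "N * \<beta> ^ Suc q = t * (N * \<beta> ^ q)" by (simp add: Nb Nt flip: mult.assoc)
    also have "\<dots> = N * t ^ Suc q" unfolding Suc by (simp add: Nt flip: mult.assoc)
    finally show ?case .
  qed simp
  \<comment> \<open>Both sides are multiples of the product of all e i, which occurs m! times in N
    t^m and n! times in \<beta>^n.\<close>
  have vol: "N * t ^ m = (fact m / fact CARD('n)) *\<^sub>R \<beta> ^ CARD('n)"
  proof -
    have t': "t ^ m = fact m *\<^sub>R prod_list (map e [p..<CARD('n)])"
      using sum_square_zero_power[of e p m, OF ee sq] pm by (simp add: t_def)
    have "\<beta> ^ CARD('n) = fact CARD('n) *\<^sub>R prod_list (map e [0..<CARD('n)])"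
      using sum_square_zero_power[of e 0 "CARD('n)", OF ee sq] by (simp add: beta)
    moreover have "[0..<CARD('n)] = [0..<p] @ [p..<CARD('n)]"
      using upt_add_eq_append[of 0 p m] pm by simp
    ultimately have "\<beta> ^ CARD('n) = fact CARD('n) *\<^sub>R (N * prod_list (map e [p..<CARD('n)]))"
      by (simp add: N_def e_def[abs_def])
    then show ?thesis by (simp add: t')
  qed
  have commu: "e i * xform v = xform v * e i" "e i * yform v = yform v * e i" for i v
    unfolding e_def by (rule eform_xform eform_yform)+
  have ez: "e i * (xform (w i) * z) = 0" "e i * (yform (w i) * z) = 0" for i z
    using eform_xform_self[of "w i"] eform_yform_self[of "w i"] unfolding e_def by (metis mult.assoc mult_zero_left)+
  have ez': "e j * (xform (w i) * yform (w j)) = 0" for i j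
  proof -
    have "e j * (xform (w i) * yform (w j)) = xform (w i) * (e j * yform (w j))"
      by (simp add: commu(1) flip: mult.assoc)
    then show ?thesis using eform_yform_self[of "w j"] unfolding e_def by simp
  qed
  have tcz: "t ^ q * z = (t - e i) ^ q * z" if "e i * z = 0" for i z q
  proof (induction q)
    case (Suc q)
    have c: "(t - e i) ^ q * e i = e i * (t - e i) ^ q"
      by (rule power_commuting_commutes) (simp add: algebra_simps t_com)
    have "t ^ Suc q * z = t * ((t - e i) ^ q * z)" by (simp add: mult.assoc Suc)
    also have "\<dots> = (t - e i) * ((t - e i) ^ q * z) + (e i * (t - e i) ^ q) * z"
      by (simp add: left_diff_distrib mult.assoc)
    also have "(e i * (t - e i) ^ q) * z = 0" using that by (simp add: c[symmetric] mult.assoc)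
    finally show ?case by (simp add: mult.assoc)
  qed simp
  have card: "card {p..<CARD('n)} = m" using pm by simp
  \<comment> \<open>Without e i the tangential sum s has m - 1 summands, so s^m = 0 and t^m = m
    s^(m-1) e i. This is the origin of the factor 1/m.\<close>
  have diag: "N * \<beta> ^ (m - 1) * e i = (fact m / (real m * fact CARD('n))) *\<^sub>R \<beta> ^ CARD('n)" if i: "p \<le> i" "i < CARD('n)" for i
  proof -
    let ?s = "\<Sum>j\<in>{p..<CARD('n)} - {i}. e j"
    have ts: "t = ?s + e i" unfolding t_def using i by (simp add: sum.remove[of _ i] add.commute)
    have c: "?s * e i = e i * ?s" by (rule commute_sum) (rule ee)
    have "card ({p..<CARD('n)} - {i}) = m - 1" using i card by simp
    then have "?s ^ m = 0"
      using sum_square_zero_nilpotent[of "{p..<CARD('n)} - {i}" e, OF _ ee sq] pm by simp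
    then have "t ^ m = real m *\<^sub>R (?s ^ (m - 1) * e i)"
      using power_add_square_zero[OF c sq, of "m - 1"] pm unfolding ts by simp
    also have "?s ^ (m - 1) * e i = t ^ (m - 1) * e i"
      using tcz[of i "e i" "m - 1", OF sq] ts by simp
    finally have "t ^ (m - 1) * e i = (1 / real m) *\<^sub>R t ^ m" using pm by simp
    then show ?thesis using vol by (simp add: bt mult.assoc)
  qed
  \<comment> \<open>If i < p or j < p, the corresponding factor of N kills the term. Otherwise e i
    and e j both drop out of t, leaving m - 2 square-zero summands in a power m - 1.\<close>
  have off: "N * \<beta> ^ (m - 1) * (xform (w i) * yform (w j)) = 0"
    if ij: "i < CARD('n)" "j < CARD('n)" "i \<noteq> j \<or> i < p" for i j
  proof -
    let ?z = "xform (w i) * yform (w j)"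
    have ei: "e i * ?z = 0" and ej: "e j * ?z = 0" using ez ez' by (simp_all add: mult.assoc)
    have c: "t ^ q * e a = e a * t ^ q" for a q by (rule power_commuting_commutes) (rule t_com)
    have lt: "N * (t ^ q * ?z) = 0" if "a < p" "e a * ?z = 0" for a q
    proof (rule Nz[OF _ that(1)])
      have "e a * (t ^ q * ?z) = t ^ q * (e a * ?z)" by (simp add: c flip: mult.assoc)
      then show "e a * (t ^ q * ?z) = 0" using that by simp
    qed
    consider "i < p" | "j < p" | "p \<le> i" "p \<le> j" by linarith
    then show ?thesis
    proof cases
      case 3
      then have ne: "i \<noteq> j" using ij by auto
      let ?s = "\<Sum>k\<in>{p..<CARD('n)} - {i} - {j}. e k"
      have "t - e i = (\<Sum>k\<in>{p..<CARD('n)} - {i}. e k)"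
        unfolding t_def using 3 ij by (simp add: sum.remove[of _ i])
      also have "\<dots> = e j + ?s" using 3 ij ne by (subst sum.remove[of _ j]) auto
      finally have s: "?s = t - e i - e j" by simp
      have cs: "?s * e j = e j * ?s" by (rule commute_sum) (rule ee)
      have "(t - e i) ^ q * ?z = ?s ^ q * ?z" for q
      proof (induction q)
        case (Suc q)
        have te: "t - e i = ?s + e j" using s by simp
        have "(t - e i) ^ Suc q * ?z = (?s + e j) * (?s ^ q * ?z)"
          using Suc by (simp add: mult.assoc te)
        also have "\<dots> = ?s ^ Suc q * ?z + (e j * ?s ^ q) * ?z" by (simp add: distrib_right mult.assoc)
        also have "(e j * ?s ^ q) * ?z = ?s ^ q * (e j * ?z)"
          using power_commuting_commutes[OF cs, of q] by (simp add: mult.assoc flip: mult.assoc)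
        finally show ?case using ej by simp
      qed simp
      then have "t ^ (m - 1) * ?z = ?s ^ (m - 1) * ?z" using tcz[OF ei] by simp
      also have "?s ^ (m - 1) = 0"
      proof -
        have "card ({p..<CARD('n)} - {i} - {j}) = m - 2" "m \<ge> 2"
          using 3 ij ne pm by auto
        then show ?thesis
          using sum_square_zero_nilpotent[of "{p..<CARD('n)} - {i} - {j}" e, OF _ ee sq]
          by (simp add: Suc_diff_Suc numeral_2_eq_2)
      qed
      finally show ?thesis by (simp add: bt mult.assoc)
    qed (use lt ei ej in \<open>simp_all add: bt mult.assoc\<close>)
  qed
  have X: "X k = (\<Sum>i<CARD('n). w i $ k *\<^sub>R xform (w i))" for k
  proof -
    have "(\<Sum>i<CARD('n). w i $ k *\<^sub>R xform (w i)) = (\<Sum>j\<in>UNIV. (\<Sum>i<CARD('n). w i $ k * w i $ j) *\<^sub>R X j)"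
      unfolding xform_def scaleR_sum_right scaleR_left.sum by (subst sum.swap) simp
    then show ?thesis by (simp add: exp if_distrib[of "\<lambda>c. c *\<^sub>R _"] cong: if_cong)
  qed
  have Y: "Y k = (\<Sum>i<CARD('n). w i $ k *\<^sub>R yform (w i))" for k
  proof -
    have "(\<Sum>i<CARD('n). w i $ k *\<^sub>R yform (w i)) = (\<Sum>j\<in>UNIV. (\<Sum>i<CARD('n). w i $ k * w i $ j) *\<^sub>R Y j)"
      unfolding yform_def scaleR_sum_right scaleR_left.sum by (subst sum.swap) simp
    then show ?thesis by (simp add: exp if_distrib[of "\<lambda>c. c *\<^sub>R _"] cong: if_cong)
  qed
  have "N * \<beta> ^ (m - 1) * (X k * Y l)
     = (\<Sum>i<CARD('n). \<Sum>j<CARD('n). (w i $ k * w j $ l) *\<^sub>R (N * \<beta> ^ (m - 1) * (xform (w i) * yform (w j))))"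
  proof -
    have "X k * Y l = (\<Sum>i<CARD('n). \<Sum>j<CARD('n). (w i $ k * w j $ l) *\<^sub>R (xform (w i) * yform (w j)))"
      unfolding X Y sum_product by (intro sum.cong refl) simp
    then show ?thesis by (simp add: sum_distrib_left)
  qed
  also have "\<dots> = (\<Sum>i<CARD('n). \<Sum>j<CARD('n). if j = i then (if p \<le> i then (w i $ k * w i $ l) *\<^sub>R
      ((fact m / (real m * fact CARD('n))) *\<^sub>R \<beta> ^ CARD('n)) else 0) else 0)"
    by (intro sum.cong refl) (auto simp: off[unfolded One_nat_def] diag[unfolded e_def One_nat_def])
  also have "\<dots> = (\<Sum>i\<in>{..<CARD('n)}. if p \<le> i then (w i $ k * w i $ l) *\<^sub>R
      ((fact m / (real m * fact CARD('n))) *\<^sub>R \<beta> ^ CARD('n)) else 0)"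
    by simp
  also have "\<dots> = (\<Sum>i\<in>{p..<CARD('n)}. (w i $ k * w i $ l) *\<^sub>R
      ((fact m / (real m * fact CARD('n))) *\<^sub>R \<beta> ^ CARD('n)))"
    by (intro sum.mono_neutral_cong_right) auto
  also have "\<dots> = ((\<Sum>i\<in>{p..<CARD('n)}. w i $ k * w i $ l) * (fact m / (real m * fact CARD('n)))) *\<^sub>R \<beta> ^ CARD('n)"
    unfolding scaleR_scaleR sum_distrib_right scaleR_left.sum ..
  finally show ?thesis .
qed

text \<open>The top coefficient of the right-hand side of \<open>prod_eform_beta_power\<close>,
  stripped of the matrix entry of the tangential projection.\<close>

definition top_const :: "'n::{finite,linorder} itself \<Rightarrow> nat \<Rightarrow> real" where
  "top_const _ m = fact m / (real m * fact CARD('n)) *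
     swedge_power (beta :: 'n sform) CARD('n) UNIV UNIV"

lemma top_const_ne_0: "m \<ge> 1 \<Longrightarrow> top_const TYPE('n::{finite,linorder}) m \<noteq> 0"
  using beta_power_top[where 'n='n] by (simp add: top_const_def coeff_of_power coeff_of_beta)

text \<open>Completing the conormals to an orthonormal basis, the tangential sum over i \<ge> p
  becomes the identity minus the normal sum, so the auxiliary vectors disappear from the
  result.\<close>

lemma normal_wedge_top:
  fixes \<rho> :: "nat \<Rightarrow> real^'n::{finite,linorder} \<Rightarrow> real"
  assumes on: "\<forall>i<p. \<forall>j<p. grad (\<rho> i) x \<bullet> grad (\<rho> j) x = (if i = j then 1 else 0)"
    and pm: "p + m = CARD('n)" "m \<ge> 1"
  shows "((sscalar (csign p) \<and>\<^sub>s (conormal_wedge \<rho> p x \<and>\<^sub>s Jop (conormal_wedge \<rho> p x))) \<and>\<^sub>s swedge_power beta (m - 1) \<and>\<^sub>s (dx k \<and>\<^sub>s dxi l)) UNIV UNIV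
    = ((if k = l then 1 else 0) - (\<Sum>i<p. grad (\<rho> i) x $ k * grad (\<rho> i) x $ l)) * top_const TYPE('n) m"
proof -
  obtain w where w: "\<forall>i<CARD('n). \<forall>j<CARD('n). w i \<bullet> w j = (if i = j then 1 else 0)" "\<forall>i<p. w i = grad (\<rho> i) x"
    using extend_orthonormal[of p "\<lambda>i. grad (\<rho> i) x"] on pm by auto
  have N: "prod_list (map (\<lambda>i. eform (grad (\<rho> i) x)) [0..<p]) = prod_list (map (\<lambda>i. eform (w i)) [0..<p])"
    by (rule arg_cong[of _ _ prod_list], rule map_cong[OF refl]) (use w in simp)
  note exp = orthonormal_full_coords[OF w(1)]
  have "(\<Sum>i<CARD('n). w i $ k * w i $ l) = (\<Sum>i<p. w i $ k * w i $ l) + (\<Sum>i\<in>{p..<CARD('n)}. w i $ k * w i $ l)"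
    using sum.atLeastLessThan_concat[of 0 p "CARD('n)" "\<lambda>i. w i $ k * w i $ l"] pm by (simp add: atLeast0LessThan)
  then have P: "(\<Sum>i\<in>{p..<CARD('n)}. w i $ k * w i $ l) = (if k = l then 1 else 0) - (\<Sum>i<p. grad (\<rho> i) x $ k * grad (\<rho> i) x $ l)"
    using w(2) by (simp add: exp)
  have "sscalar (csign p) \<and>\<^sub>s (conormal_wedge \<rho> p x \<and>\<^sub>s Jop (conormal_wedge \<rho> p x)) \<and>\<^sub>s swedge_power beta (m - 1) \<and>\<^sub>s (dx k \<and>\<^sub>s dxi l)
     = coeff_of (prod_list (map (\<lambda>i. eform (w i)) [0..<p]) * pform (\<lambda>k l. if k = l then 1 else 0) ^ (m - 1) * (X k * Y l))"
    unfolding normal_wedge_eq N times_superform.rep_eq coeff_of_power coeff_of_beta coeff_of_X coeff_of_Y ..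
  then show ?thesis
    unfolding prod_eform_beta_power[OF w(1) pm] P
    by (simp add: top_const_def scaleR_superform.rep_eq coeff_of_power coeff_of_beta)
qed

text \<open>The zero form has every bidegree, which covers \<open>normal_form\<close> off M.\<close>

definition has_bidegree :: "nat \<Rightarrow> nat \<Rightarrow> 'n sform \<Rightarrow> bool" where
  "has_bidegree p q a \<longleftrightarrow> (\<forall>I J. a I J \<noteq> 0 \<longrightarrow> card I = p \<and> card J = q)"

lemma has_bidegree_swedge:
  assumes "has_bidegree p q a" "has_bidegree r s b"
  shows "has_bidegree (p + r) (q + s) (a \<and>\<^sub>s b)"
  unfolding has_bidegree_def
proof (intro allI impI)
  fix I J :: "'a set" assume "(a \<and>\<^sub>s b) I J \<noteq> 0"
  then obtain K where K: "K \<in> Pow I" "(\<Sum>L\<in>Pow J. wedge_sign K L (I - K) (J - L) * (a K L * b (I - K) (J - L))) \<noteq> 0"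
    unfolding swedge_def by (rule sum.not_neutral_contains_not_neutral)
  from K(2) obtain L where "L \<in> Pow J" "wedge_sign K L (I - K) (J - L) * (a K L * b (I - K) (J - L)) \<noteq> 0"
    by (rule sum.not_neutral_contains_not_neutral)
  with K(1) have "K \<subseteq> I" "L \<subseteq> J" "a K L \<noteq> 0" "b (I - K) (J - L) \<noteq> 0" by auto
  then have "K \<subseteq> I" "L \<subseteq> J" "card K = p" "card L = q" "card (I - K) = r" "card (J - L) = s"
    using assms unfolding has_bidegree_def by auto
  then show "card I = p + r \<and> card J = q + s"
    using card_Diff_subset[of K I] card_Diff_subset[of L J] card_mono[of I K] card_mono[of J L]
    by simp linarith
qed

lemma has_bidegree_beta_power: "has_bidegree k k (swedge_power (beta::'n::{finite,linorder} sform) k)"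
proof (induction k)
  case 0 then show ?case by (auto simp: has_bidegree_def sscalar_def)
next
  case (Suc k)
  have 1: "has_bidegree 1 1 (dx i \<and>\<^sub>s dxi i)" for i :: 'n
  proof -
    have "has_bidegree 1 0 (dx i)" "has_bidegree 0 1 (dxi i)"
      by (auto simp: has_bidegree_def dx_def dxi_def split: if_splits)
    from has_bidegree_swedge[OF this] show ?thesis by simp
  qed
  have "has_bidegree 1 1 (beta::'n sform)"
    unfolding has_bidegree_def beta_def
  proof (intro allI impI)
    fix I J :: "'n set" assume "(\<Sum>k\<in>UNIV. (dx k \<and>\<^sub>s dxi k) I J) \<noteq> 0"
    then obtain k where "(dx k \<and>\<^sub>s dxi k) I J \<noteq> 0" by (rule sum.not_neutral_contains_not_neutral)
    then show "card I = 1 \<and> card J = 1" using 1[of k] unfolding has_bidegree_def by blast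
  qed
  from has_bidegree_swedge[OF this Suc] show ?case by simp
qed

lemma has_bidegree_conormal_wedge: "has_bidegree p 0 (conormal_wedge \<rho> p x)"
proof (induction p)
  case 0 then show ?case by (auto simp: has_bidegree_def sscalar_def)
next
  case (Suc p)
  have "has_bidegree 1 0 (conormal (\<rho> p) x)"
    unfolding has_bidegree_def conormal_eq coeff_of_xform
  proof (intro allI impI)
    fix I J :: "'a set" assume "(\<Sum>k\<in>UNIV. if I = {k} \<and> J = {} then grad (\<rho> p) x $ k else 0) \<noteq> 0"
    then obtain k where "(if I = {k} \<and> J = {} then grad (\<rho> p) x $ k else 0) \<noteq> 0"
      by (rule sum.not_neutral_contains_not_neutral)
    then show "card I = 1 \<and> card J = 0" by (auto split: if_splits)
  qed
  from has_bidegree_swedge[OF Suc this] show ?case by simp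
qed

lemma has_bidegree_Jop: "has_bidegree p q a \<Longrightarrow> has_bidegree q p (Jop a)"
  by (auto simp: has_bidegree_def Jop_def)

lemma has_bidegree_normal_wedge:
  "has_bidegree p p (sscalar (csign p) \<and>\<^sub>s (conormal_wedge \<rho> p x \<and>\<^sub>s Jop (conormal_wedge \<rho> p x)))"
  using has_bidegree_swedge[OF has_bidegree_conormal_wedge[of p \<rho> x] has_bidegree_Jop[OF has_bidegree_conormal_wedge[of p \<rho> x]]]
  by (auto simp: swedge_sscalar_left has_bidegree_def)

text \<open>Coefficients of wedge powers are polynomials in the entries of P. Applied to
  \<open>normal_form\<close>, whose defining functions may jump from point to point while the
  projection does not.\<close>

lemma continuous_on_pform_power:
  fixes P :: "'a::topological_space \<Rightarrow> 'n::{finite,linorder} \<Rightarrow> 'n \<Rightarrow> real"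
  assumes "\<And>k l. continuous_on S (\<lambda>x. P x k l)"
  shows "continuous_on S (\<lambda>x. coeff_of (pform (P x) ^ q) I J)"
proof (induction q arbitrary: I J)
  case 0 then show ?case by simp
next
  case (Suc q)
  have "continuous_on S (\<lambda>x. coeff_of (pform (P x)) I J)" for I J
    unfolding pform_def coeff_of_sum scaleR_superform.rep_eq by (intro continuous_intros assms)
  with Suc show ?case
    unfolding power_Suc times_superform.rep_eq swedge_def by (intro continuous_intros)
qed

section \<open>Partial derivatives and integration by parts\<close>

text \<open>By translation invariance each difference quotient integrates to 0; dominated
  convergence passes to the derivative.\<close>

lemma integral_derivative_compact_support:
  fixes h :: "'a::euclidean_space \<Rightarrow> real"
  assumes h: "Ck_on 1 UNIV h" and K: "compact K" "\<And>x. x \<notin> K \<Longrightarrow> h x = 0"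
  shows "(\<integral>x. frechet_derivative h (at x) v \<partial>lborel) = 0"
proof -
  define D where "D x = frechet_derivative h (at x) v" for x
  have contD: "continuous_on UNIV D" and conth: "continuous_on UNIV h"
    using h Ck_on_continuous[OF h] by (simp_all add: D_def[abs_def])
  have der: "((\<lambda>t. h (x + t *\<^sub>R v)) has_field_derivative D (x + t *\<^sub>R v)) (at t)" for x t
  proof -
    have d: "(h has_derivative frechet_derivative h (at (x + t *\<^sub>R v))) (at (x + t *\<^sub>R v))"
      using Ck_on_SucD[of 0 UNIV h] h by simp
    have "((\<lambda>t. x + t *\<^sub>R v) has_derivative (\<lambda>h. h *\<^sub>R v)) (at t)"
      using has_derivative_add[OF has_derivative_const bounded_linear_imp_has_derivative[OF bounded_linear_scaleR_left]]
      by simp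
    from has_derivative_compose[OF this d]
    have "((\<lambda>t. h (x + t *\<^sub>R v)) has_derivative (\<lambda>s. frechet_derivative h (at (x + t *\<^sub>R v)) (s *\<^sub>R v))) (at t)" .
    moreover have "(\<lambda>s. frechet_derivative h (at (x + t *\<^sub>R v)) (s *\<^sub>R v)) = (*) (D (x + t *\<^sub>R v))"
      using linear_scale[OF has_derivative_linear[OF d]] by (auto simp: fun_eq_iff D_def)
    ultimately show ?thesis by (simp only: has_field_derivative_def)
  qed
  have D0: "D x = 0" if "x \<notin> K" for x
  proof -
    have o: "open (- K)" using compact_imp_closed[OF K(1)] by auto
    have "frechet_derivative h (at x) = frechet_derivative (\<lambda>_. 0) (at x)"
      by (rule frechet_derivative_cong_open[OF o]) (use that K(2) in auto)
    then show ?thesis by (simp add: D_def)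
  qed
  have "compact (D ` K)" by (intro compact_continuous_image continuous_on_subset[OF contD] K) auto
  then obtain L where L: "L > 0" "\<And>x. x \<in> K \<Longrightarrow> \<bar>D x\<bar> \<le> L"
    using compact_imp_bounded bounded_pos by (metis image_eqI real_norm_def)
  have DL: "\<bar>D x\<bar> \<le> L" for x using L D0[of x] by (cases "x \<in> K") auto
  obtain R where R: "R > 0" "\<And>x. x \<in> K \<Longrightarrow> norm x \<le> R"
    using compact_imp_bounded[OF K(1)] bounded_pos by metis
  define q where "q n x = (h (x + inverse (real (Suc n)) *\<^sub>R v) - h x) / inverse (real (Suc n))" for n x
  have q_lim: "(\<lambda>n. q n x) \<longlonglongrightarrow> D x" for x
  proof -
    have "(\<lambda>t. (h (x + t *\<^sub>R v) - h x) / t) \<midarrow>0\<rightarrow> D x"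
      using der[of x 0] by (simp add: DERIV_def)
    moreover have "filterlim (\<lambda>n. inverse (real (Suc n))) (at 0) sequentially"
      using LIMSEQ_inverse_real_of_nat by (auto simp: filterlim_at)
    ultimately show ?thesis unfolding q_def by (rule filterlim_compose)
  qed
  \<comment> \<open>Steps are at most 1, so all difference quotients live on the R-ball enlarged by
    |v|, and the mean value theorem bounds them by L.\<close>
  have q_bound: "norm (q n x) \<le> L * indicator (cball 0 (R + norm v)) x" for n x
  proof -
    let ?t = "inverse (real (Suc n))"
    have t: "0 < ?t" "?t \<le> 1" by (auto simp: field_simps)
    show ?thesis
    proof (cases "x \<in> cball 0 (R + norm v)")
      case True
      obtain z where "h (x + ?t *\<^sub>R v) - h (x + 0 *\<^sub>R v) = (?t - 0) * D (x + z *\<^sub>R v)"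
        using MVT2[OF t(1), of "\<lambda>t. h (x + t *\<^sub>R v)" "\<lambda>t. D (x + t *\<^sub>R v)"] der by blast
      then have "q n x = D (x + z *\<^sub>R v)" unfolding q_def using t by simp
      then show ?thesis using DL True by simp
    next
      case False
      then have "norm x > R + norm v" by simp
      moreover have "norm x - norm v \<le> norm (x + ?t *\<^sub>R v)"
      proof -
        have "norm (?t *\<^sub>R v) \<le> norm v" using t by (simp add: mult_left_le_one_le)
        then show ?thesis using norm_diff_ineq[of x "?t *\<^sub>R v"] by linarith
      qed
      moreover have "norm v \<ge> 0" by simp
      ultimately have "x \<notin> K" "x + ?t *\<^sub>R v \<notin> K" using R(2) by fastforce+
      then have "q n x = 0" unfolding q_def by (simp add: K(2))
      then show ?thesis using False by simp
    qed
  qed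
  have hm: "h \<in> borel_measurable borel" using conth by (rule borel_measurable_continuous_onI)
  have qm: "q n \<in> borel_measurable lborel" for n
  proof -
    have "continuous_on UNIV (q n)"
      unfolding q_def by (intro continuous_intros continuous_on_compose2[OF conth]) auto
    then show ?thesis by (simp add: borel_measurable_continuous_onI)
  qed
  have int_dom: "integrable lborel (\<lambda>x::'a. L * indicator (cball 0 (R + norm v)) x)"
    using emeasure_bounded_finite[OF bounded_cball[of "0::'a" "R + norm v"]]
    by (intro integrable_mult_right integrable_real_indicator) auto
  have lim: "(\<lambda>n. \<integral>x. q n x \<partial>lborel) \<longlonglongrightarrow> (\<integral>x. D x \<partial>lborel)"
    by (rule integral_dominated_convergence[OF _ qm int_dom])
      (use q_bound in \<open>auto simp: q_lim intro: borel_measurable_continuous_onI contD\<close>)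
  have inth: "integrable lborel h"
  proof -
    have "integrable lborel (\<lambda>x. indicator K x *\<^sub>R h x)"
      by (rule borel_integrable_compact[OF K(1) continuous_on_subset[OF conth]]) auto
    moreover have "(\<lambda>x. indicator K x *\<^sub>R h x) = h"
      by (rule ext) (use K(2) in \<open>auto simp: indicator_def\<close>)
    ultimately show ?thesis by simp
  qed
  have "(\<integral>x. q n x \<partial>lborel) = 0" for n
  proof -
    let ?c = "inverse (real (Suc n)) *\<^sub>R v"
    have tr: "integrable lborel (\<lambda>x. h (x + ?c)) \<and> (\<integral>x. h (x + ?c) \<partial>lborel) = (\<integral>x. h x \<partial>lborel)"
    proof -
      have "integrable (distr lborel borel ((+) ?c)) h" using inth by (simp add: lborel_distr_plus)
      then have 1: "integrable lborel (\<lambda>x. h (?c + x))" by (subst (asm) integrable_distr_eq) (use hm in auto)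
      have "(\<integral>x. h x \<partial>distr lborel borel ((+) ?c)) = (\<integral>x. h (?c + x) \<partial>lborel)"
        by (rule integral_distr) (use hm in auto)
      then show ?thesis using 1 by (simp add: lborel_distr_plus add.commute)
    qed
    have "(\<integral>x. q n x \<partial>lborel) = (\<integral>x. h (x + ?c) - h x \<partial>lborel) / inverse (real (Suc n))"
      unfolding q_def by (rule integral_divide_zero)
    also have "(\<integral>x. h (x + ?c) - h x \<partial>lborel) = 0"
      using tr inth by (simp add: Bochner_Integration.integral_diff)
    finally show ?thesis by simp
  qed
  then have "(\<lambda>n. \<integral>x. q n x \<partial>lborel) \<longlonglongrightarrow> 0" by simp
  from LIMSEQ_unique[OF lim this] show ?thesis by (simp add: D_def)
qed

text \<open>A permutation other than the identity moves at least two indices, so after one factor of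
  its product is differentiated an off-diagonal entry of the identity matrix remains and is
  0.\<close>

lemma det_has_derivative_id:
  fixes C :: "'a::real_normed_vector \<Rightarrow> real^'n^'n"
  assumes C: "\<And>i j. ((\<lambda>x. C x $ i $ j) has_derivative C' i j) (at x)" and id: "C x = mat 1"
  shows "((\<lambda>x. det (C x)) has_derivative (\<lambda>h. \<Sum>i\<in>UNIV. C' i i h)) (at x)"
proof -
  let ?T = "\<lambda>p h. of_int (sign p) * (\<Sum>i\<in>UNIV. C' i (p i) h * (\<Prod>j\<in>UNIV - {i}. C x $ j $ p j))"
  have "((\<lambda>x. det (C x)) has_derivative (\<lambda>h. \<Sum>p\<in>{p. p permutes UNIV}. ?T p h)) (at x)"
    unfolding det_def by (intro has_derivative_sum has_derivative_mult_right has_derivative_prod C)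
  moreover have "(\<Sum>p\<in>{p. p permutes UNIV}. ?T p h) = (\<Sum>i\<in>UNIV. C' i i h)" for h
  proof -
    have z: "(\<Prod>j\<in>UNIV - {i}. C x $ j $ p j) = 0" if p: "p permutes UNIV" "p \<noteq> id" for p i
    proof -
      obtain j where j: "p j \<noteq> j" using p(2) by (auto simp: fun_eq_iff)
      have "p (p j) \<noteq> p j" using j permutes_inj[OF p(1)] by (metis injD)
      with j have "\<exists>k. k \<noteq> i \<and> p k \<noteq> k" by metis
      then obtain k where k: "k \<in> UNIV - {i}" "p k \<noteq> k" by blast
      then have "C x $ k $ p k = 0" by (simp add: id mat_def)
      with k(1) show ?thesis by (intro prod_zero) auto
    qed
    have "(\<Sum>p\<in>{p. p permutes UNIV}. ?T p h) = (\<Sum>p\<in>{id}. ?T p h)"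
      by (rule sum.mono_neutral_right) (auto simp: z finite_permutations permutes_id)
    also have "\<dots> = (\<Sum>i\<in>UNIV. C' i i h)" by (simp add: id mat_def sign_id)
    finally show ?thesis .
  qed
  ultimately show ?thesis by simp
qed

text \<open>Jacobi's formula, reduced to the case of the identity matrix by multiplying from the
  left with the constant matrix B.\<close>

lemma det_has_derivative:
  fixes A :: "'a::real_normed_vector \<Rightarrow> real^'n^'n"
  assumes A: "\<And>i j. ((\<lambda>x. A x $ i $ j) has_derivative A' i j) (at x0)" and inv: "B ** A x0 = mat 1"
  shows "((\<lambda>x. det (A x)) has_derivative
     (\<lambda>h. det (A x0) * (\<Sum>i\<in>UNIV. \<Sum>k\<in>UNIV. B $ i $ k * A' k i h))) (at x0)"
proof -
  have "((\<lambda>x. det (B ** A x)) has_derivative (\<lambda>h. \<Sum>i\<in>UNIV. \<Sum>k\<in>UNIV. B $ i $ k * A' k i h)) (at x0)"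
  proof (rule det_has_derivative_id[where C="\<lambda>x. B ** A x" and C'="\<lambda>i j h. \<Sum>k\<in>UNIV. B $ i $ k * A' k j h"])
    show "((\<lambda>x. (B ** A x) $ i $ j) has_derivative (\<lambda>h. \<Sum>k\<in>UNIV. B $ i $ k * A' k j h)) (at x0)" for i j
      unfolding matrix_matrix_mult_def vec_lambda_beta
      by (intro has_derivative_sum has_derivative_mult_right A)
  qed (rule inv)
  from has_derivative_mult_right[OF this, of "det (A x0)"]
  have "((\<lambda>x. det (A x0) * det (B ** A x)) has_derivative
    (\<lambda>h. det (A x0) * (\<Sum>i\<in>UNIV. \<Sum>k\<in>UNIV. B $ i $ k * A' k i h))) (at x0)" .
  moreover have "det (A x0) * det (B ** A x) = det (A x)" for x
  proof -
    have "det B * det (A x0) = 1" using arg_cong[OF inv, of det] by (simp add: det_mul)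
    then show ?thesis by (simp add: det_mul mult.assoc[symmetric] mult.commute)
  qed
  ultimately show ?thesis by simp
qed

text \<open>The segment from the Gram matrix to the identity consists of positive definite matrices,
  so the determinant does not vanish along it; being 1 at the end, it is positive at the start by
  the intermediate value theorem.\<close>

lemma det_gram_pos:
  fixes A :: "real^'m^'n"
  assumes "inj ((*v) A)"
  shows "det (transpose A ** A) > 0"
proof -
  let ?G = "transpose A ** A"
  define M where "M t = t *\<^sub>R mat 1 + (1 - t) *\<^sub>R ?G" for t :: real
  have nz: "det (M t) \<noteq> 0" if t: "0 \<le> t" "t \<le> 1" for t
  proof
    assume "det (M t) = 0"
    then have "\<not> invertible (M t)" by (simp add: invertible_det_nz)
    then have "\<not> inj ((*v) (M t))"
      by (simp add: invertible_left_inverse matrix_left_invertible_injective)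
    then obtain v where v: "v \<noteq> 0" "M t *v v = 0"
      by (metis matrix_left_invertible_injective matrix_left_invertible_ker)
    have "v \<bullet> (M t *v v) = t * (v \<bullet> v) + (1 - t) * ((A *v v) \<bullet> (A *v v))"
      unfolding M_def
      by (simp add: matrix_vector_mult_add_rdistrib scaleR_matrix_vector_assoc[symmetric] inner_add_right
          matrix_vector_mul_assoc[symmetric] dot_lmul_matrix[symmetric] vector_transpose_matrix inner_commute)
    then have e: "t * (v \<bullet> v) + (1 - t) * ((A *v v) \<bullet> (A *v v)) = 0" using v by simp
    have "A *v v \<noteq> 0" using v(1) assms by (metis injD matrix_vector_mult_0_right)
    then have "(A *v v) \<bullet> (A *v v) > 0" "v \<bullet> v > 0" using v(1) by auto
    then have "t * (v \<bullet> v) + (1 - t) * ((A *v v) \<bullet> (A *v v)) > 0"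
      using t by (cases "t = 0") (auto intro!: add_pos_nonneg)
    with e show False by simp
  qed
  have cont: "continuous_on {0..1} (\<lambda>t. det (M t))"
    unfolding det_def M_def by (intro continuous_intros)
  have M1: "det (M 1) = 1" and M0: "M 0 = ?G" by (simp_all add: M_def)
  show ?thesis
  proof (rule ccontr)
    assume "\<not> det ?G > 0"
    then have "det (M 0) \<le> 0" using M0 by simp
    then obtain t where "0 \<le> t" "t \<le> 1" "det (M t) = 0"
      using IVT'[of "\<lambda>t. det (M t)" 0 0 1] cont M1 by auto
    then show False using nz by blast
  qed
qed

lemma partial_has_derivative: "(f has_derivative f') (at x) \<Longrightarrow> partial k f x = f' (axis k 1)"
  by (simp add: partial_def frechet_derivative_eqI)

lemma differentiable_has_derivative_frechet:
  "f differentiable (at x) \<Longrightarrow> (f has_derivative frechet_derivative f (at x)) (at x)"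
  by (simp add: frechet_derivative_works)

lemma partial_mult:
  "f differentiable (at x) \<Longrightarrow> g differentiable (at x) \<Longrightarrow>
    partial k (\<lambda>x. f x * g x) x = f x * partial k g x + partial k f x * g x"
  using partial_has_derivative[OF has_derivative_mult[OF differentiable_has_derivative_frechet differentiable_has_derivative_frechet]]
  by (simp add: partial_def)

lemma partial_sum:
  "(\<And>i. i \<in> I \<Longrightarrow> f i differentiable (at x)) \<Longrightarrow> partial k (\<lambda>x. \<Sum>i\<in>I. f i x) x = (\<Sum>i\<in>I. partial k (f i) x)"
proof -
  assume "\<And>i. i \<in> I \<Longrightarrow> f i differentiable (at x)"
  then have "((\<lambda>x. \<Sum>i\<in>I. f i x) has_derivative (\<lambda>h. \<Sum>i\<in>I. frechet_derivative (f i) (at x) h)) (at x)"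
    by (intro has_derivative_sum differentiable_has_derivative_frechet)
  from partial_has_derivative[OF this] show ?thesis by (simp add: partial_def)
qed

lemma partial_cong_open:
  "open S \<Longrightarrow> x \<in> S \<Longrightarrow> (\<And>y. y \<in> S \<Longrightarrow> f y = g y) \<Longrightarrow> partial k f x = partial k g x"
  unfolding partial_def using frechet_derivative_cong_open by metis

lemma integrable_compact_support:
  fixes g :: "'a::euclidean_space \<Rightarrow> real"
  assumes "continuous_on V g" "compact K" "K \<subseteq> V" "\<And>y. y \<in> V - K \<Longrightarrow> g y = 0"
  shows "integrable lborel (\<lambda>y. indicator V y * g y)"
proof -
  have "integrable lborel (\<lambda>x. indicator K x *\<^sub>R g x)"
    by (rule borel_integrable_compact[OF assms(2) continuous_on_subset[OF assms(1,3)]])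
  moreover have "(\<lambda>x. indicator K x *\<^sub>R g x) = (\<lambda>y. indicator V y * g y)"
    using assms(3,4) by (auto simp: indicator_def fun_eq_iff)
  ultimately show ?thesis by simp
qed

section \<open>First variation in a chart\<close>

lemma smooth_on_differentiable: "smooth_on S f \<Longrightarrow> x \<in> S \<Longrightarrow> f differentiable (at x)"
  using smooth_on_has_derivative unfolding differentiable_def by blast

lemma Ck_on_partial: "Ck_on (Suc k) S f \<Longrightarrow> Ck_on k S (partial a f)"
  unfolding partial_def[abs_def] by simp

lemma smooth_on_mult:
  fixes f g :: "'a::real_normed_vector \<Rightarrow> real"
  shows "open S \<Longrightarrow> smooth_on S f \<Longrightarrow> smooth_on S g \<Longrightarrow> smooth_on S (\<lambda>x. f x * g x)"
  unfolding smooth_on_def using Ck_on_mult by blast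

lemma smooth_on_add:
  "open S \<Longrightarrow> smooth_on S f \<Longrightarrow> smooth_on S g \<Longrightarrow> smooth_on S (\<lambda>x. f x + g x)"
  unfolding smooth_on_def using Ck_on_add by blast

lemma smooth_on_const: "open S \<Longrightarrow> smooth_on S (\<lambda>x. c)"
  unfolding smooth_on_def using Ck_on_const by blast

lemma smooth_on_sum:
  "open S \<Longrightarrow> (\<And>i. i \<in> I \<Longrightarrow> smooth_on S (f i)) \<Longrightarrow> smooth_on S (\<lambda>x. \<Sum>i\<in>I. f i x)"
  unfolding smooth_on_def by (blast intro: Ck_on_sum)

lemma smooth_on_cong:
  "open S \<Longrightarrow> (\<And>x. x \<in> S \<Longrightarrow> f x = g x) \<Longrightarrow> smooth_on S f \<longleftrightarrow> smooth_on S g"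
  unfolding smooth_on_def using Ck_on_cong by metis

lemma smooth_on_compose:
  fixes f :: "'a::real_normed_vector \<Rightarrow> 'b::euclidean_space" and g :: "'b \<Rightarrow> 'c::real_normed_vector"
  shows "open S \<Longrightarrow> open T \<Longrightarrow> smooth_on S f \<Longrightarrow> smooth_on T g \<Longrightarrow> f ` S \<subseteq> T \<Longrightarrow> smooth_on S (\<lambda>x. g (f x))"
  unfolding smooth_on_def using Ck_on_compose by blast

locale immersion =
  fixes f :: "real^'m::finite \<Rightarrow> real^'n::finite" and V
  assumes openV: "open V" and smooth_f: "smooth_on V f"
    and inj_der: "\<And>y. y \<in> V \<Longrightarrow> inj (frechet_derivative f (at y))"
begin

definition A where "A y = matrix (frechet_derivative f (at y))"
definition G where "G y = transpose (A y) ** A y"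
abbreviation s where "s \<equiv> area_density f"
text \<open>The columns of B are the tangent vectors dual to the columns of A: A^T B = 1
  (\<open>A_B\<close>), so B^T is a left inverse of A.\<close>

definition B where "B y = A y ** matrix_inv (G y)"
text \<open>The matrix B A^T, which is the orthogonal projection onto the span of the columns of
  A.\<close>

definition P where "P k l y = (\<Sum>a\<in>UNIV. B y $ k $ a * A y $ l $ a)"
text \<open>Minus the tangential divergence of the l-th column of P. This is the mean curvature
  written without defining functions; \<open>h_grad\<close> and \<open>mean_curvature_eq\<close>
  make the identification.\<close>

definition h where "h l y = - (\<Sum>k\<in>UNIV. \<Sum>b\<in>UNIV. B y $ k $ b * partial b (P k l) y)"

lemma A_nth: "A y $ k $ a = frechet_derivative f (at y) (axis a 1) $ k"
  by (simp add: A_def matrix_def)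

lemma derf: "y \<in> V \<Longrightarrow> (f has_derivative frechet_derivative f (at y)) (at y)"
  using smooth_on_has_derivative[OF smooth_f] .

lemma A_apply: "y \<in> V \<Longrightarrow> A y *v v = frechet_derivative f (at y) v"
  using matrix_vector_mul(2)[OF has_derivative_linear[OF derf]] unfolding A_def by metis

lemma A_partial:
  assumes "y \<in> V"
  shows "A y $ k $ a = partial a (\<lambda>y. f y $ k) y"
proof -
  have "((\<lambda>y. f y $ k) has_derivative (\<lambda>h. frechet_derivative f (at y) h $ k)) (at y)"
    using derf[OF assms] by (rule bounded_linear.has_derivative[OF bounded_linear_vec_nth])
  from partial_has_derivative[OF this] show ?thesis by (simp add: A_nth)
qed

lemma smooth_comp: "smooth_on V (\<lambda>y. f y $ k)"
  using Ck_on_vec_nth[OF openV] smooth_f unfolding smooth_on_def by blast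

lemma smooth_A: "smooth_on V (\<lambda>y. A y $ k $ a)"
  unfolding A_nth smooth_on_def
  using Ck_on_vec_nth[OF openV] smooth_on_frechet_derivative[OF smooth_f] unfolding smooth_on_def by blast

lemma G_nth: "G y $ a $ b = (\<Sum>k\<in>UNIV. A y $ k $ a * A y $ k $ b)"
  by (simp add: G_def matrix_matrix_mult_def transpose_def)

lemma smooth_G: "smooth_on V (\<lambda>y. G y $ a $ b)"
  unfolding G_nth by (intro smooth_on_sum smooth_on_mult smooth_A openV)

lemma inj_A: "y \<in> V \<Longrightarrow> inj ((*v) (A y))"
  using inj_der A_apply by (simp add: inj_on_def)

lemma det_G_pos: "y \<in> V \<Longrightarrow> det (G y) > 0"
  unfolding G_def by (intro det_gram_pos inj_A)

lemma s_def: "s y = sqrt (det (G y))"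
  by (simp add: area_density_def G_def A_def Let_def)

lemma s_pos: "y \<in> V \<Longrightarrow> s y > 0"
  by (simp add: s_def det_G_pos)

lemma G_inv:
  assumes "y \<in> V"
  shows "G y ** matrix_inv (G y) = mat 1" "matrix_inv (G y) ** G y = mat 1"
proof -
  have "invertible (G y)" using det_G_pos[OF assms] by (simp add: invertible_det_nz)
  then show "G y ** matrix_inv (G y) = mat 1" "matrix_inv (G y) ** G y = mat 1"
    using matrix_inv_def[of "G y"] someI_ex[of "\<lambda>B. G y ** B = mat 1 \<and> B ** G y = mat 1"]
    unfolding invertible_def by simp_all
qed

lemma G_sym: "transpose (G y) = G y"
  by (simp add: G_def matrix_transpose_mul)

lemma G_inv_sym:
  assumes "y \<in> V"
  shows "transpose (matrix_inv (G y)) = matrix_inv (G y)"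
proof -
  have "transpose (matrix_inv (G y)) ** G y = mat 1"
    using arg_cong[OF G_inv(1)[OF assms], of transpose] by (simp add: matrix_transpose_mul G_sym)
  then show ?thesis
    by (metis G_inv(1)[OF assms] matrix_mul_assoc matrix_mul_lid matrix_mul_rid)
qed

lemma smooth_det_G: "smooth_on V (\<lambda>y. det (G y))"
  using smooth_G unfolding smooth_on_def by (auto intro: Ck_on_det openV)

lemma smooth_s: "smooth_on V s"
proof -
  have "Ck_on k V (\<lambda>y. det (G y) powr (1/2))" for k
    by (rule Ck_on_powr[OF openV]) (use smooth_det_G det_G_pos in \<open>auto simp: smooth_on_def\<close>)
  then have "smooth_on V (\<lambda>y. det (G y) powr (1/2))" by (simp add: smooth_on_def)
  then show ?thesis
    by (subst smooth_on_cong[OF openV, of s "\<lambda>y. det (G y) powr (1/2)"])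
      (auto simp: s_def powr_half_sqrt det_G_pos less_imp_le)
qed

lemma smooth_G_inv: "smooth_on V (\<lambda>y. matrix_inv (G y) $ a $ b)"
  unfolding smooth_on_def
proof
  fix k show "Ck_on k V (\<lambda>y. matrix_inv (G y) $ a $ b)"
    by (rule Ck_on_matrix_inv[OF openV smooth_on_Ck[OF smooth_G]]) (use det_G_pos in fastforce)
qed

lemma B_nth: "B y $ k $ b = (\<Sum>a\<in>UNIV. A y $ k $ a * matrix_inv (G y) $ a $ b)"
  by (simp add: B_def matrix_matrix_mult_def)

lemma smooth_B: "smooth_on V (\<lambda>y. B y $ k $ b)"
  unfolding B_nth by (intro smooth_on_sum smooth_on_mult smooth_A smooth_G_inv openV)

lemma smooth_P: "smooth_on V (P k l)"
  unfolding P_def[abs_def] by (intro smooth_on_sum smooth_on_mult smooth_A smooth_B openV)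

lemma smooth_h: "smooth_on V (h l)"
proof -
  have "smooth_on V (\<lambda>y. (-1) * (\<Sum>k\<in>UNIV. \<Sum>b\<in>UNIV. B y $ k $ b * partial b (P k l) y))"
    by (intro smooth_on_sum smooth_on_mult smooth_B smooth_on_partial smooth_P openV smooth_on_const)
  then show ?thesis by (simp add: h_def[abs_def])
qed

lemma A_B:
  assumes "y \<in> V"
  shows "(\<Sum>k\<in>UNIV. A y $ k $ a * B y $ k $ b) = (if a = b then 1 else 0)"
proof -
  have "transpose (A y) ** B y = mat 1"
    unfolding B_def matrix_mul_assoc G_def[symmetric] by (rule G_inv(1)[OF assms])
  then have "(transpose (A y) ** B y) $ a $ b = mat 1 $ a $ b" by simp
  then show ?thesis by (simp add: matrix_matrix_mult_def transpose_def mat_def)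
qed

lemma P_matrix: "P k l y = (B y ** transpose (A y)) $ k $ l"
  by (simp add: P_def matrix_matrix_mult_def transpose_def)

lemma P_sym:
  assumes "y \<in> V"
  shows "P k l y = P l k y"
proof -
  have "transpose (B y ** transpose (A y)) = B y ** transpose (A y)"
    by (simp add: B_def matrix_transpose_mul G_inv_sym[OF assms] matrix_mul_assoc)
  then have "transpose (B y ** transpose (A y)) $ k $ l = (B y ** transpose (A y)) $ k $ l" by simp
  then show ?thesis by (simp add: P_matrix transpose_def)
qed

lemma P_A:
  assumes "y \<in> V"
  shows "(\<Sum>l\<in>UNIV. P k l y * A y $ l $ a) = A y $ k $ a"
proof -
  have "B y ** transpose (A y) ** A y = A y"
    by (simp add: B_def matrix_mul_assoc[symmetric] G_def[symmetric] G_inv(2)[OF assms])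
  then have "(B y ** transpose (A y) ** A y) $ k $ a = A y $ k $ a" by simp
  then show ?thesis by (simp add: matrix_matrix_mult_def[of "B y ** transpose (A y)"] P_matrix)
qed

lemma B_P:
  assumes "y \<in> V"
  shows "(\<Sum>k\<in>UNIV. B y $ k $ b * P k l y) = B y $ l $ b"
proof -
  have "(\<Sum>k\<in>UNIV. B y $ k $ b * P k l y) = (\<Sum>k\<in>UNIV. \<Sum>a\<in>UNIV. B y $ l $ a * (A y $ k $ a * B y $ k $ b))"
    by (simp add: P_sym[OF assms, of _ l]) (simp add: P_def sum_distrib_left mult_ac)
  also have "\<dots> = (\<Sum>a\<in>UNIV. B y $ l $ a * (\<Sum>k\<in>UNIV. A y $ k $ a * B y $ k $ b))"
    by (subst sum.swap) (simp add: sum_distrib_left)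
  also have "\<dots> = B y $ l $ b" by (simp add: A_B[OF assms] if_distrib cong: if_cong)
  finally show ?thesis .
qed

lemma trace_P:
  assumes "y \<in> V"
  shows "(\<Sum>k\<in>UNIV. P k k y) = real CARD('m)"
proof -
  have "(\<Sum>k\<in>UNIV. P k k y) = (\<Sum>a\<in>UNIV. \<Sum>k\<in>UNIV. A y $ k $ a * B y $ k $ a)"
    unfolding P_def by (subst sum.swap) (simp add: mult.commute)
  then show ?thesis by (simp add: A_B[OF assms])
qed

text \<open>The columns of A are the first partial derivatives of f, so this is the symmetry of
  second derivatives.\<close>

lemma partial_A_sym:
  assumes "y \<in> V"
  shows "partial b (\<lambda>y. A y $ k $ a) y = partial a (\<lambda>y. A y $ k $ b) y"
proof -
  have e: "partial b (\<lambda>y. A y $ k $ a) y = frechet_derivative (\<lambda>z. frechet_derivative (\<lambda>y. f y $ k) (at z) (axis a 1)) (at y) (axis b 1)" for a b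
    using partial_cong_open[OF openV assms, of "\<lambda>y. A y $ k $ a" "partial a (\<lambda>y. f y $ k)"] A_partial
    unfolding partial_def by simp
  show ?thesis unfolding e
    by (rule second_derivative_symmetric[OF openV assms smooth_on_Ck[OF smooth_comp]])
qed

text \<open>The logarithmic derivative of the square root of det G is half the trace of G^-1 times
  the derivative of G, and the product rule on G = A^T A yields the same trace twice.\<close>

lemma partial_s:
  assumes "y \<in> V"
  shows "partial a s y = s y * (\<Sum>k\<in>UNIV. \<Sum>b\<in>UNIV. B y $ k $ b * partial a (\<lambda>y. A y $ k $ b) y)"
proof -
  let ?I = "matrix_inv (G y)" and ?D = "\<lambda>k b. partial a (\<lambda>y. A y $ k $ b) y"
  define T where "T = (\<Sum>k\<in>UNIV. \<Sum>b\<in>UNIV. B y $ k $ b * ?D k b)"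
  have dA: "(\<lambda>y. A y $ k $ b) differentiable (at y)" for k b
    by (rule smooth_on_differentiable[OF smooth_A assms])
  have dG: "(\<lambda>y. G y $ k $ b) differentiable (at y)" for k b
    by (rule smooth_on_differentiable[OF smooth_G assms])
  have pG: "partial a (\<lambda>y. G y $ b $ c) y = (\<Sum>k\<in>UNIV. A y $ k $ b * ?D k c + ?D k b * A y $ k $ c)" for b c
    unfolding G_nth by (subst partial_sum) (auto simp: dA partial_mult intro: differentiable_mult)
  have det: "((\<lambda>y. det (G y)) has_derivative
     (\<lambda>h. det (G y) * (\<Sum>i\<in>UNIV. \<Sum>k\<in>UNIV. ?I $ i $ k * frechet_derivative (\<lambda>y. G y $ k $ i) (at y) h))) (at y)"
  proof (rule det_has_derivative[where A=G and ?x0.0=y and A'="\<lambda>k i. frechet_derivative (\<lambda>y. G y $ k $ i) (at y)"])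
    show "((\<lambda>x. G x $ i $ j) has_derivative frechet_derivative (\<lambda>y. G y $ i $ j) (at y)) (at y)" for i j
      by (rule differentiable_has_derivative_frechet[OF dG])
  qed (rule G_inv(2)[OF assms])
  have "((\<lambda>y. sqrt (det (G y))) has_derivative
     (\<lambda>h. (det (G y) * (\<Sum>i\<in>UNIV. \<Sum>k\<in>UNIV. ?I $ i $ k * frechet_derivative (\<lambda>y. G y $ k $ i) (at y) h)) * (inverse (sqrt (det (G y))) / 2))) (at y)"
    by (rule DERIV_compose_FDERIV[OF DERIV_real_sqrt[OF det_G_pos[OF assms]] det])
  from partial_has_derivative[OF this]
  have ps: "partial a s y = det (G y) * (\<Sum>i\<in>UNIV. \<Sum>k\<in>UNIV. ?I $ i $ k * partial a (\<lambda>y. G y $ k $ i) y) * (inverse (s y) / 2)"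
    unfolding s_def[abs_def] partial_def by simp
  have "(\<Sum>i\<in>UNIV. \<Sum>j\<in>UNIV. ?I $ i $ j * partial a (\<lambda>y. G y $ j $ i) y)
      = (\<Sum>i\<in>UNIV. \<Sum>j\<in>UNIV. \<Sum>k\<in>UNIV. ?I $ i $ j * (A y $ k $ j * ?D k i))
      + (\<Sum>i\<in>UNIV. \<Sum>j\<in>UNIV. \<Sum>k\<in>UNIV. ?I $ i $ j * (?D k j * A y $ k $ i))"
    unfolding pG by (simp add: sum_distrib_left sum.distrib distrib_left)
  also have "(\<Sum>i\<in>UNIV. \<Sum>j\<in>UNIV. \<Sum>k\<in>UNIV. ?I $ i $ j * (?D k j * A y $ k $ i)) = T"
  proof -
    have "(\<Sum>i\<in>UNIV. \<Sum>j\<in>UNIV. \<Sum>k\<in>UNIV. ?I $ i $ j * (?D k j * A y $ k $ i))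
        = (\<Sum>j\<in>UNIV. \<Sum>i\<in>UNIV. \<Sum>k\<in>UNIV. ?I $ i $ j * (?D k j * A y $ k $ i))" by (rule sum.swap)
    also have "\<dots> = (\<Sum>j\<in>UNIV. \<Sum>k\<in>UNIV. \<Sum>i\<in>UNIV. ?I $ i $ j * (?D k j * A y $ k $ i))"
      by (intro sum.cong refl sum.swap)
    also have "\<dots> = (\<Sum>k\<in>UNIV. \<Sum>j\<in>UNIV. \<Sum>i\<in>UNIV. ?I $ i $ j * (?D k j * A y $ k $ i))" by (rule sum.swap)
    also have "\<dots> = T" unfolding T_def B_nth sum_distrib_right by (simp add: mult_ac)
    finally show ?thesis .
  qed
  also have "(\<Sum>i\<in>UNIV. \<Sum>j\<in>UNIV. \<Sum>k\<in>UNIV. ?I $ i $ j * (A y $ k $ j * ?D k i)) = T"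
  proof -
    have sym: "?I $ i $ j = ?I $ j $ i" for i j
      using arg_cong[OF G_inv_sym[OF assms], of "\<lambda>M. M $ i $ j"] by (simp add: transpose_def)
    have "(\<Sum>i\<in>UNIV. \<Sum>j\<in>UNIV. \<Sum>k\<in>UNIV. ?I $ i $ j * (A y $ k $ j * ?D k i))
        = (\<Sum>i\<in>UNIV. \<Sum>k\<in>UNIV. \<Sum>j\<in>UNIV. ?I $ i $ j * (A y $ k $ j * ?D k i))"
      by (intro sum.cong refl sum.swap)
    also have "\<dots> = (\<Sum>k\<in>UNIV. \<Sum>i\<in>UNIV. \<Sum>j\<in>UNIV. ?I $ i $ j * (A y $ k $ j * ?D k i))" by (rule sum.swap)
    also have "\<dots> = T" unfolding T_def B_nth sum_distrib_right
      by (intro sum.cong refl) (simp add: sym mult_ac)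
    finally show ?thesis .
  qed
  finally have "partial a s y = det (G y) * (2 * T) * (inverse (s y) / 2)" using ps by simp
  moreover have "det (G y) = s y * s y" using det_G_pos[OF assms] by (simp add: s_def)
  ultimately show ?thesis using s_pos[OF assms] by (simp add: T_def)
qed

text \<open>The classical coordinate formula for the divergence of a tangent field, here A \<xi>.
  Derivatives falling on A become, by symmetry of second derivatives, the logarithmic derivative of
  the area density s.\<close>

lemma divergence_tangential:
  assumes y: "y \<in> V" and \<xi>: "\<And>a. \<xi> a differentiable (at y)"
  shows "s y * (\<Sum>k\<in>UNIV. \<Sum>b\<in>UNIV. B y $ k $ b * partial b (\<lambda>y. \<Sum>a\<in>UNIV. A y $ k $ a * \<xi> a y) y)
       = (\<Sum>a\<in>UNIV. partial a (\<lambda>y. s y * \<xi> a y) y)"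
proof -
  have dA: "(\<lambda>y. A y $ k $ b) differentiable (at y)" for k b
    by (rule smooth_on_differentiable[OF smooth_A y])
  have ds: "s differentiable (at y)" by (rule smooth_on_differentiable[OF smooth_s y])
  have p: "partial b (\<lambda>y. \<Sum>a\<in>UNIV. A y $ k $ a * \<xi> a y) y
     = (\<Sum>a\<in>UNIV. A y $ k $ a * partial b (\<xi> a) y + partial a (\<lambda>y. A y $ k $ b) y * \<xi> a y)" for k b
    by (subst partial_sum) (auto simp: dA \<xi> partial_mult partial_A_sym[OF y] intro: differentiable_mult)
  have "(\<Sum>k\<in>UNIV. \<Sum>b\<in>UNIV. B y $ k $ b * partial b (\<lambda>y. \<Sum>a\<in>UNIV. A y $ k $ a * \<xi> a y) y)
      = (\<Sum>k\<in>UNIV. \<Sum>b\<in>UNIV. \<Sum>a\<in>UNIV. partial b (\<xi> a) y * (A y $ k $ a * B y $ k $ b))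
      + (\<Sum>k\<in>UNIV. \<Sum>b\<in>UNIV. \<Sum>a\<in>UNIV. \<xi> a y * (B y $ k $ b * partial a (\<lambda>y. A y $ k $ b) y))"
    unfolding p by (simp add: sum_distrib_left sum.distrib distrib_left mult_ac)
  also have "(\<Sum>k\<in>UNIV. \<Sum>b\<in>UNIV. \<Sum>a\<in>UNIV. partial b (\<xi> a) y * (A y $ k $ a * B y $ k $ b))
      = (\<Sum>a\<in>UNIV. partial a (\<xi> a) y)"
  proof -
    have "(\<Sum>k\<in>UNIV. \<Sum>b\<in>UNIV. \<Sum>a\<in>UNIV. partial b (\<xi> a) y * (A y $ k $ a * B y $ k $ b))
       = (\<Sum>b\<in>UNIV. \<Sum>k\<in>UNIV. \<Sum>a\<in>UNIV. partial b (\<xi> a) y * (A y $ k $ a * B y $ k $ b))" by (rule sum.swap)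
    also have "\<dots> = (\<Sum>b\<in>UNIV. \<Sum>a\<in>UNIV. \<Sum>k\<in>UNIV. partial b (\<xi> a) y * (A y $ k $ a * B y $ k $ b))"
      by (intro sum.cong refl sum.swap)
    also have "\<dots> = (\<Sum>b\<in>UNIV. \<Sum>a\<in>UNIV. partial b (\<xi> a) y * (if a = b then 1 else 0))"
      by (simp add: sum_distrib_left[symmetric] A_B[OF y])
    also have "\<dots> = (\<Sum>a\<in>UNIV. partial a (\<xi> a) y)" by (simp add: if_distrib cong: if_cong)
    finally show ?thesis .
  qed
  also have "(\<Sum>k\<in>UNIV. \<Sum>b\<in>UNIV. \<Sum>a\<in>UNIV. \<xi> a y * (B y $ k $ b * partial a (\<lambda>y. A y $ k $ b) y))
      = (\<Sum>a\<in>UNIV. \<xi> a y * (\<Sum>k\<in>UNIV. \<Sum>b\<in>UNIV. B y $ k $ b * partial a (\<lambda>y. A y $ k $ b) y))"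
  proof -
    have "(\<Sum>k\<in>UNIV. \<Sum>b\<in>UNIV. \<Sum>a\<in>UNIV. \<xi> a y * (B y $ k $ b * partial a (\<lambda>y. A y $ k $ b) y))
       = (\<Sum>k\<in>UNIV. \<Sum>a\<in>UNIV. \<Sum>b\<in>UNIV. \<xi> a y * (B y $ k $ b * partial a (\<lambda>y. A y $ k $ b) y))"
      by (intro sum.cong refl sum.swap)
    also have "\<dots> = (\<Sum>a\<in>UNIV. \<Sum>k\<in>UNIV. \<Sum>b\<in>UNIV. \<xi> a y * (B y $ k $ b * partial a (\<lambda>y. A y $ k $ b) y))"
      by (rule sum.swap)
    finally show ?thesis by (simp add: sum_distrib_left)
  qed
  finally have "s y * (\<Sum>k\<in>UNIV. \<Sum>b\<in>UNIV. B y $ k $ b * partial b (\<lambda>y. \<Sum>a\<in>UNIV. A y $ k $ a * \<xi> a y) y)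
     = (\<Sum>a\<in>UNIV. s y * partial a (\<xi> a) y) + (\<Sum>a\<in>UNIV. \<xi> a y * (s y * (\<Sum>k\<in>UNIV. \<Sum>b\<in>UNIV. B y $ k $ b * partial a (\<lambda>y. A y $ k $ b) y)))"
    by (simp add: distrib_left sum_distrib_left mult_ac)
  also have "\<dots> = (\<Sum>a\<in>UNIV. partial a (\<lambda>y. s y * \<xi> a y) y)"
    unfolding partial_s[OF y, symmetric] by (simp add: partial_mult[OF ds \<xi>] sum.distrib mult.commute)
  finally show ?thesis .
qed

text \<open>The divergence formula is applied to the tangent field F P e_l, whose chart components
  are \<xi>_a = F B_la. Up to the factor s, differentiating F gives the first term on the left and
  differentiating P gives - F h_l.\<close>

lemma first_variation_pointwise:
  assumes y: "y \<in> V" and F: "F differentiable (at y)"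
  shows "s y * (\<Sum>b\<in>UNIV. B y $ l $ b * partial b F y) - s y * F y * h l y
      = (\<Sum>a\<in>UNIV. partial a (\<lambda>y. s y * (F y * B y $ l $ a)) y)"
proof -
  have dB: "(\<lambda>y. B y $ k $ b) differentiable (at y)" for k b
    by (rule smooth_on_differentiable[OF smooth_B y])
  have dP: "P k l differentiable (at y)" for k
    by (rule smooth_on_differentiable[OF smooth_P y])
  have FP: "(\<Sum>a\<in>UNIV. A z $ k $ a * (F z * B z $ l $ a)) = F z * P k l z" if "z \<in> V" for z k
    by (subst P_sym[OF that]) (simp add: P_def sum_distrib_left mult_ac)
  have p: "partial b (\<lambda>z. \<Sum>a\<in>UNIV. A z $ k $ a * (F z * B z $ l $ a)) y
     = F y * partial b (P k l) y + partial b F y * P k l y" for k b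
    using partial_cong_open[OF openV y FP] partial_mult[OF F dP] by simp
  have "(\<Sum>a\<in>UNIV. partial a (\<lambda>y. s y * (F y * B y $ l $ a)) y)
     = s y * (\<Sum>k\<in>UNIV. \<Sum>b\<in>UNIV. B y $ k $ b * (F y * partial b (P k l) y + partial b F y * P k l y))"
    by (subst divergence_tangential[OF y, of "\<lambda>a y. F y * B y $ l $ a", symmetric])
      (auto simp: p intro: differentiable_mult F dB)
  also have "(\<Sum>k\<in>UNIV. \<Sum>b\<in>UNIV. B y $ k $ b * (F y * partial b (P k l) y + partial b F y * P k l y))
     = F y * (\<Sum>k\<in>UNIV. \<Sum>b\<in>UNIV. B y $ k $ b * partial b (P k l) y)
      + (\<Sum>b\<in>UNIV. \<Sum>k\<in>UNIV. partial b F y * (B y $ k $ b * P k l y))"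
    by (subst (2) sum.swap) (simp add: sum_distrib_left sum.distrib distrib_left mult_ac)
  also have "(\<Sum>b\<in>UNIV. \<Sum>k\<in>UNIV. partial b F y * (B y $ k $ b * P k l y)) = (\<Sum>b\<in>UNIV. B y $ l $ b * partial b F y)"
    unfolding sum_distrib_left[symmetric] B_P[OF y] by (simp add: mult.commute)
  finally show ?thesis by (simp add: h_def algebra_simps)
qed

text \<open>The right-hand side of the pointwise identity is a sum of partial derivatives of
  compactly supported functions, whose integrals vanish.\<close>

lemma first_variation:
  assumes F: "Ck_on 1 V F" and K: "compact K" "K \<subseteq> V" "\<And>y. y \<in> V - K \<Longrightarrow> F y = 0"
  shows "(\<integral>y. indicator V y * (s y * (\<Sum>b\<in>UNIV. B y $ l $ b * partial b F y)) \<partial>lborel)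
       = (\<integral>y. indicator V y * (s y * F y * h l y) \<partial>lborel)"
proof -
  have dF: "F differentiable (at y)" if "y \<in> V" for y using F that by simp
  have oVK: "open (V - K)" using openV compact_imp_closed[OF K(1)] by blast
  \<comment> \<open>The extension by 0 is C^1 because the open sets \<open>V\<close> and
    \<open>- K\<close> cover the space and on each of them it is given by a C^1 formula.\<close>
  define g where "g a y = (if y \<in> V then s y * (F y * B y $ l $ a) else 0)" for a y
  have gC: "Ck_on 1 UNIV (g a)" for a
  proof (rule Ck_on_local[OF open_UNIV])
    fix x :: "real^'m"
    show "\<exists>U. open U \<and> x \<in> U \<and> Ck_on 1 U (g a)"
    proof (cases "x \<in> V")
      case True
      have "Ck_on 1 V (\<lambda>y. s y * (F y * B y $ l $ a))"
        by (intro Ck_on_mult openV F smooth_on_Ck smooth_s smooth_B)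
      then have "Ck_on 1 V (g a)" by (subst Ck_on_cong[OF openV, of "g a" "\<lambda>y. s y * (F y * B y $ l $ a)"]) (auto simp: g_def)
      then show ?thesis using True openV by blast
    next
      case False
      have o: "open (- K)" using compact_imp_closed[OF K(1)] by auto
      have "Ck_on 1 (- K) (g a)"
        by (subst Ck_on_cong[OF o, of "g a" "\<lambda>_. 0"]) (use K(3) o in \<open>auto simp: g_def\<close>)
      then show ?thesis using False K(2) o by (intro exI[of _ "- K"]) auto
    qed
  qed
  have g0: "g a y = 0" if "y \<notin> K" for a y using that K(3)[of y] by (auto simp: g_def)
  have int0: "(\<integral>y. partial a (g a) y \<partial>lborel) = 0" for a
    unfolding partial_def by (rule integral_derivative_compact_support[OF gC K(1) g0])
  have pg: "partial a (g a) y = indicator V y * partial a (\<lambda>y. s y * (F y * B y $ l $ a)) y" for a y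
  proof (cases "y \<in> V")
    case True
    then show ?thesis using partial_cong_open[OF openV True, of "g a" "\<lambda>y. s y * (F y * B y $ l $ a)"] by (simp add: g_def)
  next
    case False
    have "partial a (g a) y = partial a (\<lambda>_. 0) y"
      by (rule partial_cong_open[of "- K"]) (use compact_imp_closed[OF K(1)] False K(2) g0 in auto)
    then show ?thesis using False by simp
  qed
  have pF0: "partial b F y = 0" if "y \<in> V - K" for b y
    using partial_cong_open[OF oVK that, of F "\<lambda>_. 0"] K(3) by simp
  have cF: "continuous_on V F" using F by (rule Ck_on_continuous)
  have cpF: "continuous_on V (partial b F)" for b using Ck_on_partial[of 0 V F b] F by simp
  note cont = continuous_intros smooth_on_continuous[OF smooth_s] smooth_on_continuous[OF smooth_B]
    smooth_on_continuous[OF smooth_h] cF cpF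
  have i1: "integrable lborel (\<lambda>y. indicator V y * (s y * (\<Sum>b\<in>UNIV. B y $ l $ b * partial b F y)))"
    by (rule integrable_compact_support[OF _ K(1,2)]) (auto intro!: cont simp: pF0)
  have i2: "integrable lborel (\<lambda>y. indicator V y * (s y * F y * h l y))"
    by (rule integrable_compact_support[OF _ K(1,2)]) (auto intro!: cont simp: K(3))
  have ig: "integrable lborel (partial a (g a))" for a
  proof -
    have c: "continuous_on UNIV (partial a (g a))" using Ck_on_partial[of 0 UNIV "g a" a] gC by simp
    have "integrable lborel (\<lambda>y. indicator UNIV y * partial a (g a) y)"
    proof (rule integrable_compact_support[OF c K(1)])
      fix y assume "y \<in> UNIV - K"
      then have "partial a (g a) y = partial a (\<lambda>_. 0) y"
        using compact_imp_closed[OF K(1)] g0 by (intro partial_cong_open[of "- K"]) auto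
      then show "partial a (g a) y = 0" by simp
    qed auto
    then show ?thesis by simp
  qed
  have "(\<integral>y. indicator V y * (s y * (\<Sum>b\<in>UNIV. B y $ l $ b * partial b F y)) \<partial>lborel)
       - (\<integral>y. indicator V y * (s y * F y * h l y) \<partial>lborel)
     = (\<integral>y. indicator V y * (s y * (\<Sum>b\<in>UNIV. B y $ l $ b * partial b F y)) - indicator V y * (s y * F y * h l y) \<partial>lborel)"
    by (rule Bochner_Integration.integral_diff[OF i1 i2, symmetric])
  also have "\<dots> = (\<integral>y. (\<Sum>a\<in>UNIV. partial a (g a) y) \<partial>lborel)"
  proof (rule Bochner_Integration.integral_cong[OF refl])
    fix y
    show "indicator V y * (s y * (\<Sum>b\<in>UNIV. B y $ l $ b * partial b F y)) - indicator V y * (s y * F y * h l y)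
        = (\<Sum>a\<in>UNIV. partial a (g a) y)"
      by (cases "y \<in> V") (auto simp: pg first_variation_pointwise dF)
  qed
  also have "\<dots> = (\<Sum>a\<in>UNIV. \<integral>y. partial a (g a) y \<partial>lborel)"
    by (rule Bochner_Integration.integral_sum) (rule ig)
  also have "\<dots> = 0" by (simp add: int0)
  finally show ?thesis by simp
qed

end

lemma open_preimage: "open V \<Longrightarrow> continuous_on V f \<Longrightarrow> open U \<Longrightarrow> open {y \<in> V. f y \<in> U}"
proof -
  assume "open V" "continuous_on V f" "open U"
  then have "open (V \<inter> f -` U)" by (intro continuous_open_preimage)
  moreover have "V \<inter> f -` U = {y \<in> V. f y \<in> U}" by auto
  ultimately show ?thesis by simp
qed

lemma sum_eq_axis:
  fixes D :: "real^'n \<Rightarrow> real"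
  assumes "linear D"
  shows "D v = (\<Sum>k\<in>UNIV. v $ k * D (axis k 1))"
proof -
  have "v = (\<Sum>k\<in>UNIV. v $ k *\<^sub>R axis k 1)"
    by (simp add: vec_eq_iff axis_def if_distrib cong: if_cong)
  then have "D v = D (\<Sum>k\<in>UNIV. v $ k *\<^sub>R axis k 1)" by simp
  also have "\<dots> = (\<Sum>k\<in>UNIV. v $ k * D (axis k 1))"
    using assms by (simp add: linear_sum linear_scale)
  finally show ?thesis .
qed

text \<open>n^# has the coefficients \<partial>_l \<rho>, and d puts dx_k in front of their
  derivatives: F_j is the Hessian of \<rho>_j.\<close>

lemma sd_Jop_conormal:
  fixes \<rho> :: "real^'n::{finite,linorder} \<Rightarrow> real"
  shows "sd (\<lambda>y. Jop (conormal \<rho> y)) x {k} {l} = partial k (partial l \<rho>) x"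
proof -
  let ?v = "\<lambda>k. \<chi> l. partial k (partial l \<rho>) x"
  have p: "(\<lambda>K L. partial k (\<lambda>y. Jop (conormal \<rho> y) K L) x) = coeff_of (yform (?v k))" for k
  proof (intro ext)
    fix K L
    show "partial k (\<lambda>y. Jop (conormal \<rho> y) K L) x = coeff_of (yform (?v k)) K L"
    proof (cases "K = {} \<and> (\<exists>l. L = {l})")
      case True
      then obtain l where "K = {}" "L = {l}" by auto
      then show ?thesis by (simp add: conormal_eq Jop_xform coeff_of_yform grad_def)
    next
      case False
      then have "coeff_of (yform v) K L = 0" for v :: "real^'n::{finite,linorder}"
        unfolding coeff_of_yform by (intro sum.neutral) auto
      then show ?thesis by (simp add: conormal_eq Jop_xform)
    qed
  qed
  have "sd (\<lambda>y. Jop (conormal \<rho> y)) x {k} {l} = coeff_of (\<Sum>k\<in>UNIV. \<Sum>l\<in>UNIV. ?v k $ l *\<^sub>R smono {k} {l}) {k} {l}"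
    unfolding sd_def p coeff_of_X[symmetric] times_superform.rep_eq[symmetric] coeff_of_sum[symmetric]
    by (simp add: yform_def sum_distrib_left smono_mult wedge_sign_def)
  also have "\<dots> = (\<Sum>k'\<in>UNIV. \<Sum>l'\<in>UNIV. if l' = l then (if k' = k then partial k' (partial l' \<rho>) x else 0) else 0)"
    unfolding coeff_of_sum scaleR_superform.rep_eq smono.rep_eq
    by (intro sum.cong refl) auto
  also have "\<dots> = partial k (partial l \<rho>) x" by simp
  finally show ?thesis .
qed

text \<open>For any orthonormal basis of T the sum of the b b^T is the projection 1 - \<Sum> n_j
  n_j^T; expressing the trace by it removes the \<open>SOME\<close> in
  \<open>trace_on\<close>.\<close>

lemma trace_on_eq:
  fixes F :: "'n::finite sform" and n :: "nat \<Rightarrow> real^'n"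
  assumes on: "\<forall>i<p. \<forall>j<p. n i \<bullet> n j = (if i = j then 1 else 0)"
    and T: "T = {v. \<forall>j<p. n j \<bullet> v = 0}"
  shows "trace_on T F = (\<Sum>k\<in>UNIV. \<Sum>l\<in>UNIV. F {k} {l} * ((if k = l then 1 else 0) - (\<Sum>j<p. n j $ k * n j $ l)))"
proof -
  define Q where "Q B \<longleftrightarrow> B \<subseteq> T \<and> pairwise orthogonal B \<and> (\<forall>b\<in>B. norm b = 1) \<and> span B = T" for B
  have subT: "subspace T" unfolding T subspace_def by (auto simp: inner_add_right)
  obtain B0 where "Q B0" unfolding Q_def using orthonormal_basis_subspace[OF subT] by metis
  define B where "B = (SOME B. Q B)"
  have "Q B" unfolding B_def using \<open>Q B0\<close> by (rule someI)
  then have BT: "B \<subseteq> T" and po: "pairwise orthogonal B" and nm: "\<And>b. b \<in> B \<Longrightarrow> norm b = 1" and sp: "span B = T"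
    unfolding Q_def by auto
  have "0 \<notin> B" using nm by force
  then have fin: "finite B" using pairwise_orthogonal_independent[OF po] independent_imp_finite by blast
  define P where "P k l = (if k = l then 1 else 0) - (\<Sum>j<p. n j $ k * n j $ l)" for k l
  have Pv: "(\<Sum>k\<in>UNIV. v $ k * P k l) = v $ l - (\<Sum>j<p. (n j \<bullet> v) * n j $ l)" for v l
  proof -
    have "v $ k * P k l = (if k = l then v $ l else 0) - (\<Sum>j<p. v $ k * (n j $ k * n j $ l))" for k
      by (auto simp: P_def right_diff_distrib sum_distrib_left)
    then have "(\<Sum>k\<in>UNIV. v $ k * P k l) = v $ l - (\<Sum>k\<in>UNIV. \<Sum>j<p. v $ k * (n j $ k * n j $ l))"
      by (simp add: sum_subtractf)
    also have "(\<Sum>k\<in>UNIV. \<Sum>j<p. v $ k * (n j $ k * n j $ l)) = (\<Sum>j<p. (n j \<bullet> v) * n j $ l)"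
      by (subst sum.swap) (simp add: inner_vec_def sum_distrib_right sum_distrib_left mult_ac)
    finally show ?thesis .
  qed
  have colT: "(\<chi> k. P k l) \<in> T" for l
    unfolding T
  proof (intro CollectI allI impI)
    fix i assume i: "i < p"
    have "n i \<bullet> (\<chi> k. P k l) = (\<Sum>k\<in>UNIV. n i $ k * P k l)" by (simp add: inner_vec_def)
    also have "\<dots> = n i $ l - (\<Sum>j<p. (if i = j then n j $ l else 0))"
      unfolding Pv by (intro arg_cong2[of _ _ _ _ "(-)"] refl sum.cong) (use on i in auto)
    also have "\<dots> = 0" using i by simp
    finally show "n i \<bullet> (\<chi> k. P k l) = 0" .
  qed
  \<comment> \<open>Expand the l-th column of the projection, a vector of T, in B; its inner product
    with b is the coordinate \<open>b $ l\<close>.\<close>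
  have S: "(\<Sum>b\<in>B. b $ k * b $ l) = P k l" for k l
  proof -
    have "(\<Sum>b\<in>B. ((\<chi> k. P k l) \<bullet> b) *\<^sub>R b) = (\<chi> k. P k l)"
      by (rule orthonormal_basis_expand[OF po nm _ fin]) (use colT sp in auto)
    from arg_cong[OF this, of "\<lambda>v. v $ k"]
    have "(\<Sum>b\<in>B. ((\<chi> k. P k l) \<bullet> b) * b $ k) = P k l" by (simp add: sum_component)
    moreover have "(\<chi> k. P k l) \<bullet> b = b $ l" if "b \<in> B" for b
    proof -
      have "(\<chi> k. P k l) \<bullet> b = (\<Sum>k\<in>UNIV. b $ k * P k l)" by (simp add: inner_vec_def mult.commute)
      also have "\<dots> = b $ l" unfolding Pv using BT that T by auto
      finally show ?thesis .
    qed
    ultimately show ?thesis by (simp add: mult.commute)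
  qed
  have "trace_on T F = (\<Sum>b\<in>B. \<Sum>k\<in>UNIV. \<Sum>l\<in>UNIV. F {k} {l} * b $ k * b $ l)"
    unfolding trace_on_def Let_def B_def Q_def ..
  also have "\<dots> = (\<Sum>k\<in>UNIV. \<Sum>l\<in>UNIV. \<Sum>b\<in>B. F {k} {l} * b $ k * b $ l)"
    by (subst sum.swap) (intro sum.cong refl sum.swap)
  also have "\<dots> = (\<Sum>k\<in>UNIV. \<Sum>l\<in>UNIV. F {k} {l} * P k l)"
    unfolding S[symmetric] by (simp add: sum_distrib_left mult.assoc)
  finally show ?thesis unfolding P_def .
qed

context immersion
begin

lemma chain_partial:
  assumes y: "y \<in> V" and F: "F differentiable (at (f y))"
  shows "partial a (\<lambda>z. F (f z)) y = (\<Sum>k\<in>UNIV. partial k F (f y) * A y $ k $ a)"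
proof -
  have dF: "(F has_derivative frechet_derivative F (at (f y))) (at (f y))"
    by (rule differentiable_has_derivative_frechet[OF F])
  have "partial a (\<lambda>z. F (f z)) y = frechet_derivative F (at (f y)) (frechet_derivative f (at y) (axis a 1))"
    using partial_has_derivative[OF has_derivative_compose[OF derf[OF y] dF]] .
  also have "\<dots> = (\<Sum>k\<in>UNIV. A y $ k $ a * partial k F (f y))"
    unfolding A_nth partial_def by (rule sum_eq_axis[OF has_derivative_linear[OF dF]])
  finally show ?thesis by (simp add: mult.commute)
qed

text \<open>Instead of comparing ranges, the Frobenius norm of R = 1 - P - N is computed, where N =
  \<Sum> n_j n_j^T. P and N have squared norms m and p, equal to their traces, and are orthogonal to
  each other, so the squared norm of R is n - m - p = 0.\<close>

lemma P_normal:
  fixes n :: "nat \<Rightarrow> real^'n"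
  assumes y: "y \<in> V" and on: "\<forall>i<p. \<forall>j<p. n i \<bullet> n j = (if i = j then 1 else 0)"
    and p: "p + CARD('m) = CARD('n)" and orth: "\<And>j a. j < p \<Longrightarrow> (\<Sum>k\<in>UNIV. n j $ k * A y $ k $ a) = 0"
  shows "P k l y = (if k = l then 1 else 0) - (\<Sum>j<p. n j $ k * n j $ l)"
proof -
  define N where "N k l = (\<Sum>j<p. n j $ k * n j $ l)" for k l
  have PP: "(\<Sum>k\<in>UNIV. \<Sum>l\<in>UNIV. P k l y * P k l y) = real CARD('m)"
  proof -
    have "(\<Sum>l\<in>UNIV. P k l y * P k l y) = P k k y" for k
    proof -
      have "(\<Sum>l\<in>UNIV. P k l y * P k l y) = (\<Sum>l\<in>UNIV. \<Sum>a\<in>UNIV. B y $ k $ a * (P k l y * A y $ l $ a))"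
        by (intro sum.cong refl) (simp add: P_def[of k _ y] sum_distrib_left mult_ac)
      also have "\<dots> = (\<Sum>a\<in>UNIV. B y $ k $ a * (\<Sum>l\<in>UNIV. P k l y * A y $ l $ a))"
        by (subst sum.swap) (simp add: sum_distrib_left)
      finally show ?thesis by (simp add: P_A[OF y]) (simp add: P_def)
    qed
    then show ?thesis by (simp add: trace_P[OF y])
  qed
  have Pn: "(\<Sum>l\<in>UNIV. P k l y * n j $ l) = 0" if "j < p" for k j
  proof -
    have "(\<Sum>l\<in>UNIV. P k l y * n j $ l) = (\<Sum>l\<in>UNIV. \<Sum>a\<in>UNIV. B y $ k $ a * (n j $ l * A y $ l $ a))"
      by (simp add: P_def sum_distrib_right sum_distrib_left mult_ac)
    also have "\<dots> = (\<Sum>a\<in>UNIV. B y $ k $ a * (\<Sum>l\<in>UNIV. n j $ l * A y $ l $ a))"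
      by (subst sum.swap) (simp add: sum_distrib_left)
    finally show ?thesis by (simp add: orth[OF that])
  qed
  have PN: "(\<Sum>k\<in>UNIV. \<Sum>l\<in>UNIV. P k l y * N k l) = 0"
  proof -
    have "(\<Sum>l\<in>UNIV. P k l y * N k l) = (\<Sum>j<p. n j $ k * (\<Sum>l\<in>UNIV. P k l y * n j $ l))" for k
      unfolding N_def sum_distrib_left by (subst sum.swap) (simp add: mult_ac)
    then show ?thesis by (simp add: Pn)
  qed
  have trN: "(\<Sum>k\<in>UNIV. N k k) = real p"
  proof -
    have "(\<Sum>k\<in>UNIV. N k k) = (\<Sum>j<p. n j \<bullet> n j)"
      unfolding N_def inner_vec_def by (subst sum.swap) simp
    also have "\<dots> = (\<Sum>j<p. 1)" by (rule sum.cong) (use on in auto)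
    finally show ?thesis by simp
  qed
  have NN: "(\<Sum>k\<in>UNIV. \<Sum>l\<in>UNIV. N k l * N k l) = real p"
  proof -
    have "(\<Sum>l\<in>UNIV. N k l * N k l) = N k k" for k
    proof -
      have "(\<Sum>l\<in>UNIV. N k l * N k l) = (\<Sum>l\<in>UNIV. \<Sum>i<p. \<Sum>j<p. n i $ k * n j $ k * (n i $ l * n j $ l))"
        unfolding N_def sum_product by (simp add: mult_ac)
      also have "\<dots> = (\<Sum>i<p. \<Sum>l\<in>UNIV. \<Sum>j<p. n i $ k * n j $ k * (n i $ l * n j $ l))" by (rule sum.swap)
      also have "\<dots> = (\<Sum>i<p. \<Sum>j<p. \<Sum>l\<in>UNIV. n i $ k * n j $ k * (n i $ l * n j $ l))"
        by (intro sum.cong refl sum.swap)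
      also have "\<dots> = (\<Sum>i<p. \<Sum>j<p. n i $ k * n j $ k * (n i \<bullet> n j))"
        by (simp add: inner_vec_def sum_distrib_left)
      also have "\<dots> = (\<Sum>i<p. \<Sum>j<p. if j = i then n i $ k * n i $ k else 0)"
        by (intro sum.cong refl) (use on in auto)
      also have "\<dots> = N k k" by (simp add: N_def)
      finally show ?thesis .
    qed
    then show ?thesis by (simp add: trN)
  qed
  define R where "R k l = (if k = l then 1 else 0) - P k l y - N k l" for k l
  have "R k l * R k l = (if l = k then 1 - 2 * P k k y - 2 * N k k else 0) + P k l y * P k l y + N k l * N k l + 2 * (P k l y * N k l)" for k l
    by (cases "k = l") (auto simp: R_def algebra_simps)
  then have "(\<Sum>k\<in>UNIV. \<Sum>l\<in>UNIV. R k l * R k l) = (\<Sum>k\<in>UNIV. 1 - 2 * P k k y - 2 * N k k)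
     + (\<Sum>k\<in>UNIV. \<Sum>l\<in>UNIV. P k l y * P k l y) + (\<Sum>k\<in>UNIV. \<Sum>l\<in>UNIV. N k l * N k l)
     + 2 * (\<Sum>k\<in>UNIV. \<Sum>l\<in>UNIV. P k l y * N k l)"
    by (simp add: sum.distrib sum_distrib_left)
  also have "\<dots> = real CARD('n) - 2 * real CARD('m) - 2 * real p + real CARD('m) + real p"
    by (simp add: PP NN PN trN trace_P[OF y] sum_subtractf sum_distrib_left[symmetric])
  also have "\<dots> = 0" using p by (simp flip: of_nat_add)
  finally have "(\<Sum>k\<in>UNIV. \<Sum>l\<in>UNIV. R k l * R k l) = 0" .
  then have "\<forall>k. (\<Sum>l\<in>UNIV. R k l * R k l) = 0"
    by (subst (asm) sum_nonneg_eq_0_iff) (auto intro: sum_nonneg)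
  then have "\<forall>k l. R k l * R k l = 0"
    by (subst (asm) sum_nonneg_eq_0_iff) auto
  then have "R k l = 0" by simp
  then show ?thesis by (simp add: R_def N_def)
qed

end

lemma unit_defining_at_grad:
  "unit_defining_at p M x \<rho> \<longleftrightarrow>
     (\<exists>U. x \<in> U \<and> zero_set_of p M U \<rho> \<and>
        (\<forall>y\<in>M \<inter> U. \<forall>i<p. \<forall>j<p. grad (\<rho> i) y \<bullet> grad (\<rho> j) y = (if i = j then 1 else 0)))"
  by (simp add: unit_defining_at_def dual_vector_conormal)

context immersion
begin

text \<open>\<open>\<rho> j\<close> vanishes on M \<inter> U, so its composition with f is
  constantly 0 near y; differentiate by the chain rule.\<close>

lemma grad_orthogonal:
  assumes fM: "f ` V \<subseteq> M" and zs: "zero_set_of p M U \<rho>" and y: "y \<in> V" "f y \<in> U" and j: "j < p"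
  shows "(\<Sum>k\<in>UNIV. grad (\<rho> j) (f y) $ k * A y $ k $ a) = 0"
proof -
  have U: "open U" "smooth_on U (\<rho> j)" "M \<inter> U = {x \<in> U. \<forall>j<p. \<rho> j x = 0}"
    using zs j by (auto simp: zero_set_of_def)
  have cf: "continuous_on V f" by (rule smooth_on_continuous[OF smooth_f])
  have "partial a (\<lambda>z. \<rho> j (f z)) y = partial a (\<lambda>_. 0) y"
    by (rule partial_cong_open[OF open_preimage[OF openV cf U(1)]]) (use y U fM j in auto)
  then show ?thesis
    using chain_partial[OF y(1) smooth_on_differentiable[OF U(2) y(2)], of a] by (simp add: grad_def)
qed

lemma P_grad:
  assumes fM: "f ` V \<subseteq> M" and zs: "zero_set_of p M U \<rho>" and y: "y \<in> V" "f y \<in> U"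
    and on: "\<forall>y\<in>M \<inter> U. \<forall>i<p. \<forall>j<p. grad (\<rho> i) y \<bullet> grad (\<rho> j) y = (if i = j then 1 else 0)"
    and p: "p + CARD('m) = CARD('n)"
  shows "P k l y = (if k = l then 1 else 0) - (\<Sum>j<p. grad (\<rho> j) (f y) $ k * grad (\<rho> j) (f y) $ l)"
  by (rule P_normal[OF y(1) _ p]) (use on fM y grad_orthogonal[OF fM zs y] in auto)

text \<open>Differentiate P = 1 - \<Sum> n_j n_j^T along the chart and contract with B. Where the
  derivative falls on the factor with index l, a tangent vector meets a normal one and the term is
  0; the other term is the trace of the Hessian of \<rho>_j against P.\<close>

lemma h_grad:
  assumes fM: "f ` V \<subseteq> M" and zs: "zero_set_of p M U \<rho>" and y: "y \<in> V" "f y \<in> U"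
    and on: "\<forall>y\<in>M \<inter> U. \<forall>i<p. \<forall>j<p. grad (\<rho> i) y \<bullet> grad (\<rho> j) y = (if i = j then 1 else 0)"
    and p: "p + CARD('m) = CARD('n)"
  shows "h l y = (\<Sum>j<p. (\<Sum>k\<in>UNIV. \<Sum>i\<in>UNIV. partial k (partial i (\<rho> j)) (f y) * P k i y) * grad (\<rho> j) (f y) $ l)"
proof -
  have U: "open U" "\<And>j. j < p \<Longrightarrow> smooth_on U (\<rho> j)"
    using zs by (auto simp: zero_set_of_def)
  have cf: "continuous_on V f" by (rule smooth_on_continuous[OF smooth_f])
  \<comment> \<open>\<open>P_grad\<close> holds on all of this neighbourhood, not just at y, so it
    may be differentiated.\<close>
  define W where "W = {z \<in> V. f z \<in> U}"
  have W: "open W" "y \<in> W" unfolding W_def using open_preimage[OF openV cf U(1)] y by auto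
  let ?g = "\<lambda>j k z. partial k (\<rho> j) (f z)"
  have dg: "?g j k differentiable (at y)" if "j < p" for j k
  proof -
    have "(partial k (\<rho> j)) differentiable (at (f y))"
      by (rule smooth_on_differentiable[OF smooth_on_partial[OF U(2)[OF that]] y(2)])
    then show ?thesis
      using differentiable_chain_at[OF smooth_on_differentiable[OF smooth_f y(1)]] by (simp add: o_def)
  qed
  have chain: "partial b (?g j k) y = (\<Sum>i\<in>UNIV. partial i (partial k (\<rho> j)) (f y) * A y $ i $ b)" if "j < p" for j k b
    by (rule chain_partial[OF y(1) smooth_on_differentiable[OF smooth_on_partial[OF U(2)[OF that]] y(2)]])
  have Bn: "(\<Sum>k\<in>UNIV. B y $ k $ b * ?g j k y) = 0" if "j < p" for j b
  proof -
    have "(\<Sum>k\<in>UNIV. B y $ k $ b * ?g j k y) = (\<Sum>k\<in>UNIV. \<Sum>a\<in>UNIV. matrix_inv (G y) $ a $ b * (?g j k y * A y $ k $ a))"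
      unfolding B_nth sum_distrib_right by (simp add: mult_ac)
    also have "\<dots> = (\<Sum>a\<in>UNIV. matrix_inv (G y) $ a $ b * (\<Sum>k\<in>UNIV. ?g j k y * A y $ k $ a))"
      by (subst sum.swap) (simp add: sum_distrib_left)
    finally show ?thesis using grad_orthogonal[OF fM zs y that] by (simp add: grad_def)
  qed
  have pP: "partial b (P k l) y = (\<Sum>j<p. - (?g j k y * partial b (?g j l) y + partial b (?g j k) y * ?g j l y))" for k b
  proof -
    have "partial b (P k l) y = partial b (\<lambda>z. (if k = l then 1 else 0) + (\<Sum>j<p. - 1 * (?g j k z * ?g j l z))) y"
      by (rule partial_cong_open[OF W]) (use P_grad[OF fM zs _ _ on p] in \<open>auto simp: W_def grad_def sum_negf\<close>)
    also have "\<dots> = partial b (\<lambda>z. \<Sum>j<p. - 1 * (?g j k z * ?g j l z)) y"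
    proof -
      have d: "(\<lambda>z. \<Sum>j<p. - 1 * (?g j k z * ?g j l z)) differentiable (at y)"
        by (intro differentiable_sum ballI differentiable_mult differentiable_const dg; simp)
      show ?thesis
        using partial_has_derivative[OF has_derivative_add[OF has_derivative_const differentiable_has_derivative_frechet[OF d]]]
        by (simp add: partial_def)
    qed
    also have "\<dots> = (\<Sum>j<p. partial b (\<lambda>z. - 1 * (?g j k z * ?g j l z)) y)"
      by (rule partial_sum) (intro differentiable_mult differentiable_const dg; simp)
    also have "\<dots> = (\<Sum>j<p. - (?g j k y * partial b (?g j l) y + partial b (?g j k) y * ?g j l y))"
    proof (intro sum.cong refl)
      fix j assume "j \<in> {..<p}"
      then have d: "?g j k differentiable (at y)" "?g j l differentiable (at y)" using dg by auto
      show "partial b (\<lambda>z. - 1 * (?g j k z * ?g j l z)) y = - (?g j k y * partial b (?g j l) y + partial b (?g j k) y * ?g j l y)"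
        using partial_mult[OF differentiable_const[of "-1::real"] differentiable_mult[OF d], of b] partial_mult[OF d, of b]
        by simp
    qed
    finally show ?thesis .
  qed
  have "h l y = (\<Sum>k\<in>UNIV. \<Sum>b\<in>UNIV. \<Sum>j<p. B y $ k $ b * (?g j k y * partial b (?g j l) y) + B y $ k $ b * (partial b (?g j k) y * ?g j l y))"
    unfolding h_def pP sum_negf mult_minus_right minus_minus sum_distrib_left distrib_left ..
  also have "\<dots> = (\<Sum>k\<in>UNIV. \<Sum>b\<in>UNIV. \<Sum>j<p. partial b (?g j l) y * (B y $ k $ b * ?g j k y))
       + (\<Sum>k\<in>UNIV. \<Sum>b\<in>UNIV. \<Sum>j<p. B y $ k $ b * (partial b (?g j k) y * ?g j l y))"
    by (simp add: sum.distrib mult_ac)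
  also have "(\<Sum>k\<in>UNIV. \<Sum>b\<in>UNIV. \<Sum>j<p. partial b (?g j l) y * (B y $ k $ b * ?g j k y)) = 0"
  proof -
    have "(\<Sum>k\<in>UNIV. \<Sum>b\<in>UNIV. \<Sum>j<p. partial b (?g j l) y * (B y $ k $ b * ?g j k y))
       = (\<Sum>b\<in>UNIV. \<Sum>k\<in>UNIV. \<Sum>j<p. partial b (?g j l) y * (B y $ k $ b * ?g j k y))" by (rule sum.swap)
    also have "\<dots> = (\<Sum>b\<in>UNIV. \<Sum>j<p. \<Sum>k\<in>UNIV. partial b (?g j l) y * (B y $ k $ b * ?g j k y))"
      by (intro sum.cong refl sum.swap)
    also have "\<dots> = 0" by (simp add: sum_distrib_left[symmetric] Bn)
    finally show ?thesis .
  qed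
  also have "(\<Sum>k\<in>UNIV. \<Sum>b\<in>UNIV. \<Sum>j<p. B y $ k $ b * (partial b (?g j k) y * ?g j l y))
     = (\<Sum>j<p. \<Sum>k\<in>UNIV. \<Sum>b\<in>UNIV. B y $ k $ b * (partial b (?g j k) y * ?g j l y))"
  proof -
    have "(\<Sum>k\<in>UNIV. \<Sum>b\<in>UNIV. \<Sum>j<p. B y $ k $ b * (partial b (?g j k) y * ?g j l y))
      = (\<Sum>k\<in>UNIV. \<Sum>j<p. \<Sum>b\<in>UNIV. B y $ k $ b * (partial b (?g j k) y * ?g j l y))"
      by (intro sum.cong refl sum.swap)
    also have "\<dots> = (\<Sum>j<p. \<Sum>k\<in>UNIV. \<Sum>b\<in>UNIV. B y $ k $ b * (partial b (?g j k) y * ?g j l y))"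
      by (rule sum.swap)
    finally show ?thesis .
  qed
  also have "\<dots> = (\<Sum>j<p. (\<Sum>k\<in>UNIV. \<Sum>i\<in>UNIV. partial k (partial i (\<rho> j)) (f y) * P k i y) * grad (\<rho> j) (f y) $ l)"
  proof (intro sum.cong refl)
    fix j assume j: "j \<in> {..<p}"
    have "(\<Sum>b\<in>UNIV. B y $ k $ b * partial b (?g j k) y) = (\<Sum>i\<in>UNIV. partial i (partial k (\<rho> j)) (f y) * P k i y)" for k
    proof -
      have "(\<Sum>b\<in>UNIV. B y $ k $ b * partial b (?g j k) y) = (\<Sum>b\<in>UNIV. \<Sum>i\<in>UNIV. partial i (partial k (\<rho> j)) (f y) * (B y $ k $ b * A y $ i $ b))"
        using chain j by (simp add: sum_distrib_left mult_ac)
      also have "\<dots> = (\<Sum>i\<in>UNIV. \<Sum>b\<in>UNIV. partial i (partial k (\<rho> j)) (f y) * (B y $ k $ b * A y $ i $ b))"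
        by (rule sum.swap)
      finally show ?thesis by (simp add: P_def sum_distrib_left)
    qed
    then have "(\<Sum>k\<in>UNIV. \<Sum>b\<in>UNIV. B y $ k $ b * partial b (?g j k) y)
       = (\<Sum>k\<in>UNIV. \<Sum>i\<in>UNIV. partial i (partial k (\<rho> j)) (f y) * P k i y)" by simp
    also have "\<dots> = (\<Sum>i\<in>UNIV. \<Sum>k\<in>UNIV. partial i (partial k (\<rho> j)) (f y) * P i k y)"
      by (subst sum.swap) (simp add: P_sym[OF y(1)])
    finally have "(\<Sum>k\<in>UNIV. \<Sum>b\<in>UNIV. B y $ k $ b * partial b (?g j k) y)
       = (\<Sum>k\<in>UNIV. \<Sum>i\<in>UNIV. partial k (partial i (\<rho> j)) (f y) * P k i y)" .
    then show "(\<Sum>k\<in>UNIV. \<Sum>b\<in>UNIV. B y $ k $ b * (partial b (?g j k) y * ?g j l y))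
       = (\<Sum>k\<in>UNIV. \<Sum>i\<in>UNIV. partial k (partial i (\<rho> j)) (f y) * P k i y) * grad (\<rho> j) (f y) $ l"
      unfolding mult.assoc[symmetric] sum_distrib_right[symmetric] by (simp add: grad_def)
  qed
  finally show ?thesis by simp
qed

end

text \<open>The right-hand side mentions no defining functions, so the value is the same whichever
  ones \<open>unit_defining\<close> picks. The given \<open>\<rho>\<close> is the witness that makes
  this choice succeed.\<close>

lemma mean_curvature_eq:
  fixes f :: "real^'m::finite \<Rightarrow> real^'n::{finite,linorder}"
  assumes "immersion f V" and fM: "f ` V \<subseteq> M" and y: "y \<in> V"
    and p: "CARD('m) \<le> CARD('n)" and ud: "unit_defining_at (CARD('n) - CARD('m)) M (f y) \<rho>"
  shows "mean_curvature CARD('m) M (f y) $ l = immersion.h f l y"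
proof -
  interpret immersion f V by fact
  define p where "p = CARD('n) - CARD('m)"
  have pmn: "p + CARD('m) = CARD('n)" using p by (simp add: p_def)
  define r where "r = unit_defining p M (f y)"
  have "unit_defining_at p M (f y) r"
    unfolding r_def unit_defining_def by (rule someI[of _ \<rho>]) (use ud in \<open>simp add: p_def\<close>)
  then obtain U where U: "f y \<in> U" "zero_set_of p M U r"
     and on: "\<forall>y\<in>M \<inter> U. \<forall>i<p. \<forall>j<p. grad (r i) y \<bullet> grad (r j) y = (if i = j then 1 else 0)"
    unfolding unit_defining_at_grad by blast
  have yU: "f y \<in> M \<inter> U" using U y fM by auto
  have P: "P k l y = (if k = l then 1 else 0) - (\<Sum>j<p. grad (r j) (f y) $ k * grad (r j) (f y) $ l)" for k l
    by (rule P_grad[OF fM U(2) y U(1) on pmn])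
  have "trace_on {v. \<forall>j<p. grad (r j) (f y) \<bullet> v = 0} (sd (\<lambda>z. Jop (conormal (r j) z)) (f y))
     = (\<Sum>k\<in>UNIV. \<Sum>i\<in>UNIV. partial k (partial i (r j)) (f y) * P k i y)" for j
    unfolding P sd_Jop_conormal[symmetric] by (rule trace_on_eq[OF _ refl]) (use on yU in blast)
  then show ?thesis
    unfolding h_grad[OF fM U(2) y U(1) on pmn]
    by (simp add: mean_curvature_def Let_def p_def[symmetric] r_def[symmetric] dual_vector_conormal sum_component)
qed

section \<open>Surface measure\<close>

text \<open>The change of variables theorem of the library requires a well-ordered index type for the
  coordinates; \<open>wo\<close> is a copy of the index type carrying such an order.\<close>

typedef 'a wo = "UNIV :: 'a set" morphisms of_wo to_wo by simp

lemma bij_of_wo: "bij of_wo"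
  by (rule bij_betw_byWitness[where f'=to_wo]) (auto simp: of_wo_inverse to_wo_inverse)

instance wo :: (finite) finite
proof
  show "finite (UNIV :: 'a wo set)"
    using bij_betw_finite[OF bij_of_wo[where 'a='a]] by simp
qed

definition wo_index :: "'a::finite \<Rightarrow> nat" where
  "wo_index = (SOME f. inj f)"

lemma inj_wo_index: "inj wo_index"
proof -
  obtain f :: "'a \<Rightarrow> nat" where "inj f"
    using finite_imp_inj_to_nat_seg[OF finite[of "UNIV :: 'a set"]] by auto
  then show ?thesis unfolding wo_index_def by (rule someI[of inj])
qed

instantiation wo :: (finite) wellorder
begin

definition less_eq_wo :: "'a wo \<Rightarrow> 'a wo \<Rightarrow> bool" where
  "less_eq_wo x y \<longleftrightarrow> wo_index (of_wo x) \<le> wo_index (of_wo y)"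
definition less_wo :: "'a wo \<Rightarrow> 'a wo \<Rightarrow> bool" where
  "less_wo x y \<longleftrightarrow> wo_index (of_wo x) < wo_index (of_wo y)"

instance
proof
  fix x y :: "'a wo"
  show "x \<le> y \<Longrightarrow> y \<le> x \<Longrightarrow> x = y"
    unfolding less_eq_wo_def using injD[OF inj_wo_index, of "of_wo x" "of_wo y"] by (simp add: of_wo_inject)
next
  fix P :: "'a wo \<Rightarrow> bool" and a
  assume H: "\<And>x. (\<And>y. y < x \<Longrightarrow> P y) \<Longrightarrow> P x"
  show "P a"
  proof (induction "wo_index (of_wo a)" arbitrary: a rule: less_induct)
    case less
    show ?case by (rule H) (use less in \<open>simp add: less_wo_def\<close>)
  qed
qed (auto simp: less_eq_wo_def less_wo_def)

end

definition vwo :: "real^'m::finite \<Rightarrow> real^('m wo)" where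
  "vwo x = (\<chi> i. x $ of_wo i)"
definition unvwo :: "real^('m wo) \<Rightarrow> real^'m::finite" where
  "unvwo x = (\<chi> i. x $ to_wo i)"

lemma vwo_inverse [simp]: "unvwo (vwo x) = x" "vwo (unvwo z) = z"
  by (simp_all add: vwo_def unvwo_def vec_eq_iff to_wo_inverse of_wo_inverse)

lemma bounded_linear_vwo: "bounded_linear vwo" "bounded_linear unvwo"
  unfolding linear_conv_bounded_linear[symmetric]
  by (auto intro!: linearI simp: vwo_def unvwo_def vec_eq_iff)

text \<open>Renaming the indices conjugates permutations by a bijection, which preserves their
  sign.\<close>

lemma det_vwo:
  fixes A :: "real^'m^'m::finite"
  shows "det (\<chi> i j. A $ of_wo i $ of_wo j) = det A"
proof -
  have bij: "bij_betw (to_wo :: 'm \<Rightarrow> 'm wo) UNIV UNIV"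
    by (rule bij_betw_byWitness[where f'=of_wo]) (auto simp: of_wo_inverse to_wo_inverse)
  have sgn: "sign (of_wo \<circ> p \<circ> (to_wo :: 'm \<Rightarrow> 'm wo)) = sign p" if "p permutes UNIV" for p
  proof -
    have "inj (of_wo :: 'm wo \<Rightarrow> 'm)" "surj (of_wo :: 'm wo \<Rightarrow> 'm)" using bij_of_wo by (auto simp: bij_def)
    moreover have "inv (of_wo :: 'm wo \<Rightarrow> 'm) = to_wo"
      by (rule inv_equality) (simp_all add: of_wo_inverse to_wo_inverse)
    ultimately have "map_permutation UNIV of_wo p = of_wo \<circ> p \<circ> (to_wo :: 'm \<Rightarrow> 'm wo)"
      by (simp add: map_permutation_def fun_eq_iff restrict_id_def)
    then show ?thesis using sign_map_permutation[of of_wo UNIV p] that \<open>inj of_wo\<close> by simp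
  qed
  have "det A = (\<Sum>p\<in>{p. p permutes (UNIV :: 'm wo set)}. of_int (sign p) * (\<Prod>i\<in>UNIV. A $ of_wo i $ of_wo (p i)))"
    unfolding det_def
  proof (rule sum.reindex_bij_witness[of _ "\<lambda>p. of_wo \<circ> p \<circ> to_wo" "\<lambda>q. to_wo \<circ> q \<circ> of_wo"])
    fix q :: "'m \<Rightarrow> 'm" assume q: "q \<in> {p. p permutes UNIV}"
    show "of_wo \<circ> (to_wo \<circ> q \<circ> of_wo) \<circ> to_wo = q" by (simp add: fun_eq_iff to_wo_inverse)
    have bq: "bij q" using q by (simp add: permutes_bij)
    have b: "bij (to_wo \<circ> q \<circ> of_wo)"
      using bij bij_of_wo bq by (metis bij_comp)
    then show mem: "to_wo \<circ> q \<circ> of_wo \<in> {p. p permutes UNIV}" by (auto intro: bij_imp_permutes)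
    have "of_wo \<circ> (to_wo \<circ> q \<circ> of_wo) \<circ> to_wo = q" by (simp add: fun_eq_iff to_wo_inverse)
    then have "sign (to_wo \<circ> q \<circ> of_wo) = sign q" using sgn mem by (metis mem_Collect_eq)
    moreover have "(\<Prod>i\<in>UNIV. A $ of_wo i $ of_wo ((to_wo \<circ> q \<circ> of_wo) i)) = (\<Prod>i\<in>UNIV. A $ i $ q i)"
      using prod.reindex_bij_betw[OF bij_of_wo, of "\<lambda>i. A $ i $ q i"] by (simp add: to_wo_inverse)
    ultimately show "of_int (sign (to_wo \<circ> q \<circ> of_wo)) * (\<Prod>i\<in>UNIV. A $ of_wo i $ of_wo ((to_wo \<circ> q \<circ> of_wo) i))
       = of_int (sign q) * (\<Prod>i\<in>UNIV. A $ i $ q i)" by simp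
  next
    fix p :: "'m wo \<Rightarrow> 'm wo" assume p: "p \<in> {p. p permutes UNIV}"
    show "to_wo \<circ> (of_wo \<circ> p \<circ> to_wo) \<circ> of_wo = p" by (simp add: fun_eq_iff of_wo_inverse)
    have "bij (of_wo \<circ> p \<circ> to_wo)"
      using bij bij_of_wo p by (metis bij_comp mem_Collect_eq permutes_bij)
    then show "of_wo \<circ> p \<circ> to_wo \<in> {p. p permutes UNIV}" by (auto intro: bij_imp_permutes)
  qed
  then show ?thesis by (simp add: det_def)
qed

lemma lborel_vwo: "distr lborel borel (vwo :: real^'m::finite \<Rightarrow> _) = lborel"
proof (rule lborel_eqI[symmetric])
  show "sets (distr lborel borel vwo) = sets borel" by simp
  fix l u :: "real^('m wo)" assume lu: "\<And>b. b \<in> Basis \<Longrightarrow> l \<bullet> b \<le> u \<bullet> b"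
  then have le: "l $ i \<le> u $ i" for i using lu[of "axis i 1"] by (simp add: inner_axis axis_in_Basis_iff)
  have m: "(vwo :: real^'m \<Rightarrow> _) \<in> borel_measurable borel"
    by (intro borel_measurable_continuous_onI linear_continuous_on bounded_linear_vwo)
  have pre: "vwo -` box l u = box (unvwo l) (unvwo u)"
    by (auto simp: mem_box_cart vwo_def unvwo_def) (metis of_wo_inverse to_wo_inverse UNIV_I)+
  have basis: "(\<Prod>b\<in>Basis. x \<bullet> b) = (\<Prod>i\<in>UNIV. x $ i)" for x :: "real^'k"
  proof -
    have B: "Basis = range (\<lambda>i. axis i (1::real) :: real^'k)" by (auto simp: Basis_vec_def)
    have I: "inj (\<lambda>i. axis i (1::real) :: real^'k)" by (auto simp: inj_on_def axis_eq_axis)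
    show ?thesis unfolding B prod.reindex[OF I] by (simp add: inner_axis)
  qed
  have "emeasure (distr lborel borel vwo) (box l u) = emeasure lborel (box (unvwo l) (unvwo u))"
    by (subst emeasure_distr) (use m pre in auto)
  also have "\<dots> = (\<Prod>b\<in>Basis. (unvwo u - unvwo l) \<bullet> b)"
  proof (rule emeasure_lborel_box)
    fix b :: "real^'m" assume "b \<in> Basis"
    then obtain i where "b = axis i 1" by (auto simp: Basis_vec_def)
    then show "unvwo l \<bullet> b \<le> unvwo u \<bullet> b" using le by (simp add: inner_axis unvwo_def)
  qed
  also have "(\<Prod>b\<in>Basis. (unvwo u - unvwo l) \<bullet> b) = (\<Prod>b\<in>Basis. (u - l) \<bullet> b)"
    unfolding basis using prod.reindex_bij_betw[OF bij_of_wo, of "\<lambda>i. (unvwo u - unvwo l) $ i"]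
    by (simp add: unvwo_def of_wo_inverse)
  finally show "emeasure (distr lborel borel vwo) (box l u) = (\<Prod>b\<in>Basis. (u - l) \<bullet> b)" .
qed

lemma nn_integral_vwo:
  fixes g :: "real^('m::finite wo) \<Rightarrow> ennreal"
  assumes "g \<in> borel_measurable borel"
  shows "(\<integral>\<^sup>+ x. g (vwo x) \<partial>lborel) = (\<integral>\<^sup>+ z. g z \<partial>lborel)"
proof -
  have m: "(vwo :: real^'m \<Rightarrow> _) \<in> borel_measurable borel"
    by (intro borel_measurable_continuous_onI linear_continuous_on bounded_linear_vwo)
  have "(\<integral>\<^sup>+ z. g z \<partial>distr lborel borel vwo) = (\<integral>\<^sup>+ x. g (vwo x) \<partial>lborel)"
    by (rule nn_integral_distr) (use m assms in auto)
  then show ?thesis by (simp add: lborel_vwo)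
qed

text \<open>The vector-valued theorem says that one side has a given finite integral if and only if
  the other has it. Finite values therefore agree, and if one side is infinite so is the
  other.\<close>

lemma nn_integral_change_of_variables_wellorder:
  fixes \<tau> :: "real^'m::{finite,wellorder} \<Rightarrow> real^'m::{finite,wellorder}" and h :: "real^'m::{finite,wellorder} \<Rightarrow> real"
  assumes S: "S \<in> sets borel"
    and der: "\<And>x. x \<in> S \<Longrightarrow> (\<tau> has_derivative \<tau>' x) (at x)" and inj: "inj_on \<tau> S"
    and h: "h \<in> borel_measurable borel" "\<And>z. 0 \<le> h z" and im: "\<tau> ` S \<in> sets borel"
    and meas: "(\<lambda>x. indicator S x * (\<bar>det (matrix (\<tau>' x))\<bar> * h (\<tau> x))) \<in> borel_measurable borel"
  shows "(\<integral>\<^sup>+ x. ennreal (indicator S x * (\<bar>det (matrix (\<tau>' x))\<bar> * h (\<tau> x))) \<partial>lborel)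
     = (\<integral>\<^sup>+ z. ennreal (indicator (\<tau> ` S) z * h z) \<partial>lborel)"
proof -
  have SL: "S \<in> sets lebesgue" using S by simp
  have der': "(\<tau> has_derivative \<tau>' x) (at x within S)" if "x \<in> S" for x
    using der[OF that] has_derivative_at_withinI by blast
  let ?F = "\<lambda>x. \<bar>det (matrix (\<tau>' x))\<bar> * h (\<tau> x)"
  \<comment> \<open>Real functions are embedded in \<open>real^1\<close> to match the vector-valued
    theorem.\<close>
  let ?v = "\<lambda>c. c *\<^sub>R (axis 1 1 :: real^1)"
  have ai: "(\<lambda>x. ?v (g x)) absolutely_integrable_on T \<and> integral T (\<lambda>x. ?v (g x)) = ?v b \<longleftrightarrow> (g has_integral b) T"
    if "\<And>x. x \<in> T \<Longrightarrow> 0 \<le> g x" for g :: "real^'m::{finite,wellorder} \<Rightarrow> real" and T b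
  proof
    assume L: "(\<lambda>x. ?v (g x)) absolutely_integrable_on T \<and> integral T (\<lambda>x. ?v (g x)) = ?v b"
    then have "((\<lambda>x. ?v (g x)) has_integral ?v b) T"
      using absolutely_integrable_on_def has_integral_iff by blast
    from has_integral_linear[OF this bounded_linear_vec_nth[of 1]]
    show "(g has_integral b) T" by (simp add: o_def axis_def)
  next
    assume R: "(g has_integral b) T"
    then have "g absolutely_integrable_on T"
      using that nonnegative_absolutely_integrable_1 by blast
    from absolutely_integrable_linear[OF this bounded_linear_scaleR_left[of "axis 1 1 :: real^1"]]
    have "(\<lambda>x. ?v (g x)) absolutely_integrable_on T" by (simp add: o_def)
    moreover have "((\<lambda>x. ?v (g x)) has_integral ?v b) T"
      using has_integral_linear[OF R bounded_linear_scaleR_left[of "axis 1 1 :: real^1"]] by (simp add: o_def)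
    ultimately show "(\<lambda>x. ?v (g x)) absolutely_integrable_on T \<and> integral T (\<lambda>x. ?v (g x)) = ?v b"
      by (simp add: integral_unique)
  qed
  have cov: "(?F has_integral b) S \<longleftrightarrow> (h has_integral b) (\<tau> ` S)" for b
    using has_absolute_integral_change_of_variables[OF SL der' inj, of "\<lambda>x. ?v (h x)" "?v b"]
      ai[of S ?F b] ai[of "\<tau> ` S" h b] h(2) by simp
  have fin: "(\<integral>\<^sup>+ z. ennreal (indicator T z * g z) \<partial>lborel) = ennreal b"
    if "(g has_integral b) T" "\<And>x. 0 \<le> g x" for g :: "real^'m::{finite,wellorder} \<Rightarrow> real" and T b
    using nn_integral_has_integral_lebesgue[OF _ that(1)] that(2) by simp
  have conv: "\<exists>b. (g has_integral b) T"
    if "(\<lambda>z. indicator T z * g z) \<in> borel_measurable borel" "\<And>x. 0 \<le> g x" "(\<integral>\<^sup>+ z. ennreal (indicator T z * g z) \<partial>lborel) < \<infinity>"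
    for g :: "real^'m::{finite,wellorder} \<Rightarrow> real" and T
  proof -
    have "(\<lambda>z. indicator T z * g z) integrable_on UNIV"
      by (rule nn_integral_integrable_on) (use that in auto)
    moreover have "(\<lambda>z. indicator T z * g z) = (\<lambda>z. if z \<in> T then g z else 0)" by (auto simp: indicator_def)
    ultimately show ?thesis using integrable_restrict_UNIV[of T g] by (simp add: integrable_on_def)
  qed
  have F0: "0 \<le> ?F x" for x using h(2) by simp
  have hm: "(\<lambda>z. indicator (\<tau> ` S) z * h z) \<in> borel_measurable borel"
    using h(1) im by simp
  show ?thesis
  proof (cases "(\<integral>\<^sup>+ z. ennreal (indicator (\<tau> ` S) z * h z) \<partial>lborel) < \<infinity>")
    case True
    then obtain b where b: "(h has_integral b) (\<tau> ` S)" using conv[OF hm h(2)] by blast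
    show ?thesis using fin[OF b h(2)] fin[of ?F b S] cov[of b] b F0 by simp
  next
    case False
    have "\<not> (\<integral>\<^sup>+ x. ennreal (indicator S x * ?F x) \<partial>lborel) < \<infinity>"
    proof
      assume "(\<integral>\<^sup>+ x. ennreal (indicator S x * ?F x) \<partial>lborel) < \<infinity>"
      then obtain b where "(?F has_integral b) S" using conv[OF meas F0] by blast
      then show False using False fin[of h b "\<tau> ` S"] cov[of b] h(2) by simp
    qed
    then show ?thesis using False by (simp add: less_top[symmetric])
  qed
qed

text \<open>Transport along the relabelling \<open>vwo\<close>, which preserves Lebesgue measure and
  determinants.\<close>

theorem nn_integral_change_of_variables:
  fixes \<tau> :: "real^'m::finite \<Rightarrow> real^'m" and h :: "real^'m \<Rightarrow> real"
  assumes S: "S \<in> sets borel"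
    and der: "\<And>x. x \<in> S \<Longrightarrow> (\<tau> has_derivative \<tau>' x) (at x)" and inj: "inj_on \<tau> S"
    and h: "h \<in> borel_measurable borel" "\<And>z. 0 \<le> h z" and im: "\<tau> ` S \<in> sets borel"
    and meas: "(\<lambda>x. indicator S x * (\<bar>det (matrix (\<tau>' x))\<bar> * h (\<tau> x))) \<in> borel_measurable borel"
  shows "(\<integral>\<^sup>+ x. ennreal (indicator S x * (\<bar>det (matrix (\<tau>' x))\<bar> * h (\<tau> x))) \<partial>lborel)
     = (\<integral>\<^sup>+ z. ennreal (indicator (\<tau> ` S) z * h z) \<partial>lborel)"
proof -
  define t where "t = vwo \<circ> \<tau> \<circ> unvwo"
  define t' where "t' x = vwo \<circ> \<tau>' (unvwo x) \<circ> unvwo" for x :: "real^('m wo)"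
  define S' where "S' = vwo ` S"
  have S'eq: "S' = unvwo -` S"
    unfolding S'_def by (auto simp: image_iff) (metis vwo_inverse(2))
  have inS: "vwo x \<in> S' \<longleftrightarrow> x \<in> S" for x by (simp add: S'eq)
  have mu: "(unvwo :: _ \<Rightarrow> real^'m) \<in> borel_measurable borel" and mv: "(vwo :: real^'m \<Rightarrow> _) \<in> borel_measurable borel"
    by (intro borel_measurable_continuous_onI linear_continuous_on bounded_linear_vwo)+
  have bs: "S' \<in> sets borel" using measurable_sets[OF mu S] by (simp add: S'eq)
  have tim: "t ` S' = unvwo -` (\<tau> ` S)"
    unfolding t_def S'_def by (auto simp: image_iff) (metis vwo_inverse(2))
  have bt: "t ` S' \<in> sets borel" using measurable_sets[OF mu im] by (simp add: tim)
  have intS: "vwo z \<in> t ` S' \<longleftrightarrow> z \<in> \<tau> ` S" for z by (simp add: tim)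
  have dt: "(t has_derivative t' x) (at x)" if "x \<in> S'" for x
  proof -
    have "unvwo x \<in> S" using that by (simp add: S'eq)
    from has_derivative_compose[OF bounded_linear_imp_has_derivative[OF bounded_linear_vwo(2)] der[OF this]]
    have "((\<lambda>x. \<tau> (unvwo x)) has_derivative (\<lambda>v. \<tau>' (unvwo x) (unvwo v))) (at x)" .
    from bounded_linear.has_derivative[OF bounded_linear_vwo(1) this]
    show ?thesis by (simp add: t_def t'_def o_def)
  qed
  have it: "inj_on t S'"
  proof (rule inj_onI)
    fix x y assume "x \<in> S'" "y \<in> S'" "t x = t y"
    then have "\<tau> (unvwo x) = \<tau> (unvwo y)" unfolding t_def comp_def by (metis vwo_inverse(1))
    then have "unvwo x = unvwo y" using inj \<open>x \<in> S'\<close> \<open>y \<in> S'\<close> by (auto simp: S'eq inj_on_def)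
    then show "x = y" by (metis vwo_inverse(2))
  qed
  have dett: "det (matrix (t' x)) = det (matrix (\<tau>' (unvwo x)))" for x
  proof -
    have ax: "unvwo (axis j 1) = axis (of_wo j) 1" for j :: "'m wo"
      by (auto simp: unvwo_def vec_eq_iff axis_def to_wo_inverse of_wo_inverse)
    have "matrix (t' x) $ i $ j = matrix (\<tau>' (unvwo x)) $ of_wo i $ of_wo j" for i j
      by (simp add: matrix_def t'_def vwo_def ax)
    then have "matrix (t' x) = (\<chi> i j. matrix (\<tau>' (unvwo x)) $ of_wo i $ of_wo j)"
      by (simp add: vec_eq_iff)
    then show ?thesis by (simp add: det_vwo)
  qed
  let ?F = "\<lambda>x. indicator S x * (\<bar>det (matrix (\<tau>' x))\<bar> * h (\<tau> x))"
  have F: "indicator S' x * (\<bar>det (matrix (t' x))\<bar> * (h \<circ> unvwo) (t x)) = ?F (unvwo x)" for x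
    by (simp add: dett t_def S'eq indicator_def)
  have mF: "(\<lambda>x. indicator S' x * (\<bar>det (matrix (t' x))\<bar> * (h \<circ> unvwo) (t x))) \<in> borel_measurable borel"
    unfolding F by (rule measurable_compose[OF mu meas])
  have mh: "h \<circ> unvwo \<in> borel_measurable borel" using measurable_comp[OF mu h(1)] .
  have "(\<integral>\<^sup>+ x. ennreal (?F x) \<partial>lborel) = (\<integral>\<^sup>+ x. ennreal (indicator S' (vwo x) * (\<bar>det (matrix (t' (vwo x)))\<bar> * (h \<circ> unvwo) (t (vwo x)))) \<partial>lborel)"
    unfolding F by simp
  also have "\<dots> = (\<integral>\<^sup>+ x. ennreal (indicator S' x * (\<bar>det (matrix (t' x))\<bar> * (h \<circ> unvwo) (t x))) \<partial>lborel)"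
    by (rule nn_integral_vwo) (use mF in simp)
  also have "\<dots> = (\<integral>\<^sup>+ z. ennreal (indicator (t ` S') z * (h \<circ> unvwo) z) \<partial>lborel)"
    by (rule nn_integral_change_of_variables_wellorder[OF bs dt it mh _ bt mF]) (use h(2) in auto)
  also have "\<dots> = (\<integral>\<^sup>+ z. ennreal (indicator (t ` S') (vwo z) * (h \<circ> unvwo) (vwo z)) \<partial>lborel)"
  proof (rule nn_integral_vwo[symmetric])
    have "(\<lambda>z. indicator (t ` S') z * (h \<circ> unvwo) z) \<in> borel_measurable borel"
      by (rule borel_measurable_times[OF borel_measurable_indicator[OF bt] mh])
    then show "(\<lambda>z. ennreal (indicator (t ` S') z * (h \<circ> unvwo) z)) \<in> borel_measurable borel"
      by (rule measurable_compose[OF _ measurable_ennreal])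
  qed
  also have "\<dots> = (\<integral>\<^sup>+ z. ennreal (indicator (\<tau> ` S) z * h z) \<partial>lborel)"
    by (simp add: indicator_def intS)
  finally show ?thesis .
qed

text \<open>Transition maps arise as lifts through a chart g and are at first only known to be
  continuous. Applying the left inverse L of g' to g (\<tau> z) = f z expresses the increment of
  \<tau> by that of f, with an error small relative to the increment of \<tau> itself, which is
  absorbed.\<close>

lemma has_derivative_lift:
  fixes g :: "'b::real_normed_vector \<Rightarrow> 'c::real_normed_vector" and \<tau> :: "'a::real_normed_vector \<Rightarrow> 'b"
  assumes g: "(g has_derivative g') (at (\<tau> y))" and f: "(f has_derivative f') (at y)"
    and cont: "isCont \<tau> y" and L: "bounded_linear L" "\<And>x. L (g' x) = x"
    and S: "open S" "y \<in> S" "\<And>z. z \<in> S \<Longrightarrow> g (\<tau> z) = f z"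
  shows "(\<tau> has_derivative (\<lambda>x. L (f' x))) (at y)"
proof -
  have blf: "bounded_linear f'" using f by (rule has_derivative_bounded_linear)
  obtain C where C: "C > 0" "\<And>x. norm (L x) \<le> norm x * C"
    using bounded_linear.pos_bounded[OF L(1)] by blast
  obtain K where K: "K > 0" "\<And>x. norm (f' x) \<le> norm x * K"
    using bounded_linear.pos_bounded[OF blf] by blast
  have linL: "L (a + b) = L a + L b" "L (a - b) = L a - L b" for a b
    using L(1) by (simp_all add: linear_add linear_diff bounded_linear.linear)
  show ?thesis unfolding has_derivative_at_alt
  proof (intro conjI allI impI)
    show "bounded_linear (\<lambda>x. L (f' x))" by (rule bounded_linear_compose[OF L(1) blf])
    fix e :: real assume e: "e > 0"
    \<comment> \<open>With \<open>C * e1 \<le> 1 / 2\<close> the error in the increment k of \<tau>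
      is absorbed, giving |k| \<le> 2C(K+1)|h|. The second bound then limits its contribution to e/2
      |h|, and \<open>e2\<close> supplies the other half.\<close>
    define e1 where "e1 = min (1 / (2 * C)) (e / (4 * C * C * (K + 1)))"
    define e2 where "e2 = min 1 (e / (2 * C))"
    have e1: "e1 > 0" "C * e1 \<le> 1 / 2" "e1 \<le> e / (4 * C * C * (K + 1))"
    proof -
      show "e1 > 0" "e1 \<le> e / (4 * C * C * (K + 1))" using C K e by (auto simp: e1_def)
      have "C * e1 \<le> C * (1 / (2 * C))" using C by (intro mult_left_mono) (auto simp: e1_def)
      then show "C * e1 \<le> 1 / 2" using C by simp
    qed
    have e2: "e2 > 0" "e2 \<le> 1" "e2 \<le> e / (2 * C)" using C e by (auto simp: e2_def)
    obtain d1 where d1: "d1 > 0" "\<And>w. norm (w - \<tau> y) < d1 \<Longrightarrow> norm (g w - g (\<tau> y) - g' (w - \<tau> y)) \<le> e1 * norm (w - \<tau> y)"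
      using g e1(1) unfolding has_derivative_at_alt by meson
    obtain d2 where d2: "d2 > 0" "\<And>z. norm (z - y) < d2 \<Longrightarrow> norm (f z - f y - f' (z - y)) \<le> e2 * norm (z - y)"
      using f e2(1) unfolding has_derivative_at_alt by meson
    obtain d3 where d3: "d3 > 0" "\<And>z. dist z y < d3 \<Longrightarrow> dist (\<tau> z) (\<tau> y) < d1"
      using cont d1(1) unfolding continuous_at_eps_delta by meson
    obtain d4 where d4: "d4 > 0" "ball y d4 \<subseteq> S" using S openE by blast
    show "\<exists>d>0. \<forall>z. norm (z - y) < d \<longrightarrow> norm (\<tau> z - \<tau> y - L (f' (z - y))) \<le> e * norm (z - y)"
    proof (intro exI conjI allI impI)
      show "min d2 (min d3 d4) > 0" using d2 d3 d4 by simp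
      fix z assume z: "norm (z - y) < min d2 (min d3 d4)"
      define k where "k = \<tau> z - \<tau> y"
      define h where "h = z - y"
      have "norm k < d1" using d3(2)[of z] z by (simp add: dist_norm k_def)
      then have r1: "norm (g (\<tau> z) - g (\<tau> y) - g' k) \<le> e1 * norm k" using d1(2)[of "\<tau> z"] by (simp add: k_def)
      have r2: "norm (f z - f y - f' h) \<le> e2 * norm h" using d2(2)[of z] z by (simp add: h_def)
      have zS: "z \<in> S" using d4(2) z by (auto simp: dist_norm norm_minus_commute subset_eq)
      define r where "r = (f z - f y - f' h) - (g (\<tau> z) - g (\<tau> y) - g' k)"
      have "g' k - f' h = r" unfolding r_def using S(3)[OF zS] S(3)[OF S(2)] by simp
      then have kL: "k - L (f' h) = L r" using linL(2)[of "g' k" "f' h"] L(2) by simp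
      have nr: "norm r \<le> e2 * norm h + e1 * norm k"
        unfolding r_def using norm_triangle_ineq4[of "f z - f y - f' h" "g (\<tau> z) - g (\<tau> y) - g' k"] r1 r2 by linarith
      have Lr: "norm (L r) \<le> C * (e2 * norm h) + C * e1 * norm k"
      proof -
        have "norm (L r) \<le> norm r * C" by (rule C(2))
        also have "\<dots> \<le> (e2 * norm h + e1 * norm k) * C" using nr C(1) by (intro mult_right_mono) auto
        finally show ?thesis by (simp add: algebra_simps)
      qed
      have "norm (L (f' h)) \<le> C * (K * norm h)"
      proof -
        have "norm (L (f' h)) \<le> norm (f' h) * C" by (rule C(2))
        also have "\<dots> \<le> (norm h * K) * C" using K(2) C(1) by (intro mult_right_mono) auto
        finally show ?thesis by (simp add: algebra_simps)
      qed
      moreover have "norm k \<le> norm (L (f' h)) + norm (L r)"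
        using kL norm_triangle_ineq[of "L (f' h)" "L r"] by (metis add.commute diff_add_cancel)
      moreover have "C * e1 * norm k \<le> 1 / 2 * norm k" using e1(2) by (intro mult_right_mono) auto
      moreover have "C * (e2 * norm h) \<le> C * norm h"
        using e2 C(1) by (intro mult_left_mono) (auto simp: mult_left_le_one_le)
      ultimately have "norm k \<le> C * (K * norm h) + C * norm h + 1 / 2 * norm k" using Lr by linarith
      then have k2: "norm k \<le> 2 * (C * (K + 1)) * norm h" by (simp add: algebra_simps)
      have "C * e1 * norm k \<le> C * e1 * (2 * (C * (K + 1)) * norm h)"
        using k2 e1 C by (intro mult_left_mono) auto
      also have "\<dots> = e1 * (2 * C * C * (K + 1)) * norm h" by (simp add: algebra_simps)
      also have "\<dots> \<le> (e / 2) * norm h"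
      proof (intro mult_right_mono)
        have "e1 * (2 * C * C * (K + 1)) \<le> (e / (4 * C * C * (K + 1))) * (2 * C * C * (K + 1))"
          using e1(3) C K by (intro mult_right_mono) auto
        also have "\<dots> = e / 2"
        proof -
          define Y where "Y = 2 * C * C * (K + 1)"
          have "Y > 0" unfolding Y_def using C K by simp
          moreover have "4 * C * C * (K + 1) = 2 * Y" by (simp add: Y_def)
          ultimately show ?thesis unfolding Y_def[symmetric] by simp
        qed
        finally show "e1 * (2 * C * C * (K + 1)) \<le> e / 2" .
      qed auto
      finally have a: "C * e1 * norm k \<le> (e / 2) * norm h" .
      have "C * (e2 * norm h) \<le> C * (e / (2 * C) * norm h)"
        using e2(3) C(1) by (intro mult_left_mono mult_right_mono) auto
      also have "\<dots> = (e / 2) * norm h" using C(1) by simp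
      finally have "norm (L r) \<le> e * norm h" using a Lr by (simp add: algebra_simps)
      then show "norm (\<tau> z - \<tau> y - L (f' (z - y))) \<le> e * norm (z - y)"
        using kL by (simp add: k_def h_def)
    qed
  qed
qed

section \<open>Chart integrals, their agreement on overlaps, and gluing\<close>

lemma local_parametrization_immersion: "local_parametrization M V f \<Longrightarrow> immersion f V"
  by (simp add: local_parametrization_def immersion_def)

definition chart_integral :: "(real^'m::finite \<Rightarrow> real^'n::finite) \<Rightarrow> (real^'m) set \<Rightarrow> (real^'n) set \<Rightarrow> ennreal" where
  "chart_integral f V A = (\<integral>\<^sup>+ y\<in>V. (ennreal (area_density f y) * indicator A (f y)) \<partial>lborel)"

lemma continuous_indicator_measurable:
  fixes g :: "'a::euclidean_space \<Rightarrow> 'b::euclidean_space"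
  assumes "open V" "continuous_on V g"
  shows "(\<lambda>y. indicator V y *\<^sub>R g y) \<in> borel_measurable borel"
  by (rule borel_measurable_continuous_on_indicator) (use assms in auto)

lemma preimage_borel:
  fixes g :: "'a::euclidean_space \<Rightarrow> 'b::euclidean_space"
  assumes "open V" "continuous_on V g" "A \<in> sets borel"
  shows "{y \<in> V. g y \<in> A} \<in> sets borel"
proof -
  have "{y \<in> V. g y \<in> A} = V \<inter> ((\<lambda>y. indicator V y *\<^sub>R g y) -` A \<inter> space borel)"
    by (auto simp: indicator_def)
  also have "\<dots> \<in> sets borel"
    using measurable_sets[OF continuous_indicator_measurable[OF assms(1,2)] assms(3)] assms(1) by auto
  finally show ?thesis .
qed

text \<open>Multiplying f by the indicator makes the map measurable on the whole space; the points
  outside V, which it sends to 0, carry density 0.\<close>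

definition chart_measure :: "(real^'m::finite \<Rightarrow> real^'n::finite) \<Rightarrow> (real^'m) set \<Rightarrow> (real^'n) measure" where
  "chart_measure f V = distr (density lborel (\<lambda>y. ennreal (indicator V y * area_density f y))) borel (\<lambda>y. indicator V y *\<^sub>R f y)"

context immersion
begin

lemma continuous_f: "continuous_on V f" by (rule smooth_on_continuous[OF smooth_f])

lemma density_measurable: "(\<lambda>y. indicator V y * s y) \<in> borel_measurable borel"
  using continuous_indicator_measurable[OF openV smooth_on_continuous[OF smooth_s]] by simp

lemma emeasure_chart_measure:
  assumes "D \<in> sets borel"
  shows "emeasure (chart_measure f V) D = chart_integral f V D"
proof -
  have m: "(\<lambda>y. indicator V y *\<^sub>R f y) \<in> borel_measurable borel"
    by (rule continuous_indicator_measurable[OF openV continuous_f])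
  have "emeasure (chart_measure f V) D
      = (\<integral>\<^sup>+ y. ennreal (indicator V y * s y) * indicator ((\<lambda>y. indicator V y *\<^sub>R f y) -` D) y \<partial>lborel)"
  proof -
    have pre: "(\<lambda>y. indicator V y *\<^sub>R f y) -` D \<in> sets lborel"
      using measurable_sets_borel[OF m assms] by simp
    have dm: "(\<lambda>y. ennreal (indicator V y * s y)) \<in> borel_measurable lborel"
      using density_measurable by simp
    have "emeasure (chart_measure f V) D = emeasure (density lborel (\<lambda>y. ennreal (indicator V y * s y))) ((\<lambda>y. indicator V y *\<^sub>R f y) -` D)"
      unfolding chart_measure_def by (subst emeasure_distr) (use m assms in auto)
    then show ?thesis by (simp only: emeasure_density[OF dm pre])
  qed
  also have "\<dots> = chart_integral f V D"
    unfolding chart_integral_def by (intro nn_integral_cong) (auto simp: indicator_def)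
  finally show ?thesis .
qed

lemma sets_chart_measure [simp]: "sets (chart_measure f V) = sets borel"
  by (simp add: chart_measure_def)

lemma integral_chart_measure:
  fixes \<phi> :: "real^'n \<Rightarrow> real"
  assumes "\<phi> \<in> borel_measurable borel"
  shows "(\<integral>x. \<phi> x \<partial>chart_measure f V) = (\<integral>y. indicator V y * (s y * \<phi> (f y)) \<partial>lborel)"
proof -
  have m: "(\<lambda>y. indicator V y *\<^sub>R f y) \<in> borel_measurable borel"
    by (rule continuous_indicator_measurable[OF openV continuous_f])
  have m2: "(\<lambda>y. \<phi> (indicator V y *\<^sub>R f y)) \<in> borel_measurable borel"
    using measurable_compose[OF m assms] .
  have pos: "0 \<le> indicator V y * s y" for y using s_pos[of y] by (cases "y \<in> V") auto
  have "(\<integral>x. \<phi> x \<partial>chart_measure f V)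
      = (\<integral>y. \<phi> (indicator V y *\<^sub>R f y) \<partial>density lborel (\<lambda>y. ennreal (indicator V y * area_density f y)))"
    unfolding chart_measure_def by (rule integral_distr) (use m assms in auto)
  also have "\<dots> = (\<integral>y. (indicator V y * s y) *\<^sub>R \<phi> (indicator V y *\<^sub>R f y) \<partial>lborel)"
    by (rule integral_density) (use m2 density_measurable pos in auto)
  also have "\<dots> = (\<integral>y. indicator V y * (s y * \<phi> (f y)) \<partial>lborel)"
    by (intro Bochner_Integration.integral_cong) (auto simp: indicator_def)
  finally show ?thesis .
qed

end

text \<open>The transition map satisfies g (\<tau> y) = f y, so the Gram determinant of f is the
  square of the Jacobian of \<tau> times that of g, and the change of variables formula
  applies.\<close>

lemma chart_integral_transition:
  fixes f g :: "real^'m::finite \<Rightarrow> real^'n::finite"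
  assumes lf: "local_parametrization M V f" and lg: "local_parametrization M W g"
    and D: "D \<in> sets borel" "D \<subseteq> f ` V \<inter> g ` W"
  shows "chart_integral f V D = chart_integral g W D"
proof -
  interpret F: immersion f V by (rule local_parametrization_immersion[OF lf])
  interpret Gi: immersion g W by (rule local_parametrization_immersion[OF lg])
  obtain g' where hg: "homeomorphism W (g ` W) g g'" using lg by (auto simp: local_parametrization_def)
  obtain f' where hf: "homeomorphism V (f ` V) f f'" using lf by (auto simp: local_parametrization_def)
  define \<tau> where "\<tau> = g' \<circ> f"
  define V0 where "V0 = {y \<in> V. f y \<in> g ` W}"
  obtain T where T: "open T" "g ` W = M \<inter> T"
    using lg by (auto simp: local_parametrization_def openin_open)
  obtain T' where T': "open T'" "f ` V = M \<inter> T'"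
    using lf by (auto simp: local_parametrization_def openin_open)
  have "V0 = {y \<in> V. f y \<in> T}" unfolding V0_def using T T' by auto
  then have oV0: "open V0" using open_preimage[OF F.openV F.continuous_f T(1)] by simp
  have g\<tau>: "\<tau> y \<in> W" "g (\<tau> y) = f y" if "y \<in> V0" for y
    using that hg unfolding V0_def \<tau>_def homeomorphism_def by auto
  have W0: "\<tau> ` V0 = {w \<in> W. g w \<in> f ` V}"
  proof (intro set_eqI iffI)
    fix w assume "w \<in> \<tau> ` V0"
    then show "w \<in> {w \<in> W. g w \<in> f ` V}"
      using g\<tau> by (auto simp: V0_def)
  next
    fix w assume "w \<in> {w \<in> W. g w \<in> f ` V}"
    then obtain y where y: "w \<in> W" "y \<in> V" "g w = f y" by auto
    have "f y \<in> g ` W" using y by (metis imageI)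
    moreover have "\<tau> y = w" using y homeomorphism_apply1[OF hg y(1)] by (simp add: \<tau>_def)
    ultimately have "y \<in> V0" "\<tau> y = w" using y by (simp_all add: V0_def)
    then show "w \<in> \<tau> ` V0" by blast
  qed
  have "{w \<in> W. g w \<in> f ` V} = {w \<in> W. g w \<in> T'}" using T T' by auto
  then have oW0: "open (\<tau> ` V0)" using open_preimage[OF Gi.openV Gi.continuous_f T'(1)] W0 by simp
  have cont\<tau>: "continuous_on V0 \<tau>"
    unfolding \<tau>_def
  proof (rule continuous_on_compose)
    show "continuous_on V0 f" by (rule continuous_on_subset[OF F.continuous_f]) (auto simp: V0_def)
    have "continuous_on (g ` W) g'" using hg by (simp add: homeomorphism_def)
    then show "continuous_on (f ` V0) g'" by (rule continuous_on_subset) (auto simp: V0_def)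
  qed
  have inj\<tau>: "inj_on \<tau> V0"
  proof (rule inj_onI)
    fix x y assume "x \<in> V0" "y \<in> V0" "\<tau> x = \<tau> y"
    then have "f x = f y" "x \<in> V" "y \<in> V" using g\<tau> by (metis, auto simp: V0_def)
    then show "x = y" using hf by (metis homeomorphism_apply1)
  qed
  \<comment> \<open>By \<open>A_B\<close> for g, this is a left inverse of the derivative of g at
    \<tau> y, as \<open>has_derivative_lift\<close> requires.\<close>
  define L where "L y = (*v) (transpose (Gi.B (\<tau> y)))" for y
  define t' where "t' y v = L y (frechet_derivative f (at y) v)" for y v
  have der: "(\<tau> has_derivative t' y) (at y)" if y: "y \<in> V0" for y
    unfolding t'_def
  proof (rule has_derivative_lift[where g=g and g'="frechet_derivative g (at (\<tau> y))" and f=f and S=V0])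
    show "(g has_derivative frechet_derivative g (at (\<tau> y))) (at (\<tau> y))" by (rule Gi.derf[OF g\<tau>(1)[OF y]])
    show "(f has_derivative frechet_derivative f (at y)) (at y)" using F.derf y by (simp add: V0_def)
    show "open V0" "y \<in> V0" by (rule oV0 y)+
    show "isCont \<tau> y" using cont\<tau> oV0 y by (simp add: continuous_on_eq_continuous_at)
    show "bounded_linear (L y)" unfolding L_def by simp
    show "g (\<tau> z) = f z" if "z \<in> V0" for z using g\<tau>(2)[OF that] .
    have "transpose (Gi.B (\<tau> y)) ** Gi.A (\<tau> y) = mat 1"
      using Gi.A_B[OF g\<tau>(1)[OF y]] by (simp add: matrix_matrix_mult_def transpose_def mat_def vec_eq_iff mult.commute)
    then show "L y (frechet_derivative g (at (\<tau> y)) v) = v" for v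
      unfolding L_def by (simp add: Gi.A_apply[OF g\<tau>(1)[OF y], symmetric] matrix_vector_mul_assoc)
  qed
  have dens: "area_density f y = \<bar>det (matrix (t' y))\<bar> * area_density g (\<tau> y)" if y: "y \<in> V0" for y
  proof -
    have yV: "y \<in> V" using y by (simp add: V0_def)
    have dc: "((\<lambda>z. g (\<tau> z)) has_derivative (\<lambda>v. frechet_derivative g (at (\<tau> y)) (t' y v))) (at y)"
      by (rule has_derivative_compose[OF der[OF y] Gi.derf[OF g\<tau>(1)[OF y]]])
    have "(f has_derivative (\<lambda>v. frechet_derivative g (at (\<tau> y)) (t' y v))) (at y)"
      by (rule has_derivative_transform_within_open[OF dc oV0 y]) (rule g\<tau>(2))
    then have fd: "frechet_derivative f (at y) = (\<lambda>v. frechet_derivative g (at (\<tau> y)) (t' y v))"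
      by (rule frechet_derivative_eqI)
    have lt: "linear (t' y)" using has_derivative_linear[OF der[OF y]] .
    have "F.A y = Gi.A (\<tau> y) ** matrix (t' y)"
    proof -
      have "F.A y *v v = (Gi.A (\<tau> y) ** matrix (t' y)) *v v" for v
        unfolding F.A_apply[OF yV] fd matrix_vector_mul_assoc[symmetric]
        using matrix_vector_mul(2)[OF lt] Gi.A_apply[OF g\<tau>(1)[OF y]] by (metis)
      then show ?thesis by (simp add: matrix_eq)
    qed
    then have "F.G y = transpose (matrix (t' y)) ** Gi.G (\<tau> y) ** matrix (t' y)"
      by (simp add: F.G_def Gi.G_def matrix_transpose_mul matrix_mul_assoc)
    then have "det (F.G y) = (det (matrix (t' y)))\<^sup>2 * det (Gi.G (\<tau> y))"
      by (simp add: det_mul power2_eq_square)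
    then show ?thesis by (simp add: F.s_def Gi.s_def real_sqrt_mult)
  qed
  define h where "h w = indicator W w * area_density g w * indicator D (g w)" for w
  have h0: "0 \<le> h w" for w using Gi.s_pos[of w] by (auto simp: h_def indicator_def)
  have hm: "h \<in> borel_measurable borel"
  proof -
    have "h = (\<lambda>w. (indicator W w * area_density g w) * indicator {w \<in> W. g w \<in> D} w)"
      by (auto simp: h_def indicator_def)
    also have "\<dots> \<in> borel_measurable borel"
      by (intro borel_measurable_times Gi.density_measurable borel_measurable_indicator preimage_borel Gi.openV Gi.continuous_f D(1))
    finally show ?thesis .
  qed
  have inD: "y \<in> V0" if "y \<in> V" "f y \<in> D" for y using that D(2) by (auto simp: V0_def)
  have Feq: "indicator V0 y * (\<bar>det (matrix (t' y))\<bar> * h (\<tau> y)) = (indicator V y * area_density f y) * indicator {y \<in> V. f y \<in> D} y" for y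
  proof (cases "y \<in> V0")
    case True
    then have "y \<in> V" by (simp add: V0_def)
    then show ?thesis using True dens[OF True] g\<tau>[OF True] by (simp add: h_def indicator_def)
  next
    case False
    then show ?thesis using inD by (auto simp: indicator_def)
  qed
  have meas: "(\<lambda>y. indicator V0 y * (\<bar>det (matrix (t' y))\<bar> * h (\<tau> y))) \<in> borel_measurable borel"
    unfolding Feq
    by (intro borel_measurable_times F.density_measurable borel_measurable_indicator preimage_borel F.openV F.continuous_f D(1))
  have "chart_integral f V D = (\<integral>\<^sup>+ y. ennreal (indicator V0 y * (\<bar>det (matrix (t' y))\<bar> * h (\<tau> y))) \<partial>lborel)"
    unfolding Feq chart_integral_def by (intro nn_integral_cong) (auto simp: indicator_def)
  also have "\<dots> = (\<integral>\<^sup>+ w. ennreal (indicator (\<tau> ` V0) w * h w) \<partial>lborel)"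
    by (rule nn_integral_change_of_variables[OF _ der inj\<tau> hm h0 _ meas]) (use oV0 oW0 in auto)
  also have "\<dots> = chart_integral g W D"
    unfolding chart_integral_def
  proof (intro nn_integral_cong)
    fix w
    have "w \<in> \<tau> ` V0" if "w \<in> W" "g w \<in> D" using that D(2) unfolding W0 by auto
    then show "ennreal (indicator (\<tau> ` V0) w * h w) = ennreal (area_density g w) * indicator D (g w) * indicator W w"
      by (auto simp: h_def indicator_def)
  qed
  finally show ?thesis .
qed

lemma chart_family:
  fixes M :: "(real^'n::finite) set"
  assumes "\<And>x. x \<in> M \<Longrightarrow> \<exists>V (f :: real^'m::finite \<Rightarrow> real^'n). local_parametrization M V f \<and> x \<in> f ` V"
  obtains V :: "nat \<Rightarrow> (real^'m) set" and f :: "nat \<Rightarrow> real^'m \<Rightarrow> real^'n"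
  where "\<And>i. local_parametrization M (V i) (f i)" "(\<Union>i. f i ` V i) = M"
proof -
  define \<F> where "\<F> = {f ` V |V (f :: real^'m \<Rightarrow> real^'n). local_parametrization M V f}"
  have op: "openin (top_of_set M) U" if "U \<in> \<F>" for U
    using that by (auto simp: \<F>_def local_parametrization_def)
  obtain \<F>' where F': "\<F>' \<subseteq> \<F>" "countable \<F>'" "\<Union>\<F>' = \<Union>\<F>"
    by (rule Lindelof_openin[of \<F> M]) (use op in auto)
  have UM: "\<Union>\<F> = M"
  proof
    show "\<Union>\<F> \<subseteq> M" using op[THEN openin_imp_subset] by blast
    show "M \<subseteq> \<Union>\<F>"
    proof
      fix x assume "x \<in> M"
      then obtain V and f :: "real^'m \<Rightarrow> real^'n" where "local_parametrization M V f" "x \<in> f ` V"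
        using assms by blast
      moreover from this have "f ` V \<in> \<F>" unfolding \<F>_def by blast
      ultimately show "x \<in> \<Union>\<F>" by blast
    qed
  qed
  \<comment> \<open>The empty chart is added to the countable family so that it can be enumerated
    even if M is empty.\<close>
  have emp: "local_parametrization M {} (\<lambda>_. 0 :: real^'n)"
    by (auto simp: local_parametrization_def smooth_on_const homeomorphism_def)
  define \<F>2 where "\<F>2 = insert {} \<F>'"
  have e\<F>: "{} \<in> \<F>" unfolding \<F>_def using emp by force
  have F2: "countable \<F>2" "\<F>2 \<noteq> {}" "\<F>2 \<subseteq> \<F>" "\<Union>\<F>2 = M"
    using F' UM e\<F> by (auto simp: \<F>2_def)
  have ex: "\<exists>V (f :: real^'m \<Rightarrow> real^'n). local_parametrization M V f \<and> from_nat_into \<F>2 i = f ` V" for i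
  proof -
    have "from_nat_into \<F>2 i \<in> \<F>" using from_nat_into[OF F2(2), of i] F2(3) by blast
    then show "\<exists>V (f :: real^'m \<Rightarrow> real^'n). local_parametrization M V f \<and> from_nat_into \<F>2 i = f ` V"
      unfolding \<F>_def by blast
  qed
  define Q where "Q i p \<longleftrightarrow> local_parametrization M (fst p) (snd p) \<and> from_nat_into \<F>2 i = snd p ` fst p"
    for i and p :: "(real^'m) set \<times> (real^'m \<Rightarrow> real^'n)"
  define c where "c i = (SOME p. Q i p)" for i
  define V where "V i = fst (c i)" for i
  define f where "f i = snd (c i)" for i
  have f: "local_parametrization M (V i) (f i) \<and> from_nat_into \<F>2 i = f i ` V i" for i
  proof -
    have "\<exists>p. Q i p" using ex[of i] by (auto simp: Q_def)
    then have "Q i (c i)" unfolding c_def by (rule someI_ex)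
    then show ?thesis by (simp add: Q_def V_def f_def)
  qed
  have "from_nat_into \<F>2 i = f i ` V i" for i using f[of i] by (rule conjunct2)
  then have eq: "(\<lambda>i. f i ` V i) = from_nat_into \<F>2" by (intro ext) (rule sym)
  have "(\<Union>i. f i ` V i) = M"
    unfolding eq using range_from_nat_into[OF F2(2,1)] F2(4) by simp
  then show ?thesis by (rule that[OF conjunct1[OF f]])
qed

lemma local_parametrization_borel:
  assumes "local_parametrization M V f" "M \<in> sets borel"
  shows "f ` V \<in> sets borel"
  using assms by (auto simp: local_parametrization_def openin_open)

text \<open>Chart measures are glued along a disjoint sequence of Borel pieces D i, each inside one
  chart image. Agreement on overlaps makes the result correct in every chart, and the values on the
  pieces determine it.\<close>

lemma surface_measure_ex1:
  fixes M :: "(real^'n::finite) set"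
  assumes M: "M \<in> sets borel"
    and charts: "\<And>x. x \<in> M \<Longrightarrow> \<exists>V (f :: real^'m::finite \<Rightarrow> real^'n). local_parametrization M V f \<and> x \<in> f ` V"
  shows "\<exists>!\<mu>. is_surface_measure TYPE('m) M \<mu>"
proof -
  obtain V :: "nat \<Rightarrow> (real^'m) set" and f :: "nat \<Rightarrow> real^'m \<Rightarrow> real^'n"
    where lp: "\<And>i. local_parametrization M (V i) (f i)" and cover: "(\<Union>i. f i ` V i) = M"
    using chart_family[OF charts] by blast
  define D where "D = disjointed (\<lambda>i. f i ` V i)"
  have Db: "D i \<in> sets borel" for i
    using sets.range_disjointed_sets[of "\<lambda>i. f i ` V i" borel] local_parametrization_borel[OF lp M]
    unfolding D_def by auto
  have Dsub: "D i \<subseteq> f i ` V i" for i unfolding D_def by (rule disjointed_subset)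
  have Ddisj: "disjoint_family D" unfolding D_def by (rule disjoint_family_disjointed)
  have DU: "(\<Union>i. D i) = M" unfolding D_def UN_disjointed_eq cover ..
  define \<nu> where "\<nu> A = (\<Sum>i. chart_integral (f i) (V i) (A \<inter> D i))" for A
  define \<mu> where "\<mu> = measure_of UNIV (sets borel) \<nu>"
  have em_i: "chart_integral (f i) (V i) A = emeasure (chart_measure (f i) (V i)) A" if "A \<in> sets borel" for i A
    using immersion.emeasure_chart_measure[OF local_parametrization_immersion[OF lp] that] by simp
  have sets_i: "sets (chart_measure (f i) (V i)) = sets borel" for i
    by (simp add: chart_measure_def)
  have ca: "countably_additive (sets borel) \<nu>"
    unfolding countably_additive_def
  proof (intro allI impI)
    fix A :: "nat \<Rightarrow> (real^'n) set"
    assume A: "range A \<subseteq> sets borel" "disjoint_family A"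
    have Ab: "A k \<in> sets borel" for k using A by auto
    have "(\<Sum>k. \<nu> (A k)) = (\<Sum>k. \<integral>\<^sup>+ i. chart_integral (f i) (V i) (A k \<inter> D i) \<partial>count_space UNIV)"
      by (simp add: \<nu>_def nn_integral_count_space_nat)
    also have "\<dots> = (\<integral>\<^sup>+ i. (\<Sum>k. chart_integral (f i) (V i) (A k \<inter> D i)) \<partial>count_space UNIV)"
      by (rule nn_integral_suminf[symmetric]) auto
    also have "\<dots> = (\<integral>\<^sup>+ i. chart_integral (f i) (V i) ((\<Union>k. A k) \<inter> D i) \<partial>count_space UNIV)"
    proof (intro nn_integral_cong)
      fix i
      have "(\<Sum>k. emeasure (chart_measure (f i) (V i)) (A k \<inter> D i)) = emeasure (chart_measure (f i) (V i)) (\<Union>k. A k \<inter> D i)"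
        by (rule suminf_emeasure) (use A Db in \<open>auto simp: sets_i disjoint_family_on_def\<close>)
      moreover have "(\<Union>k. A k \<inter> D i) = (\<Union>k. A k) \<inter> D i" by auto
      moreover have "(\<Union>k. A k) \<inter> D i \<in> sets borel" using Ab Db by auto
      ultimately show "(\<Sum>k. chart_integral (f i) (V i) (A k \<inter> D i)) = chart_integral (f i) (V i) ((\<Union>k. A k) \<inter> D i)"
        using Ab Db by (simp add: em_i)
    qed
    also have "\<dots> = \<nu> (\<Union>k. A k)" by (simp add: \<nu>_def nn_integral_count_space_nat)
    finally show "(\<Sum>k. \<nu> (A k)) = \<nu> (\<Union>k. A k)" .
  qed
  have sets_\<mu>: "sets \<mu> = sets borel"
    unfolding \<mu>_def using sets.sigma_sets_eq[of "borel :: (real^'n) measure"] by (simp add: sets_measure_of)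
  have em: "emeasure \<mu> A = \<nu> A" if "A \<in> sets borel" for A
  proof (rule emeasure_measure_of[OF \<mu>_def])
    show "positive (sets \<mu>) \<nu>" by (simp add: positive_def \<nu>_def chart_integral_def)
    show "countably_additive (sets \<mu>) \<nu>" using ca sets_\<mu> by simp
    show "A \<in> sets \<mu>" using that sets_\<mu> by simp
  qed auto
  have sm: "is_surface_measure TYPE('m) M \<mu>"
    unfolding is_surface_measure_def
  proof (intro conjI allI impI ballI sets_\<mu>)
    have "- M \<inter> D i = {}" for i using DU by auto
    then have "\<nu> (- M) = 0" by (simp add: \<nu>_def chart_integral_def)
    moreover have "- M \<in> sets borel" using M by auto
    ultimately show "emeasure \<mu> (- M) = 0" using em by simp
    fix W and g :: "real^'m \<Rightarrow> real^'n" and A :: "(real^'n) set"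
    assume lg: "local_parametrization M W g" and A: "A \<in> sets borel"
    interpret g: immersion g W by (rule local_parametrization_immersion[OF lg])
    have gW: "g ` W \<in> sets borel" by (rule local_parametrization_borel[OF lg M])
    have gM: "g ` W \<subseteq> M" using lg openin_imp_subset unfolding local_parametrization_def by blast
    have "emeasure \<mu> (A \<inter> g ` W) = (\<Sum>i. chart_integral (f i) (V i) (A \<inter> g ` W \<inter> D i))"
      using A gW by (simp add: em \<nu>_def)
    also have "\<dots> = (\<Sum>i. chart_integral g W (A \<inter> g ` W \<inter> D i))"
    proof (intro suminf_cong)
      fix i
      show "chart_integral (f i) (V i) (A \<inter> g ` W \<inter> D i) = chart_integral g W (A \<inter> g ` W \<inter> D i)"
        by (rule chart_integral_transition[OF lp lg]) (use A gW Db Dsub in auto)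
    qed
    also have "\<dots> = (\<Sum>i. emeasure (chart_measure g W) (A \<inter> g ` W \<inter> D i))"
      using A gW Db by (simp add: g.emeasure_chart_measure)
    also have "\<dots> = emeasure (chart_measure g W) (\<Union>i. A \<inter> g ` W \<inter> D i)"
      by (rule suminf_emeasure) (use A gW Db Ddisj in \<open>auto simp: disjoint_family_on_def\<close>)
    also have "(\<Union>i. A \<inter> g ` W \<inter> D i) = A \<inter> g ` W" using DU gM by auto
    also have "emeasure (chart_measure g W) (A \<inter> g ` W) = chart_integral g W (A \<inter> g ` W)"
      using A gW by (simp add: g.emeasure_chart_measure)
    also have "\<dots> = (\<integral>\<^sup>+ y\<in>W. (ennreal (area_density g y) * indicator A (g y)) \<partial>lborel)"
      unfolding chart_integral_def by (intro nn_integral_cong) (auto simp: indicator_def)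
    finally show "emeasure \<mu> (A \<inter> g ` W) = (\<integral>\<^sup>+ y\<in>W. (ennreal (area_density g y) * indicator A (g y)) \<partial>lborel)" .
  qed
  \<comment> \<open>Any candidate is concentrated on M, the disjoint union of the D i, and on each D
    i a chart prescribes its values.\<close>
  have char: "emeasure \<mu>' A = \<nu> A" if sm': "is_surface_measure TYPE('m) M \<mu>'" and A: "A \<in> sets borel" for \<mu>' A
  proof -
    have s': "sets \<mu>' = sets borel" and z: "emeasure \<mu>' (- M) = 0"
      and ch: "\<And>i. emeasure \<mu>' ((A \<inter> D i) \<inter> f i ` V i) = chart_integral (f i) (V i) (A \<inter> D i)"
      using sm' lp A Db unfolding is_surface_measure_def chart_integral_def by auto
    have "emeasure \<mu>' A = emeasure \<mu>' (A \<inter> M)"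
    proof (rule emeasure_eq_AE)
      show "AE x in \<mu>'. x \<in> A \<longleftrightarrow> x \<in> A \<inter> M"
        by (rule AE_I[of _ _ "- M"]) (use z M s' in auto)
    qed (use A M s' in auto)
    also have "\<dots> = emeasure \<mu>' (\<Union>i. A \<inter> D i)" using DU by (metis Int_UN_distrib)
    also have "\<dots> = (\<Sum>i. emeasure \<mu>' (A \<inter> D i))"
      by (rule suminf_emeasure[symmetric]) (use A Db Ddisj s' in \<open>auto simp: disjoint_family_on_def\<close>)
    also have "\<dots> = \<nu> A" unfolding \<nu>_def
    proof (intro suminf_cong)
      fix i
      have "A \<inter> D i \<inter> f i ` V i = A \<inter> D i" using Dsub by auto
      then show "emeasure \<mu>' (A \<inter> D i) = chart_integral (f i) (V i) (A \<inter> D i)" using ch[of i] by simp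
    qed
    finally show ?thesis .
  qed
  show ?thesis
  proof (rule ex1I)
    show "is_surface_measure TYPE('m) M \<mu>" by (rule sm)
    fix \<mu>' assume *: "is_surface_measure TYPE('m) M \<mu>'"
    have s': "sets \<mu>' = sets borel" using * by (simp add: is_surface_measure_def)
    show "\<mu>' = \<mu>"
      by (rule measure_eqI) (use s' sets_\<mu> char[OF *] char[OF sm] in auto)
  qed
qed

lemma is_surface_measure_surface_measure:
  fixes M :: "(real^'n::finite) set"
  assumes "M \<in> sets borel"
    and "\<And>x. x \<in> M \<Longrightarrow> \<exists>V (f :: real^'m::finite \<Rightarrow> real^'n). local_parametrization M V f \<and> x \<in> f ` V"
  shows "is_surface_measure TYPE('m) M (surface_measure TYPE('m) M)"
  unfolding surface_measure_def by (rule theI'[OF surface_measure_ex1[OF assms]])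

text \<open>Restricted to the chart image, \<open>\<mu>\<close> is \<open>chart_measure f V\<close>;
  on the rest of M the integrand is 0, and the complement of M is null.\<close>

lemma surface_integral_chart:
  fixes M :: "(real^'n::finite) set" and f :: "real^'m::finite \<Rightarrow> real^'n"
  assumes sm: "is_surface_measure TYPE('m) M \<mu>" and M: "M \<in> sets borel" and lp: "local_parametrization M V f"
    and \<phi>: "\<phi> \<in> borel_measurable borel" "\<And>x. x \<in> M - f ` V \<Longrightarrow> \<phi> x = 0"
  shows "(\<integral>x. \<phi> x \<partial>\<mu>) = (\<integral>y. indicator V y * (area_density f y * \<phi> (f y)) \<partial>lborel)"
proof -
  interpret immersion f V by (rule local_parametrization_immersion[OF lp])
  have s': "sets \<mu> = sets borel" and z: "emeasure \<mu> (- M) = 0"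
    and ch: "\<And>A. A \<in> sets borel \<Longrightarrow> emeasure \<mu> (A \<inter> f ` V) = chart_integral f V A"
    using sm lp unfolding is_surface_measure_def chart_integral_def by auto
  have fV: "f ` V \<in> sets borel" by (rule local_parametrization_borel[OF lp M])
  have mb: "\<phi> \<in> borel_measurable \<mu>" using \<phi>(1) s' measurable_cong_sets by blast
  have "density \<mu> (indicator (f ` V)) = chart_measure f V"
  proof (rule measure_eqI)
    fix A assume "A \<in> sets (density \<mu> (indicator (f ` V)))"
    then have A: "A \<in> sets borel" using s' by simp
    have "emeasure (density \<mu> (indicator (f ` V))) A = (\<integral>\<^sup>+ x. indicator (f ` V) x * indicator A x \<partial>\<mu>)"
      by (rule emeasure_density) (use fV A s' in auto)
    also have "\<dots> = (\<integral>\<^sup>+ x. indicator (A \<inter> f ` V) x \<partial>\<mu>)" by (intro nn_integral_cong) (auto simp: indicator_def)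
    also have "\<dots> = emeasure \<mu> (A \<inter> f ` V)" by (rule nn_integral_indicator) (use fV A s' in auto)
    finally show "emeasure (density \<mu> (indicator (f ` V))) A = emeasure (chart_measure f V) A"
      using ch[OF A] emeasure_chart_measure[OF A] by simp
  qed (simp add: s')
  moreover have "(\<integral>x. \<phi> x \<partial>density \<mu> (\<lambda>x. ennreal (indicator (f ` V) x))) = (\<integral>x. indicator (f ` V) x *\<^sub>R \<phi> x \<partial>\<mu>)"
    by (rule integral_density) (use mb fV s' in auto)
  moreover have "(\<lambda>x. ennreal (indicator (f ` V) x)) = indicator (f ` V)"
    by (auto simp: indicator_def)
  ultimately have "(\<integral>x. \<phi> x \<partial>chart_measure f V) = (\<integral>x. indicator (f ` V) x *\<^sub>R \<phi> x \<partial>\<mu>)" by simp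
  also have "\<dots> = (\<integral>x. \<phi> x \<partial>\<mu>)"
  proof (rule integral_cong_AE)
    show "AE x in \<mu>. indicator (f ` V) x *\<^sub>R \<phi> x = \<phi> x"
      by (rule AE_I[of _ _ "- M"]) (use z M s' \<phi>(2) in \<open>auto simp: indicator_def\<close>)
    show "(\<lambda>x. indicator (f ` V) x *\<^sub>R \<phi> x) \<in> borel_measurable \<mu>"
      using mb fV s' by auto
  qed (rule mb)
  finally show ?thesis using integral_chart_measure[OF \<phi>(1)] by simp
qed

section \<open>Orthonormal defining functions and local parametrizations\<close>

lemma grad_inner: "grad f x \<bullet> v = (\<Sum>k\<in>UNIV. partial k f x * v $ k)"
  by (simp add: grad_def inner_vec_def)

text \<open>Where g vanishes, a coefficient function f passes through the gradient like a constant.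
  This lets Gram-Schmidt act on defining functions as if on their gradients along M.\<close>

lemma grad_mult_zero:
  assumes "f differentiable (at y)" "g differentiable (at y)" "g y = 0"
  shows "grad (\<lambda>x. f x * g x) y = f y *\<^sub>R grad g y"
  using assms by (simp add: grad_def partial_mult vec_eq_iff)

lemma grad_diff:
  assumes "f differentiable (at y)" "g differentiable (at y)"
  shows "grad (\<lambda>x. f x - g x) y = grad f y - grad g y"
  using partial_has_derivative[OF has_derivative_diff[OF assms[THEN differentiable_has_derivative_frechet]]]
  by (simp add: grad_def vec_eq_iff partial_def)

lemma grad_sum:
  assumes "\<And>i. i \<in> I \<Longrightarrow> f i differentiable (at y)"
  shows "grad (\<lambda>x. \<Sum>i\<in>I. f i x) y = (\<Sum>i\<in>I. grad (f i) y)"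
  by (simp add: grad_def vec_eq_iff partial_sum[OF assms])

lemma smooth_on_grad_inner:
  "open U \<Longrightarrow> smooth_on U f \<Longrightarrow> smooth_on U g \<Longrightarrow> smooth_on U (\<lambda>y. grad f y \<bullet> grad g y)"
  unfolding grad_inner by (simp add: grad_def) (intro smooth_on_sum smooth_on_mult smooth_on_partial)

lemma smooth_on_diff:
  fixes f g :: "'a::real_normed_vector \<Rightarrow> real"
  assumes "open S" "smooth_on S f" "smooth_on S g"
  shows "smooth_on S (\<lambda>x. f x - g x)"
proof -
  have "smooth_on S (\<lambda>x. f x + (-1) * g x)"
    by (intro smooth_on_add smooth_on_mult smooth_on_const assms)
  then show ?thesis by simp
qed

lemma smooth_on_powr:
  fixes f :: "'a::real_normed_vector \<Rightarrow> real"
  shows "open S \<Longrightarrow> smooth_on S f \<Longrightarrow> (\<And>x. x \<in> S \<Longrightarrow> f x > 0) \<Longrightarrow> smooth_on S (\<lambda>x. f x powr a)"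
  unfolding smooth_on_def by (intro allI Ck_on_powr) auto

definition grads_independent_on :: "nat \<Rightarrow> (real^'n::finite) set \<Rightarrow> (nat \<Rightarrow> real^'n \<Rightarrow> real) \<Rightarrow> bool" where
  "grads_independent_on p S \<rho> \<longleftrightarrow>
     (\<forall>y\<in>S. \<forall>c. (\<Sum>j<p. c j *\<^sub>R grad (\<rho> j) y) = 0 \<longrightarrow> (\<forall>j<p. c j = 0))"

text \<open>\<sigma>_r is replaced by \<phi> w with w = \<sigma>_r - \<Sum> a_j \<sigma>_j and
  function coefficients a_j. The common zero set in U' stays the same, and at points of M the
  gradients transform as the vectors in Gram-Schmidt do, because all \<sigma>_j vanish
  there.\<close>

lemma gram_schmidt_step:
  fixes M :: "(real^'n::finite) set"
  assumes U: "x \<in> U" "x \<in> M" and zs: "zero_set_of p M U \<sigma>" and ind: "grads_independent_on p (M \<inter> U) \<sigma>" and r: "r < p"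
    and on: "\<forall>y\<in>M \<inter> U. \<forall>i<r. \<forall>j<r. grad (\<sigma> i) y \<bullet> grad (\<sigma> j) y = (if i = j then 1 else 0)"
  shows "\<exists>U' \<sigma>'. x \<in> U' \<and> zero_set_of p M U' \<sigma>' \<and> grads_independent_on p (M \<inter> U') \<sigma>' \<and>
     (\<forall>y\<in>M \<inter> U'. \<forall>i<Suc r. \<forall>j<Suc r. grad (\<sigma>' i) y \<bullet> grad (\<sigma>' j) y = (if i = j then 1 else 0))"
proof -
  have oU: "open U" and sm: "\<And>j. j < p \<Longrightarrow> smooth_on U (\<sigma> j)" and MU: "M \<inter> U = {y \<in> U. \<forall>j<p. \<sigma> j y = 0}"
    using zs by (auto simp: zero_set_of_def)
  define a where "a j y = grad (\<sigma> r) y \<bullet> grad (\<sigma> j) y" for j y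
  define w where "w y = \<sigma> r y - (\<Sum>j<r. a j y * \<sigma> j y)" for y
  have sa: "smooth_on U (a j)" if "j < p" for j
    unfolding a_def[abs_def] by (intro smooth_on_grad_inner oU sm r that)
  have sw: "smooth_on U w"
    unfolding w_def[abs_def] by (intro smooth_on_diff smooth_on_sum smooth_on_mult oU sm r sa) (use r in auto)
  have dif: "\<sigma> j differentiable (at y)" "a j differentiable (at y)" if "j < p" "y \<in> U" for j y
    using smooth_on_differentiable sm sa that by blast+
  have z: "\<sigma> j y = 0" if "y \<in> M \<inter> U" "j < p" for j y using that MU by auto
  have gw: "grad w y = grad (\<sigma> r) y - (\<Sum>j<r. a j y *\<^sub>R grad (\<sigma> j) y)" if y: "y \<in> M \<inter> U" for y
  proof -
    have d: "(\<lambda>y. a j y * \<sigma> j y) differentiable (at y)" if "j < r" for j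
      using dif[of j y] that r y by (intro differentiable_mult) auto
    have "grad w y = grad (\<sigma> r) y - grad (\<lambda>y. \<Sum>j<r. a j y * \<sigma> j y) y"
      unfolding w_def[abs_def] by (rule grad_diff) (use dif[of r y] r y d in \<open>auto intro!: differentiable_sum\<close>)
    also have "grad (\<lambda>y. \<Sum>j<r. a j y * \<sigma> j y) y = (\<Sum>j<r. grad (\<lambda>y. a j y * \<sigma> j y) y)"
      by (rule grad_sum) (use d in auto)
    also have "\<dots> = (\<Sum>j<r. a j y *\<^sub>R grad (\<sigma> j) y)"
      by (intro sum.cong refl grad_mult_zero) (use dif[of _ y] r y z in auto)
    finally show ?thesis .
  qed
  \<comment> \<open>Rewrites combinations involving the new gradient in the old ones, whose
    independence is known.\<close>
  have expand: "(\<Sum>j<p. c j *\<^sub>R grad (\<sigma> j) y) + d *\<^sub>R grad w y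
      = (\<Sum>j<p. (c j + (if j = r then d else if j < r then - d * a j y else 0)) *\<^sub>R grad (\<sigma> j) y)"
    if y: "y \<in> M \<inter> U" for y c d
  proof -
    let ?g = "\<lambda>j. grad (\<sigma> j) y"
    have "(\<Sum>j<p. (if j = r then d else if j < r then - d * a j y else 0) *\<^sub>R ?g j)
        = (\<Sum>j<p. (if j = r then d *\<^sub>R ?g r else 0) + (if j < r then (- d * a j y) *\<^sub>R ?g j else 0))"
      by (intro sum.cong refl) auto
    also have "\<dots> = d *\<^sub>R ?g r + (\<Sum>j<p. if j < r then (- d * a j y) *\<^sub>R ?g j else 0)"
      using r by (simp add: sum.distrib)
    also have "(\<Sum>j<p. if j < r then (- d * a j y) *\<^sub>R ?g j else 0) = (\<Sum>j<r. (- d * a j y) *\<^sub>R ?g j)"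
      by (rule sum.mono_neutral_cong_right) (use r in auto)
    finally show ?thesis
      by (simp add: gw[OF y] scaleR_add_left sum.distrib scaleR_diff_right scaleR_sum_right sum_negf)
  qed
  have indD: "c j = 0" if "y \<in> M \<inter> U" "(\<Sum>j<p. c j *\<^sub>R grad (\<sigma> j) y) = 0" "j < p" for y c j
    using ind that unfolding grads_independent_on_def by blast
  have gw0: "grad w y \<noteq> 0" if y: "y \<in> M \<inter> U" for y
  proof
    assume "grad w y = 0"
    then have "(\<Sum>j<p. (0 + (if j = r then 1 else if j < r then - 1 * a j y else 0)) *\<^sub>R grad (\<sigma> j) y) = 0"
      using expand[OF y, of "\<lambda>_. 0" 1] by simp
    from indD[OF y this r] show False by simp
  qed
  \<comment> \<open>Independence makes q positive on M \<inter> U but not necessarily on U; the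
    smaller U' is where its power -1/2 is smooth.\<close>
  define q where "q y = grad w y \<bullet> grad w y" for y
  have sq: "smooth_on U q" unfolding q_def[abs_def] by (intro smooth_on_grad_inner oU sw)
  define U' where "U' = {y \<in> U. q y \<in> {0<..}}"
  have oU': "open U'" unfolding U'_def
    by (rule open_preimage[OF oU smooth_on_continuous[OF sq]]) auto
  have U'U: "U' \<subseteq> U" by (auto simp: U'_def)
  have MU': "M \<inter> U' = M \<inter> U" using gw0 by (auto simp: U'_def q_def)
  define \<phi> where "\<phi> y = q y powr (- (1/2))" for y
  have qpos: "q y > 0" if "y \<in> U'" for y using that by (simp add: U'_def)
  have \<phi>pos: "\<phi> y > 0" if "y \<in> U'" for y using qpos[OF that] by (simp add: \<phi>_def)
  have s\<phi>: "smooth_on U' \<phi>"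
    unfolding \<phi>_def[abs_def] by (rule smooth_on_powr[OF oU' smooth_on_subset[OF sq U'U] qpos])
  have swU': "smooth_on U' w" using smooth_on_subset[OF sw U'U] .
  define \<sigma>' where "\<sigma>' = \<sigma>(r := \<lambda>y. \<phi> y * w y)"
  have w0: "w y = 0" if "y \<in> M \<inter> U" for y using z[OF that] r by (simp add: w_def)
  have g': "grad (\<sigma>' j) y = (if j = r then \<phi> y *\<^sub>R grad w y else grad (\<sigma> j) y)" if y: "y \<in> M \<inter> U'" for j y
  proof (cases "j = r")
    case True
    have "\<sigma>' j = (\<lambda>y. \<phi> y * w y)" by (simp add: \<sigma>'_def True)
    moreover have "grad (\<lambda>y. \<phi> y * w y) y = \<phi> y *\<^sub>R grad w y"
      by (rule grad_mult_zero) (use smooth_on_differentiable[OF s\<phi>] smooth_on_differentiable[OF swU'] y w0 MU' in auto)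
    ultimately show ?thesis using True by simp
  qed (simp add: \<sigma>'_def)
  have zs': "zero_set_of p M U' \<sigma>'"
    unfolding zero_set_of_def
  proof (intro conjI allI impI oU')
    fix j assume "j < p"
    then show "smooth_on U' (\<sigma>' j)"
      using smooth_on_mult[OF oU' s\<phi> swU'] smooth_on_subset[OF sm U'U] by (simp add: \<sigma>'_def)
  next
    have "(\<forall>j<p. \<sigma> j y = 0) \<longleftrightarrow> (\<forall>j<p. \<sigma>' j y = 0)" if y: "y \<in> U'" for y
    proof
      assume "\<forall>j<p. \<sigma> j y = 0"
      then show "\<forall>j<p. \<sigma>' j y = 0" using r by (simp add: \<sigma>'_def w_def)
    next
      assume A: "\<forall>j<p. \<sigma>' j y = 0"
      then have "\<phi> y * w y = 0" using r by (auto simp: \<sigma>'_def)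
      then have "w y = 0" using \<phi>pos[OF y] by simp
      moreover have B: "\<sigma> j y = 0" if "j < p" "j \<noteq> r" for j using A that by (auto simp: \<sigma>'_def)
      then have "(\<Sum>j<r. a j y * \<sigma> j y) = 0" using r by (intro sum.neutral) auto
      ultimately have "\<sigma> r y = 0" by (simp add: w_def)
      then show "\<forall>j<p. \<sigma> j y = 0" using B by blast
    qed
    then show "M \<inter> U' = {y \<in> U'. \<forall>j<p. \<sigma>' j y = 0}" using MU U'U by blast
  qed
  have ind': "grads_independent_on p (M \<inter> U') \<sigma>'"
    unfolding grads_independent_on_def
  proof (intro ballI allI impI)
    fix y c j assume y: "y \<in> M \<inter> U'" and s0: "(\<Sum>j<p. c j *\<^sub>R grad (\<sigma>' j) y) = 0" and j: "j < p"
    have yU: "y \<in> M \<inter> U" using y MU' by auto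
    have ph: "\<phi> y > 0" using \<phi>pos y by auto
    let ?c = "\<lambda>j. if j = r then 0 else c j"
    have "(\<Sum>j<p. c j *\<^sub>R grad (\<sigma>' j) y) = (\<Sum>j<p. ?c j *\<^sub>R grad (\<sigma> j) y + (if j = r then (c r * \<phi> y) *\<^sub>R grad w y else 0))"
      by (intro sum.cong refl) (simp add: g'[OF y])
    also have "\<dots> = (\<Sum>j<p. ?c j *\<^sub>R grad (\<sigma> j) y) + (c r * \<phi> y) *\<^sub>R grad w y"
      using r by (simp add: sum.distrib)
    finally have "(\<Sum>j<p. (?c j + (if j = r then c r * \<phi> y else if j < r then - (c r * \<phi> y) * a j y else 0)) *\<^sub>R grad (\<sigma> j) y) = 0"
      using s0 expand[OF yU, of ?c "c r * \<phi> y"] by (simp only:)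
    note all = indD[OF yU this]
    have cr: "c r = 0" using all[OF r] ph by simp
    show "c j = 0" using all[OF j] cr by (cases "j = r") (auto split: if_splits)
  qed
  have on': "grad (\<sigma>' i) y \<bullet> grad (\<sigma>' j) y = (if i = j then 1 else 0)"
    if y: "y \<in> M \<inter> U'" and ij: "i < Suc r" "j < Suc r" for y i j
  proof -
    have yU: "y \<in> M \<inter> U" using y MU' by auto
    have wi: "grad w y \<bullet> grad (\<sigma> i) y = 0" if "i < r" for i
    proof -
      have "(\<Sum>j<r. a j y * (grad (\<sigma> j) y \<bullet> grad (\<sigma> i) y)) = (\<Sum>j<r. if j = i then a i y else 0)"
        by (intro sum.cong refl) (use on yU that in auto)
      then show ?thesis using that by (simp add: gw[OF yU] inner_diff_left inner_sum_left a_def)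
    qed
    have ww: "(\<phi> y *\<^sub>R grad w y) \<bullet> (\<phi> y *\<^sub>R grad w y) = 1"
    proof -
      have "q y > 0" using qpos y by auto
      then have "\<phi> y * (\<phi> y * q y) = 1" unfolding \<phi>_def
        by (simp add: powr_minus powr_half_sqrt field_simps)
      then show ?thesis by (simp add: q_def)
    qed
    consider "i < r" "j < r" | "i = r" "j < r" | "i < r" "j = r" | "i = r" "j = r" using ij by linarith
    then show ?thesis
      by cases (use on yU wi ww in \<open>simp_all add: g'[OF y] inner_commute[of "grad (\<sigma> i) y" "grad w y"]\<close>)
  qed
  have "x \<in> U'" using MU' U by auto
  then show ?thesis using zs' ind' on' by blast
qed

lemma unit_defining_exists:
  fixes M :: "(real^'n::{finite,linorder}) set"
  assumes M: "smooth_submanifold m M" and x: "x \<in> M"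
  shows "\<exists>\<rho>. unit_defining_at (CARD('n) - m) M x \<rho>"
proof -
  let ?p = "CARD('n) - m"
  obtain U \<rho> where U: "x \<in> U" "zero_set_of ?p M U \<rho>" "grads_independent_on ?p (M \<inter> U) \<rho>"
    using M x unfolding smooth_submanifold_def grads_independent_on_def dual_vector_conormal by meson
  have "r \<le> ?p \<Longrightarrow> \<exists>U' \<sigma>'. x \<in> U' \<and> zero_set_of ?p M U' \<sigma>' \<and> grads_independent_on ?p (M \<inter> U') \<sigma>' \<and>
     (\<forall>y\<in>M \<inter> U'. \<forall>i<r. \<forall>j<r. grad (\<sigma>' i) y \<bullet> grad (\<sigma>' j) y = (if i = j then 1 else 0))" for r
  proof (induction r)
    case 0 then show ?case using U by auto
  next
    case (Suc r)
    then obtain U' \<sigma>' where "x \<in> U'" "zero_set_of ?p M U' \<sigma>'" "grads_independent_on ?p (M \<inter> U') \<sigma>'"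
     "\<forall>y\<in>M \<inter> U'. \<forall>i<r. \<forall>j<r. grad (\<sigma>' i) y \<bullet> grad (\<sigma>' j) y = (if i = j then 1 else 0)" by auto
    from gram_schmidt_step[OF this(1) x this(2,3) _ this(4)] Suc.prems show ?case by auto
  qed
  from this[of ?p] show ?thesis unfolding unit_defining_at_grad by blast
qed

text \<open>Near x the map \<Psi> straightens M into the tangent space T, since its normal
  components are the \<rho>_j. Its local inverse, restricted to T and written in linear coordinates
  L of T, is the chart.\<close>

lemma local_parametrization_exists:
  fixes M :: "(real^'n::{finite,linorder}) set"
  assumes ud: "unit_defining_at (CARD('n) - CARD('m::finite)) M x \<rho>" and x: "x \<in> M" and mn: "CARD('m) \<le> CARD('n)"
  shows "\<exists>V (f :: real^'m \<Rightarrow> real^'n::{finite,linorder}). local_parametrization M V f \<and> x \<in> f ` V"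
proof -
  define p where "p = CARD('n) - CARD('m)"
  obtain U where xU: "x \<in> U" and zs: "zero_set_of p M U \<rho>"
    and onM: "\<forall>y\<in>M \<inter> U. \<forall>i<p. \<forall>j<p. grad (\<rho> i) y \<bullet> grad (\<rho> j) y = (if i = j then 1 else 0)"
    using ud unfolding unit_defining_at_grad p_def by blast
  have oU: "open U" and sm: "\<And>j. j < p \<Longrightarrow> smooth_on U (\<rho> j)" and MU: "M \<inter> U = {y \<in> U. \<forall>j<p. \<rho> j y = 0}"
    using zs by (auto simp: zero_set_of_def)
  define n where "n j = grad (\<rho> j) x" for j
  have on: "n i \<bullet> n j = (if i = j then 1 else 0)" if "i < p" "j < p" for i j
    using onM x xU that by (simp add: n_def)
  define T where "T = {v. \<forall>j<p. n j \<bullet> v = 0}"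
  have subT: "subspace T" unfolding T_def subspace_def by (auto simp: inner_add_right)
  have dimT: "dim T = CARD('m)"
  proof -
    let ?N = "n ` {..<p}"
    have inj: "inj_on n {..<p}"
      by (rule inj_onI) (metis lessThan_iff on zero_neq_one)
    have po: "pairwise orthogonal ?N"
      using on inj by (auto simp: pairwise_def orthogonal_def)
    have "0 \<notin> ?N" using on by (metis imageE inner_zero_left lessThan_iff zero_neq_one)
    then have "independent ?N" by (rule pairwise_orthogonal_independent[OF po])
    then have dN: "dim (span ?N) = p" using inj by (simp add: dim_eq_card_independent card_image)
    have "T = {y \<in> UNIV. \<forall>x\<in>span ?N. orthogonal x y}"
    proof (intro set_eqI iffI)
      fix v assume "v \<in> T"
      then have "\<And>y. y \<in> ?N \<Longrightarrow> orthogonal v y" by (auto simp: T_def orthogonal_def inner_commute)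
      then have "orthogonal v y" if "y \<in> span ?N" for y
        using orthogonal_to_span[OF that] by blast
      then show "v \<in> {y \<in> UNIV. \<forall>x\<in>span ?N. orthogonal x y}" by (auto simp: orthogonal_commute)
    next
      fix v assume "v \<in> {y \<in> UNIV. \<forall>x\<in>span ?N. orthogonal x y}"
      then show "v \<in> T" by (auto simp: T_def orthogonal_def span_base)
    qed
    moreover have "dim {y \<in> UNIV. \<forall>x\<in>span ?N. orthogonal x y} + dim (span ?N) = dim (UNIV :: (real^'n::{finite,linorder}) set)"
      by (rule dim_subspace_orthogonal_to_vectors) auto
    ultimately show ?thesis using dN mn by (simp add: p_def)
  qed
  obtain L :: "real^'m \<Rightarrow> real^'n::{finite,linorder}" where L: "linear L" "range L = T" "inj L"
    using subspace_isomorphism[of "UNIV :: (real^'m) set" T] subT dimT by auto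
  obtain L' where L': "linear L'" "L' \<circ> L = id"
    using linear_injective_left_inverse[OF L(1,3)] by blast
  have LL [simp]: "L' (L y) = y" for y using L'(2) by (metis comp_apply id_apply)
  have blL: "bounded_linear L" "bounded_linear L'" using L(1) L'(1) linear_conv_bounded_linear by auto
  \<comment> \<open>Orthogonal projection onto T.\<close>
  define Q where "Q z = z - (\<Sum>j<p. (n j \<bullet> z) *\<^sub>R n j)" for z
  have linQ: "linear Q"
    unfolding Q_def
    by (rule linearI) (auto simp: inner_add_right scaleR_add_left sum.distrib scaleR_diff_right scaleR_sum_right)
  have nQ: "n i \<bullet> Q z = 0" if "i < p" for i z
  proof -
    have "(\<Sum>j<p. (n j \<bullet> z) * (n i \<bullet> n j)) = (\<Sum>j<p. if j = i then n i \<bullet> z else 0)"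
      by (intro sum.cong refl) (use on that in auto)
    then show ?thesis using that by (simp add: Q_def inner_diff_right inner_sum_right)
  qed
  \<comment> \<open>The normal coordinates of z are replaced by the values \<rho>_j; as \<rho>_j has
    gradient n_j at x, the derivative at x is the identity.\<close>
  define \<Psi> where "\<Psi> z = Q z + (\<Sum>j<p. \<rho> j z *\<^sub>R n j)" for z
  have n\<Psi>: "n i \<bullet> \<Psi> z = \<rho> i z" if "i < p" for i z
  proof -
    have "(\<Sum>j<p. \<rho> j z * (n i \<bullet> n j)) = (\<Sum>j<p. if j = i then \<rho> i z else 0)"
      by (intro sum.cong refl) (use on that in auto)
    then show ?thesis using that by (simp add: \<Psi>_def inner_add_right nQ inner_sum_right)
  qed
  have s\<Psi>: "smooth_on U \<Psi>"
  proof -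
    have "smooth_on U Q" unfolding smooth_on_def using Ck_on_bounded_linear[OF _ oU] linQ linear_conv_bounded_linear by blast
    moreover have "smooth_on U (\<lambda>z. \<Sum>j<p. \<rho> j z *\<^sub>R n j)"
      unfolding smooth_on_def
      by (intro allI Ck_on_sum Ck_on_scaleR Ck_on_const oU smooth_on_Ck sm) auto
    ultimately show ?thesis unfolding \<Psi>_def[abs_def] by (rule smooth_on_add[OF oU])
  qed
  have d\<Psi>: "frechet_derivative \<Psi> (at x) = (\<lambda>v. v)"
  proof -
    have dr: "(\<rho> j has_derivative frechet_derivative (\<rho> j) (at x)) (at x)" if "j < p" for j
      by (rule smooth_on_has_derivative[OF sm[OF that] xU])
    have nv: "frechet_derivative (\<rho> j) (at x) v = n j \<bullet> v" if "j < p" for j v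
      using sum_eq_axis[OF has_derivative_linear[OF dr[OF that]], of v]
      by (simp add: n_def grad_inner partial_def mult.commute)
    have "(\<Psi> has_derivative (\<lambda>v. Q v + (\<Sum>j<p. frechet_derivative (\<rho> j) (at x) v *\<^sub>R n j))) (at x)"
      unfolding \<Psi>_def[abs_def]
      by (intro has_derivative_add has_derivative_sum has_derivative_scaleR_left dr)
        (use linQ linear_conv_bounded_linear bounded_linear_imp_has_derivative in auto)
    moreover have "Q v + (\<Sum>j<p. frechet_derivative (\<rho> j) (at x) v *\<^sub>R n j) = v" for v
      using nv by (simp add: Q_def)
    ultimately show ?thesis using frechet_derivative_eqI by fastforce
  qed
  obtain U' W g where U': "open U'" "U' \<subseteq> U" "x \<in> U'" and oW: "open W" and hom: "homeomorphism U' W \<Psi> g"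
    and sg: "smooth_on W g" and dg: "\<And>y. y \<in> W \<Longrightarrow> (g has_derivative frechet_derivative g (at y)) (at y)"
    using smooth_inverse_function[OF oU xU s\<Psi> d\<Psi>] by metis
  have inT: "\<Psi> z \<in> T \<longleftrightarrow> z \<in> M" if "z \<in> U'" for z
    using that U'(2) MU n\<Psi> by (auto simp: T_def)
  define V where "V = L -` W"
  define f where "f y = g (L y)" for y
  have contL: "continuous_on S L" for S using blL(1) by (rule linear_continuous_on)
  have oV: "open V" unfolding V_def using oW contL[of UNIV] by (rule open_vimage)
  have LV: "L ` V \<subseteq> W" by (auto simp: V_def)
  have sL: "smooth_on V L" unfolding smooth_on_def using Ck_on_bounded_linear[OF blL(1) oV] by blast
  have sf: "smooth_on V f"
    unfolding f_def[abs_def] by (rule smooth_on_compose[OF oV oW sL sg LV])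
  have gW: "g w \<in> U'" "\<Psi> (g w) = w" if "w \<in> W" for w
    using hom that unfolding homeomorphism_def by auto
  have fV: "f ` V = M \<inter> U'"
  proof (intro set_eqI iffI)
    fix z assume "z \<in> f ` V"
    then obtain y where y: "L y \<in> W" "z = g (L y)" by (auto simp: V_def f_def)
    then have "z \<in> U'" "\<Psi> z = L y" using gW by auto
    moreover have "L y \<in> T" using L(2) by auto
    ultimately show "z \<in> M \<inter> U'" using inT[of z] by auto
  next
    fix z assume z: "z \<in> M \<inter> U'"
    then have "\<Psi> z \<in> T" using inT by auto
    then obtain y where y: "\<Psi> z = L y" using L(2) by auto
    have "\<Psi> z \<in> W" "g (\<Psi> z) = z" using hom z unfolding homeomorphism_def by auto
    then have "y \<in> V" "f y = z" using y by (auto simp: V_def f_def)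
    then show "z \<in> f ` V" by blast
  qed
  have "local_parametrization M V f"
    unfolding local_parametrization_def
  proof (intro conjI ballI oV sf)
    show "openin (top_of_set M) (f ` V)" unfolding fV using U'(1) by (auto simp: openin_open)
  next
    fix y assume "y \<in> V"
    then have w: "L y \<in> W" by (simp add: V_def)
    have "(f has_derivative (\<lambda>v. frechet_derivative g (at (L y)) (L v))) (at y)"
      unfolding f_def[abs_def]
      by (rule has_derivative_compose[OF bounded_linear_imp_has_derivative[OF blL(1)] dg[OF w]])
    then have fd: "frechet_derivative f (at y) = (\<lambda>v. frechet_derivative g (at (L y)) (L v))"
      by (rule frechet_derivative_eqI)
    have d\<Psi>g: "(\<Psi> has_derivative frechet_derivative \<Psi> (at (g (L y)))) (at (g (L y)))"
      by (rule smooth_on_has_derivative[OF s\<Psi>]) (use gW(1)[OF w] U'(2) in auto)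
    have "((\<lambda>w. \<Psi> (g w)) has_derivative (\<lambda>v. frechet_derivative \<Psi> (at (g (L y))) (frechet_derivative g (at (L y)) v))) (at (L y))"
      by (rule has_derivative_compose[OF dg[OF w] d\<Psi>g])
    then have "((\<lambda>w. w) has_derivative (\<lambda>v. frechet_derivative \<Psi> (at (g (L y))) (frechet_derivative g (at (L y)) v))) (at (L y))"
      by (rule has_derivative_transform_within_open[OF _ oW w]) (rule gW(2))
    \<comment> \<open>The derivative of g has a left inverse, hence is injective, and so is its
      composition with L.\<close>
    then have id: "frechet_derivative \<Psi> (at (g (L y))) (frechet_derivative g (at (L y)) v) = v" for v
      using has_derivative_unique[OF _ has_derivative_ident] by metis
    show "inj (frechet_derivative f (at y))"
    proof (rule injI)
      fix u v assume "frechet_derivative f (at y) u = frechet_derivative f (at y) v"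
      then have "L u = L v" unfolding fd by (metis id)
      then show "u = v" using L(3) by (simp add: inj_eq)
    qed
  next
    have "homeomorphism V (f ` V) f (\<lambda>z. L' (\<Psi> z))"
      unfolding homeomorphism_def
    proof (intro conjI ballI)
      show "continuous_on V f" by (rule smooth_on_continuous[OF sf])
      have inv: "L' (\<Psi> (f y)) = y" if "y \<in> V" for y using gW(2)[of "L y"] that by (simp add: V_def f_def)
      show "L' (\<Psi> (f y)) = y" if "y \<in> V" for y by (rule inv[OF that])
      show "(\<lambda>z. L' (\<Psi> z)) ` f ` V = V" using inv by (auto simp: image_iff)
      show "f (L' (\<Psi> z)) = z" if "z \<in> f ` V" for z using that inv by auto
      have c\<Psi>: "continuous_on (f ` V) \<Psi>"
        by (rule continuous_on_subset[OF smooth_on_continuous[OF s\<Psi>]]) (use fV U'(2) in auto)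
      show "continuous_on (f ` V) (\<lambda>z. L' (\<Psi> z))"
        by (rule continuous_on_compose2[OF linear_continuous_on[OF blL(2), of UNIV] c\<Psi>]) auto
    qed auto
    then show "\<exists>g. homeomorphism V (f ` V) f g" by blast
  qed
  moreover have "x \<in> f ` V" using fV x U'(3) by auto
  ultimately show ?thesis by blast
qed

section \<open>The supercurrent of a submanifold\<close>

text \<open>(1,1)-forms are even, so they commute with 1-forms. This carries the dx_k produced by d
  past [M]_s \<and> \<beta>^(m-1).\<close>

lemma pform_X: "pform P * X k = X k * pform P"
proof -
  have c: "(X a * Y b) * X k = X k * (X a * Y b)" for a b
  proof -
    have "(X a * Y b) * X k = X a * (Y b * X k)" by (simp only: mult.assoc)
    also have "\<dots> = - (X a * X k) * Y b" by (simp only: Y_X mult_minus_right mult.assoc mult_minus_left)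
    also have "\<dots> = X k * X a * Y b" by (subst X_X) (simp only: minus_minus)
    finally show ?thesis by (simp only: mult.assoc)
  qed
  show ?thesis unfolding pform_def sum_distrib_left sum_distrib_right
    by (intro sum.cong refl) (simp only: mult_scaleR_left mult_scaleR_right c)
qed

lemma sscalar_0: "sscalar 0 = (\<lambda>_ _. 0)"
  by (simp add: sscalar_def fun_eq_iff)

lemma swedge_zero_left: "(\<lambda>_ _. 0) \<and>\<^sub>s b = (\<lambda>_ _. 0)"
  by (simp add: swedge_def)

lemma swedge_zero_right: "a \<and>\<^sub>s (\<lambda>_ _. 0) = (\<lambda>_ _. 0)"
  by (simp add: swedge_def)

text \<open>Only the splitting with L the complement of l meets d\<xi>_l. The sign stays
  unevaluated: \<open>current_apply_bidegree\<close> produces the same one.\<close>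

lemma swedge_dxi_top:
  "(a \<and>\<^sub>s dxi l) UNIV UNIV = wedge_sign UNIV (UNIV - {l}) {} {l} * a UNIV (UNIV - {l})"
proof -
  have "(a \<and>\<^sub>s dxi l) UNIV UNIV = (\<Sum>K\<in>{UNIV}. \<Sum>L\<in>{UNIV - {l}}. wedge_sign K L (UNIV - K) (UNIV - L) * (a K L * dxi l (UNIV - K) (UNIV - L)))"
    unfolding swedge_def
  proof (rule sum.mono_neutral_cong_right)
    show "\<forall>K\<in>Pow UNIV - {UNIV}. (\<Sum>L\<in>Pow UNIV. wedge_sign K L (UNIV - K) (UNIV - L) * (a K L * dxi l (UNIV - K) (UNIV - L))) = 0"
    proof
      fix K :: "'a set" assume "K \<in> Pow UNIV - {UNIV}"
      then have "UNIV - K \<noteq> {}" by auto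
      then show "(\<Sum>L\<in>Pow UNIV. wedge_sign K L (UNIV - K) (UNIV - L) * (a K L * dxi l (UNIV - K) (UNIV - L))) = 0"
        by (intro sum.neutral) (auto simp: dxi_def)
    qed
  next
    fix K :: "'a set"
    show "(\<Sum>L\<in>Pow UNIV. wedge_sign K L (UNIV - K) (UNIV - L) * (a K L * dxi l (UNIV - K) (UNIV - L)))
      = (\<Sum>L\<in>{UNIV - {l}}. wedge_sign K L (UNIV - K) (UNIV - L) * (a K L * dxi l (UNIV - K) (UNIV - L)))"
    proof (rule sum.mono_neutral_right)
      show "\<forall>L\<in>Pow UNIV - {UNIV - {l}}. wedge_sign K L (UNIV - K) (UNIV - L) * (a K L * dxi l (UNIV - K) (UNIV - L)) = 0"
      proof
        fix L :: "'a set" assume "L \<in> Pow UNIV - {UNIV - {l}}"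
        then have "UNIV - L \<noteq> {l}" by auto
        then show "wedge_sign K L (UNIV - K) (UNIV - L) * (a K L * dxi l (UNIV - K) (UNIV - L)) = 0"
          by (simp add: dxi_def)
      qed
    qed auto
  qed auto
  moreover have "UNIV - (UNIV - {l}) = {l}" by auto
  ultimately show ?thesis by (simp add: dxi_def)
qed

lemma form_wedge_star:
  "form_wedge_current a (star_measure \<mu>) K L \<phi> = (\<integral>x. a x K L * \<phi> x \<partial>\<mu>)"
proof -
  have "form_wedge_current a (star_measure \<mu>) K L \<phi>
    = (\<Sum>K'\<in>{K}. \<Sum>L'\<in>{L}. wedge_sign K' L' (K - K') (L - L') * star_measure \<mu> (K - K') (L - L') (\<lambda>x. a x K' L' * \<phi> x))"
    unfolding form_wedge_current_def
  proof (rule sum.mono_neutral_cong_right)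
    have z: "star_measure \<mu> (K - K') (L - L') \<psi> = 0" if "K' \<in> Pow K - {K} \<or> L' \<in> Pow L - {L}" for K' L' \<psi>
      using that by (auto simp: star_measure_def)
    then show "\<forall>K'\<in>Pow K - {K}. (\<Sum>L'\<in>Pow L. wedge_sign K' L' (K - K') (L - L') * star_measure \<mu> (K - K') (L - L') (\<lambda>x. a x K' L' * \<phi> x)) = 0"
      by simp
    fix K'
    show "(\<Sum>L'\<in>Pow L. wedge_sign K' L' (K - K') (L - L') * star_measure \<mu> (K - K') (L - L') (\<lambda>x. a x K' L' * \<phi> x))
      = (\<Sum>L'\<in>{L}. wedge_sign K' L' (K - K') (L - L') * star_measure \<mu> (K - K') (L - L') (\<lambda>x. a x K' L' * \<phi> x))"
      by (rule sum.mono_neutral_right) (use z in simp_all)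
  qed auto
  then show ?thesis by (simp add: star_measure_def)
qed

lemma partial_cmult:
  assumes "f differentiable (at x)"
  shows "partial k (\<lambda>y. c * f y) x = c * partial k f x"
  using partial_mult[OF differentiable_const[of c] assms, of k] by simp

text \<open>Integrability of every coefficient lets the finite wedge sum commute with the integral;
  the integral of a non-integrable function is 0 by convention, which would break
  additivity.\<close>

lemma current_wedge_form_smooth:
  fixes \<mu> :: "(real^'n::{finite,linorder}) measure"
  assumes "\<And>K L. integrable \<mu> (\<lambda>x. N x K L * \<phi> x)"
  shows "current_wedge_form (form_wedge_current N (star_measure \<mu>)) (\<lambda>_. b) I J \<phi> = (\<integral>x. (N x \<and>\<^sub>s b) I J * \<phi> x \<partial>\<mu>)"
    and "integrable \<mu> (\<lambda>x. (N x \<and>\<^sub>s b) I J * \<phi> x)"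
proof -
  let ?t = "\<lambda>K L x. (wedge_sign K L (I - K) (J - L) * b (I - K) (J - L)) * (N x K L * \<phi> x)"
  have i: "integrable \<mu> (?t K L)" for K L by (intro integrable_mult_right assms)
  have e: "(N x \<and>\<^sub>s b) I J * \<phi> x = (\<Sum>K\<in>Pow I. \<Sum>L\<in>Pow J. ?t K L x)" for x
    unfolding swedge_def sum_distrib_right by (simp add: mult_ac)
  show "integrable \<mu> (\<lambda>x. (N x \<and>\<^sub>s b) I J * \<phi> x)"
    unfolding e by (intro Bochner_Integration.integrable_sum i)
  have "(\<integral>x. (N x \<and>\<^sub>s b) I J * \<phi> x \<partial>\<mu>) = (\<Sum>K\<in>Pow I. \<integral>x. (\<Sum>L\<in>Pow J. ?t K L x) \<partial>\<mu>)"
    unfolding e by (rule Bochner_Integration.integral_sum) (intro Bochner_Integration.integrable_sum i)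
  also have "\<dots> = (\<Sum>K\<in>Pow I. \<Sum>L\<in>Pow J. \<integral>x. ?t K L x \<partial>\<mu>)"
    by (intro sum.cong refl Bochner_Integration.integral_sum i)
  also have "\<dots> = current_wedge_form (form_wedge_current N (star_measure \<mu>)) (\<lambda>_. b) I J \<phi>"
    unfolding current_wedge_form_def form_wedge_star
  proof (intro sum.cong refl)
    fix K L
    have "(\<integral>x. ?t K L x \<partial>\<mu>) = (wedge_sign K L (I - K) (J - L) * b (I - K) (J - L)) * (\<integral>x. N x K L * \<phi> x \<partial>\<mu>)"
      by (rule integral_mult_right_zero)
    moreover have "(\<integral>x. N x K L * (b (I - K) (J - L) * \<phi> x) \<partial>\<mu>) = b (I - K) (J - L) * (\<integral>x. N x K L * \<phi> x \<partial>\<mu>)"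
    proof -
      have "(\<integral>x. b (I - K) (J - L) * (N x K L * \<phi> x) \<partial>\<mu>) = b (I - K) (J - L) * (\<integral>x. N x K L * \<phi> x \<partial>\<mu>)"
        by (rule integral_mult_right_zero)
      then show ?thesis by (simp add: mult.left_commute)
    qed
    ultimately show "(\<integral>x. ?t K L x \<partial>\<mu>) = wedge_sign K L (I - K) (J - L) * (\<integral>x. N x K L * (b (I - K) (J - L) * \<phi> x) \<partial>\<mu>)"
      by simp
  qed
  finally show "current_wedge_form (form_wedge_current N (star_measure \<mu>)) (\<lambda>_. b) I J \<phi> = (\<integral>x. (N x \<and>\<^sub>s b) I J * \<phi> x \<partial>\<mu>)" ..
qed

text \<open>The type \<open>scurrent\<close> carries no linearity, so T is controlled only on the
  derivatives of \<phi> and on the zero function. This suffices because the coefficients of dx_k are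
  0 or 1. The minus sign is that of the distributional derivative.\<close>

lemma current_d_eq:
  assumes T: "\<And>I J k. T I J (partial k \<phi>) = (\<integral>x. a x I J * partial k \<phi> x \<partial>\<mu>)"
    and i: "\<And>I J k. integrable \<mu> (\<lambda>x. a x I J * partial k \<phi> x)"
    and T0: "\<And>I J. T I J (\<lambda>_. 0) = 0" and d: "\<And>x. \<phi> differentiable (at x)"
  shows "current_d T I J \<phi> = - (\<Sum>k\<in>UNIV. \<integral>x. (dx k \<and>\<^sub>s a x) I J * partial k \<phi> x \<partial>\<mu>)"
proof -
  have p: "partial k (\<lambda>x. dx k K L * \<phi> x) = (\<lambda>x. dx k K L * partial k \<phi> x)" for k K L
    using d by (auto simp: partial_cmult)
  have tm: "- T A B (\<lambda>x. dx k K L * partial k \<phi> x) = - (dx k K L * (\<integral>x. a x A B * partial k \<phi> x \<partial>\<mu>))" for k K L A B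
    using T T0 by (auto simp: dx_def)
  have "(\<integral>x. (dx k \<and>\<^sub>s a x) I J * partial k \<phi> x \<partial>\<mu>)
     = (\<Sum>K\<in>Pow I. \<Sum>L\<in>Pow J. wedge_sign K L (I - K) (J - L) * (dx k K L * (\<integral>x. a x (I - K) (J - L) * partial k \<phi> x \<partial>\<mu>)))" for k
  proof -
    let ?t = "\<lambda>K L x. (wedge_sign K L (I - K) (J - L) * dx k K L) * (a x (I - K) (J - L) * partial k \<phi> x)"
    have it: "integrable \<mu> (?t K L)" for K L by (intro integrable_mult_right i)
    have e: "(dx k \<and>\<^sub>s a x) I J * partial k \<phi> x = (\<Sum>K\<in>Pow I. \<Sum>L\<in>Pow J. ?t K L x)" for x
      unfolding swedge_def sum_distrib_right by (simp add: mult_ac)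
    have "(\<integral>x. (dx k \<and>\<^sub>s a x) I J * partial k \<phi> x \<partial>\<mu>) = (\<Sum>K\<in>Pow I. \<integral>x. (\<Sum>L\<in>Pow J. ?t K L x) \<partial>\<mu>)"
      unfolding e by (rule Bochner_Integration.integral_sum) (intro Bochner_Integration.integrable_sum it)
    also have "\<dots> = (\<Sum>K\<in>Pow I. \<Sum>L\<in>Pow J. \<integral>x. ?t K L x \<partial>\<mu>)"
      by (intro sum.cong refl Bochner_Integration.integral_sum it)
    also have "\<dots> = (\<Sum>K\<in>Pow I. \<Sum>L\<in>Pow J. (wedge_sign K L (I - K) (J - L) * dx k K L) * (\<integral>x. a x (I - K) (J - L) * partial k \<phi> x \<partial>\<mu>))"
      by (intro sum.cong refl integral_mult_right_zero)
    finally show ?thesis by (simp add: mult.assoc)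
  qed
  then show ?thesis
    unfolding current_d_def form_wedge_current_def p tm sum_negf[symmetric] by (simp add: sum_negf)
qed

text \<open>A current of bidegree (n, n-1) pairs only with the (0,1)-part of \<alpha>, indexed by
  the missing d\<xi>_l. The vanishing in other bidegrees is asked for only on the components of
  \<alpha>, where it can be computed.\<close>

lemma current_apply_bidegree:
  fixes S :: "'n::{finite,linorder} scurrent"
  assumes S: "\<And>I J \<psi>. \<not> (card I = CARD('n) \<and> card J = CARD('n) - 1) \<Longrightarrow> \<psi> \<in> range (\<lambda>p x. \<alpha> x (fst p) (snd p)) \<Longrightarrow> S I J \<psi> = 0"
  shows "current_apply S \<alpha> = csign CARD('n) *
     (\<Sum>l\<in>UNIV. wedge_sign UNIV (UNIV - {l}) {} {l} * S UNIV (UNIV - {l}) (\<lambda>x. \<alpha> x {} {l}))"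
proof -
  let ?t = "\<lambda>K L. wedge_sign K L (UNIV - K) (UNIV - L) * S K L (\<lambda>x. \<alpha> x (UNIV - K) (UNIV - L))"
  have S': "S K L (\<lambda>x. \<alpha> x (UNIV - K) (UNIV - L)) = 0" if "\<not> (card K = CARD('n) \<and> card L = CARD('n) - 1)" for K L
    by (rule S[OF that]) (rule image_eqI[of _ _ "(UNIV - K, UNIV - L)"], auto)
  have "current_wedge_form S \<alpha> UNIV UNIV (\<lambda>_. 1) = (\<Sum>K\<in>UNIV. \<Sum>L\<in>UNIV. ?t K L)"
    by (simp add: current_wedge_form_def)
  also have "\<dots> = (\<Sum>K\<in>{UNIV}. \<Sum>L\<in>range (\<lambda>l. UNIV - {l}). ?t K L)"
  proof (rule sum.mono_neutral_cong_right)
    show "\<forall>K\<in>UNIV - {UNIV}. (\<Sum>L\<in>UNIV. ?t K L) = 0"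
    proof
      fix K :: "'n set" assume "K \<in> UNIV - {UNIV}"
      then have "card K \<noteq> CARD('n)" using card_eq_UNIV_imp_eq_UNIV[of K] by auto
      then show "(\<Sum>L\<in>UNIV. ?t K L) = 0" using S' by simp
    qed
  next
    fix K :: "'n set"
    show "(\<Sum>L\<in>UNIV. ?t K L) = (\<Sum>L\<in>range (\<lambda>l. UNIV - {l}). ?t K L)"
    proof (rule sum.mono_neutral_right)
      show "\<forall>L\<in>UNIV - range (\<lambda>l. UNIV - {l}). ?t K L = 0"
      proof
        fix L :: "'n set" assume L: "L \<in> UNIV - range (\<lambda>l. UNIV - {l})"
        have "card L \<noteq> CARD('n) - 1"
        proof
          assume c: "card L = CARD('n) - 1"
          have "card (UNIV - L) = 1" using c card_Diff_subset[of L UNIV] by (simp add: Suc_leI)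
          then obtain l where "UNIV - L = {l}" by (auto simp: card_1_singleton_iff)
          then have "L = UNIV - {l}" by auto
          then show False using L by auto
        qed
        then show "?t K L = 0" using S' by simp
      qed
    qed auto
  qed auto
  also have "\<dots> = (\<Sum>l\<in>UNIV. ?t UNIV (UNIV - {l}))"
    by (subst sum.reindex) (auto simp: inj_on_def)
  also have "\<dots> = (\<Sum>l\<in>UNIV. wedge_sign UNIV (UNIV - {l}) {} {l} * S UNIV (UNIV - {l}) (\<lambda>x. \<alpha> x {} {l}))"
  proof (intro sum.cong refl)
    fix l :: 'n
    have "UNIV - (UNIV - {l}) = {l}" by auto
    then show "?t UNIV (UNIV - {l}) = wedge_sign UNIV (UNIV - {l}) {} {l} * S UNIV (UNIV - {l}) (\<lambda>x. \<alpha> x {} {l})" by simp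
  qed
  finally show ?thesis by (simp add: current_apply_def)
qed

text \<open>Orthogonal projection onto the tangent space of M at x, 0 off M. The pointwise choice in
  \<open>unit_defining\<close> does not affect its value, as \<open>tangent_proj_chart\<close>
  shows.\<close>

definition tangent_proj :: "nat \<Rightarrow> (real^'n::{finite,linorder}) set \<Rightarrow> real^'n::{finite,linorder} \<Rightarrow> 'n \<Rightarrow> 'n \<Rightarrow> real" where
  "tangent_proj p M x k l = (if x \<in> M then (if k = l then 1 else 0)
     - (\<Sum>j<p. grad (unit_defining p M x j) x $ k * grad (unit_defining p M x j) x $ l) else 0)"

text \<open>The product of the n_j \<and> n_j^# sees only the projection onto the normal space, 1 -
  \<open>tangent_proj\<close>; the continuity of \<open>normal_form\<close> along M rests on
  this.\<close>

lemma normal_form_eq: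
  assumes "x \<in> M"
  shows "normal_form p M x = coeff_of ((1 / fact p) *\<^sub>R pform (\<lambda>k l. (if k = l then 1 else 0) - tangent_proj p M x k l) ^ p)"
proof -
  have "normal_form p M x = coeff_of (prod_list (map (\<lambda>i. eform (grad (unit_defining p M x i) x)) [0..<p]))"
    using assms by (simp add: normal_form_def Let_def normal_wedge_eq)
  also have "\<dots> = coeff_of ((1 / fact p) *\<^sub>R pform (\<lambda>k l. \<Sum>j<p. grad (unit_defining p M x j) x $ k * grad (unit_defining p M x j) x $ l) ^ p)"
    by (simp only: prod_eform)
  also have "(\<lambda>k l. \<Sum>j<p. grad (unit_defining p M x j) x $ k * grad (unit_defining p M x j) x $ l)
     = (\<lambda>k l. (if k = l then 1 else 0) - tangent_proj p M x k l)"
    using assms by (simp add: tangent_proj_def fun_eq_iff)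
  finally show ?thesis .
qed

text \<open>All factors between dx_k and d\<xi>_l are even, so dx_k can be moved next to d\<xi>_l,
  where \<open>normal_wedge_top\<close> applies. Off M both sides are 0.\<close>

lemma normal_form_top:
  fixes M :: "(real^'n::{finite,linorder}) set"
  assumes ud: "x \<in> M \<Longrightarrow> \<exists>\<rho>. unit_defining_at p M x \<rho>" and pm: "p + m = CARD('n)" "m \<ge> 1"
  shows "(dx k \<and>\<^sub>s (normal_form p M x \<and>\<^sub>s swedge_power beta (m - 1)) \<and>\<^sub>s dxi l) UNIV UNIV
     = tangent_proj p M x k l * top_const TYPE('n) m"
proof (cases "x \<in> M")
  case False
  then show ?thesis by (simp add: normal_form_def sscalar_0 swedge_zero_left swedge_zero_right tangent_proj_def)
next
  case True
  define r where "r = unit_defining p M x"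
  have "unit_defining_at p M x r" unfolding r_def unit_defining_def using ud[OF True] by (rule someI_ex)
  then have on: "\<forall>i<p. \<forall>j<p. grad (r i) x \<bullet> grad (r j) x = (if i = j then 1 else 0)"
    using True unfolding unit_defining_at_grad by blast
  let ?q = "(1 / fact p) *\<^sub>R pform (\<lambda>k l. (if k = l then 1 else 0) - tangent_proj p M x k l) ^ p * pform (\<lambda>k l. if k = l then 1 else 0) ^ (m - 1)"
  have c: "X k * ?q = ?q * X k"
  proof -
    have 1: "pform P ^ j * X k = X k * pform P ^ j" for P j by (rule power_commuting_commutes[OF pform_X])
    have "?q * X k = (1 / fact p) *\<^sub>R pform (\<lambda>k l. (if k = l then 1 else 0) - tangent_proj p M x k l) ^ p * (X k * pform (\<lambda>k l. if k = l then 1 else 0) ^ (m - 1))"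
      by (simp only: mult.assoc 1)
    also have "\<dots> = (1 / fact p) *\<^sub>R (pform (\<lambda>k l. (if k = l then 1 else 0) - tangent_proj p M x k l) ^ p * X k) * pform (\<lambda>k l. if k = l then 1 else 0) ^ (m - 1)"
      by (simp only: mult.assoc mult_scaleR_left)
    also have "\<dots> = X k * ?q" by (simp only: 1 mult.assoc mult_scaleR_left mult_scaleR_right)
    finally show ?thesis ..
  qed
  have q: "coeff_of ?q = normal_form p M x \<and>\<^sub>s swedge_power beta (m - 1)"
    by (simp only: times_superform.rep_eq normal_form_eq[OF True] coeff_of_power coeff_of_beta)
  have "dx k \<and>\<^sub>s (normal_form p M x \<and>\<^sub>s swedge_power beta (m - 1)) = normal_form p M x \<and>\<^sub>s swedge_power beta (m - 1) \<and>\<^sub>s dx k"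
    using arg_cong[OF c, of coeff_of] by (simp only: times_superform.rep_eq[of "X k"] times_superform.rep_eq[of ?q] q coeff_of_X)
  then have "dx k \<and>\<^sub>s (normal_form p M x \<and>\<^sub>s swedge_power beta (m - 1)) \<and>\<^sub>s dxi l
    = normal_form p M x \<and>\<^sub>s swedge_power beta (m - 1) \<and>\<^sub>s (dx k \<and>\<^sub>s dxi l)"
    by (simp add: swedge_assoc)
  moreover have "normal_form p M x = sscalar (csign p) \<and>\<^sub>s (conormal_wedge r p x \<and>\<^sub>s Jop (conormal_wedge r p x))"
    using True by (simp add: normal_form_def Let_def r_def)
  ultimately show ?thesis
    using normal_wedge_top[OF on pm, of k l] True by (simp add: tangent_proj_def r_def)
qed

lemma has_bidegree_normal_form: "has_bidegree p p (normal_form p M x)"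
proof (cases "x \<in> M")
  case True
  then show ?thesis using has_bidegree_normal_wedge[of p "unit_defining p M x" x]
    by (simp add: normal_form_def Let_def)
next
  case False
  then show ?thesis by (simp add: normal_form_def sscalar_0 has_bidegree_def)
qed

text \<open>Bidegree leaves only the d\<xi>_l-components of \<alpha>; for these the top coefficient
  of dx_k \<and> [M]_s \<and> \<beta>^(m-1) \<and> d\<xi>_l is a projection entry times
  \<open>top_const\<close>.\<close>

lemma current_apply_submanifold:
  fixes M :: "(real^'n::{finite,linorder}) set" and \<mu> :: "(real^'n::{finite,linorder}) measure"
  assumes ud: "\<And>x. x \<in> M \<Longrightarrow> \<exists>\<rho>. unit_defining_at p M x \<rho>" and pm: "p + m = CARD('n)" "m \<ge> 1"
    and sm: "\<And>I J. smooth_on UNIV (\<lambda>x. \<alpha> x I J)"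
    and int: "\<And>I J k K L. integrable \<mu> (\<lambda>x. normal_form p M x K L * partial k (\<lambda>x. \<alpha> x I J) x)"
  shows "current_apply (current_d (current_wedge_form (form_wedge_current (normal_form p M) (star_measure \<mu>)) (\<lambda>_. swedge_power beta (m - 1)))) \<alpha>
    = - (csign CARD('n) * top_const TYPE('n) m) *
       (\<Sum>l\<in>UNIV. \<Sum>k\<in>UNIV. \<integral>x. tangent_proj p M x k l * partial k (\<lambda>x. \<alpha> x {} {l}) x \<partial>\<mu>)"
proof -
  let ?b = "swedge_power (beta :: 'n sform) (m - 1)"
  let ?T = "current_wedge_form (form_wedge_current (normal_form p M) (star_measure \<mu>)) (\<lambda>_. ?b)"
  let ?a = "\<lambda>x. normal_form p M x \<and>\<^sub>s ?b"
  have cd: "current_d ?T I J (\<lambda>x. \<alpha> x A B) = - (\<Sum>k\<in>UNIV. \<integral>x. (dx k \<and>\<^sub>s ?a x) I J * partial k (\<lambda>x. \<alpha> x A B) x \<partial>\<mu>)" for I J A B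
  proof (rule current_d_eq)
    show "?T I J (partial k (\<lambda>x. \<alpha> x A B)) = (\<integral>x. ?a x I J * partial k (\<lambda>x. \<alpha> x A B) x \<partial>\<mu>)" for I J k
      by (rule current_wedge_form_smooth(1)) (rule int)
    show "integrable \<mu> (\<lambda>x. ?a x I J * partial k (\<lambda>x. \<alpha> x A B) x)" for I J k
      by (rule current_wedge_form_smooth(2)) (rule int)
    show "?T I J (\<lambda>_. 0) = 0" for I J
      by (simp add: current_wedge_form_def form_wedge_star)
    show "(\<lambda>x. \<alpha> x A B) differentiable (at x)" for x
      by (rule smooth_on_differentiable[OF sm]) simp
  qed
  have bd: "has_bidegree CARD('n) (CARD('n) - 1) (dx k \<and>\<^sub>s ?a x)" for k x
  proof -
    have "has_bidegree 1 0 (dx k)" by (auto simp: has_bidegree_def dx_def split: if_splits)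
    from has_bidegree_swedge[OF this has_bidegree_swedge[OF has_bidegree_normal_form[of p M x] has_bidegree_beta_power[of "m - 1"]]]
    have "has_bidegree (1 + (p + (m - 1))) (0 + (p + (m - 1))) (dx k \<and>\<^sub>s ?a x)" .
    moreover have "1 + (p + (m - 1)) = CARD('n)" "0 + (p + (m - 1)) = CARD('n) - 1" using pm by auto
    ultimately show ?thesis by (simp only:)
  qed
  have "current_apply (current_d ?T) \<alpha> = csign CARD('n) *
     (\<Sum>l\<in>UNIV. wedge_sign UNIV (UNIV - {l}) {} {l} * current_d ?T UNIV (UNIV - {l}) (\<lambda>x. \<alpha> x {} {l}))"
  proof (rule current_apply_bidegree)
    fix I J :: "'n set" and \<psi> assume ne: "\<not> (card I = CARD('n) \<and> card J = CARD('n) - 1)" and "\<psi> \<in> range (\<lambda>p x. \<alpha> x (fst p) (snd p))"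
    then obtain A B where \<psi>: "\<psi> = (\<lambda>x. \<alpha> x A B)" by auto
    have z: "(dx k \<and>\<^sub>s ?a x) I J = 0" for k x using bd[of k x] ne unfolding has_bidegree_def by blast
    show "current_d ?T I J \<psi> = 0" unfolding \<psi> cd z by simp
  qed
  also have "(\<Sum>l\<in>UNIV. wedge_sign UNIV (UNIV - {l}) {} {l} * current_d ?T UNIV (UNIV - {l}) (\<lambda>x. \<alpha> x {} {l}))
     = (\<Sum>l\<in>UNIV. - (\<Sum>k\<in>UNIV. top_const TYPE('n) m * (\<integral>x. tangent_proj p M x k l * partial k (\<lambda>x. \<alpha> x {} {l}) x \<partial>\<mu>)))"
  proof (intro sum.cong refl)
    fix l :: 'n
    have "wedge_sign UNIV (UNIV - {l}) {} {l} * (\<integral>x. (dx k \<and>\<^sub>s ?a x) UNIV (UNIV - {l}) * partial k (\<lambda>x. \<alpha> x {} {l}) x \<partial>\<mu>)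
       = top_const TYPE('n) m * (\<integral>x. tangent_proj p M x k l * partial k (\<lambda>x. \<alpha> x {} {l}) x \<partial>\<mu>)" for k
    proof -
      have "wedge_sign UNIV (UNIV - {l}) {} {l} * ((dx k \<and>\<^sub>s ?a x) UNIV (UNIV - {l}) * partial k (\<lambda>x. \<alpha> x {} {l}) x)
         = top_const TYPE('n) m * (tangent_proj p M x k l * partial k (\<lambda>x. \<alpha> x {} {l}) x)" for x
        using normal_form_top[OF ud pm, of x k l] unfolding swedge_dxi_top by (simp add: mult_ac)
      then show ?thesis unfolding integral_mult_right_zero[symmetric] by (simp only:)
    qed
    then show "wedge_sign UNIV (UNIV - {l}) {} {l} * current_d ?T UNIV (UNIV - {l}) (\<lambda>x. \<alpha> x {} {l})
      = - (\<Sum>k\<in>UNIV. top_const TYPE('n) m * (\<integral>x. tangent_proj p M x k l * partial k (\<lambda>x. \<alpha> x {} {l}) x \<partial>\<mu>))"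
      unfolding cd mult_minus_right sum_distrib_left by simp
  qed
  finally show ?thesis by (simp add: sum_negf sum_distrib_left mult.assoc)
qed

lemma smooth_on_bump: "smooth_on UNIV (bump a r)"
  by (simp add: smooth_on_def Ck_on_bump)

lemma partial_eq_0_outside:
  assumes "closed C" "\<And>x. x \<notin> C \<Longrightarrow> \<phi> x = 0" "x \<notin> C"
  shows "partial k \<phi> x = 0"
proof -
  have "partial k \<phi> x = partial k (\<lambda>_. 0) x"
    by (rule partial_cong_open[of "- C"]) (use assms in auto)
  then show ?thesis by simp
qed

text \<open>A positive value would persist on a non-empty open set, which is not negligible.\<close>

lemma continuous_nonneg_integral_0:
  fixes g :: "'a::euclidean_space \<Rightarrow> real"
  assumes V: "open V" "continuous_on V g" "\<And>y. y \<in> V \<Longrightarrow> 0 \<le> g y"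
    and int: "integrable lborel (\<lambda>y. indicator V y * g y)" and z: "(\<integral>y. indicator V y * g y \<partial>lborel) = 0"
    and y: "y \<in> V"
  shows "g y = 0"
proof (rule ccontr)
  assume "g y \<noteq> 0"
  then have gy: "g y > 0" using V(3)[OF y] by simp
  define S where "S = {z \<in> V. g z \<in> {0<..}}"
  have oS: "open S" unfolding S_def by (rule open_preimage[OF V(1,2)]) auto
  have "AE z in lborel. indicator V z * g z = 0"
    using integral_nonneg_eq_0_iff_AE[OF int] z V(3) by (auto simp: indicator_def)
  then have "AE z in lborel. z \<notin> S"
    by (rule AE_mp) (auto simp: S_def indicator_def)
  moreover have "S \<in> sets lborel" using oS by simp
  ultimately have "S \<in> null_sets lborel" by (simp add: AE_iff_null_sets)
  then have "negligible S" using negligible_iff_null_sets null_sets_completionI by blast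
  then have "S = {}" using oS open_not_negligible by blast
  then show False using y gy by (auto simp: S_def)
qed

lemma local_parametrization_restrict:
  assumes lp: "local_parametrization M V f" and W: "open W" "W \<subseteq> V"
  shows "local_parametrization M W f"
proof -
  obtain g where g: "homeomorphism V (f ` V) f g" using lp by (auto simp: local_parametrization_def)
  have "openin (top_of_set (f ` V)) (f ` W)"
    by (rule homeomorphism_imp_open_map[OF g]) (use W in \<open>auto simp: openin_open_eq local_parametrization_def openin_open\<close>)
  then have "openin (top_of_set M) (f ` W)"
    using lp openin_trans unfolding local_parametrization_def by blast
  moreover have "homeomorphism W (f ` W) f g"
    using homeomorphism_of_subsets[OF g W(2)] by blast
  ultimately show ?thesis
    using lp W smooth_on_subset unfolding local_parametrization_def by blast
qed

section \<open>Relatively closed submanifolds: d-closedness and vanishing mean curvature\<close>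

locale closed_submanifold =
  fixes M \<Omega> :: "(real^'n::{finite,linorder}) set" and \<mu> :: "(real^'n::{finite,linorder}) measure"
    and codim :: nat and ty :: "'m::finite itself"
  assumes open\<Omega>: "open \<Omega>" and closedM: "closedin (top_of_set \<Omega>) M"
    and smoothM: "smooth_submanifold CARD('m) M"
    and \<mu>: "\<mu> = surface_measure TYPE('m) M" and codim: "codim = CARD('n) - CARD('m)"
begin

abbreviation chart where "chart (V :: (real^'m) set) f \<equiv> local_parametrization M V f"

lemma mn: "CARD('m) \<le> CARD('n)" using smoothM by (simp add: smooth_submanifold_def)

lemma unit_defining_ex: "x \<in> M \<Longrightarrow> \<exists>\<rho>. unit_defining_at codim M x \<rho>"
  unfolding codim by (rule unit_defining_exists[OF smoothM])

lemma chart_ex: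
  assumes "x \<in> M"
  shows "\<exists>V f. chart V f \<and> x \<in> f ` V"
  using unit_defining_ex[OF assms] local_parametrization_exists[where 'm='m, OF _ assms mn] unfolding codim by blast

lemma M_sub: "M \<subseteq> \<Omega>" using closedin_imp_subset[OF closedM] .

lemma M_borel: "M \<in> sets borel"
  using closedM open\<Omega> by (auto simp: closedin_closed)

lemma open_diff: "open (\<Omega> - M)"
proof -
  obtain S where "closed S" "M = \<Omega> \<inter> S" using closedM by (auto simp: closedin_closed)
  then have "\<Omega> - M = \<Omega> - S" by auto
  then show ?thesis using \<open>closed S\<close> open\<Omega> by (simp add: open_Diff)
qed

text \<open>Relative closedness makes traces of compact sets on M compact; finiteness of the measure
  and compact supports in charts rely on it.\<close>

lemma compact_Int_M:
  assumes "compact C" "C \<subseteq> \<Omega>"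
  shows "compact (C \<inter> M)"
proof -
  obtain S where "closed S" "M = \<Omega> \<inter> S" using closedM by (auto simp: closedin_closed)
  then have "C \<inter> M = C \<inter> S" using assms by auto
  then show ?thesis using assms \<open>closed S\<close> by (simp add: compact_Int_closed)
qed

lemma is_surface: "is_surface_measure TYPE('m) M \<mu>"
  unfolding \<mu> by (rule is_surface_measure_surface_measure[OF M_borel chart_ex])

lemma sets_\<mu>: "sets \<mu> = sets borel" and null_\<mu>: "emeasure \<mu> (- M) = 0"
  using is_surface by (simp_all add: is_surface_measure_def)

lemma chart_open:
  assumes "chart V f"
  obtains W where "open W" "f ` V = M \<inter> W"
proof -
  have "openin (top_of_set M) (f ` V)" using assms by (simp add: local_parametrization_def)
  then have "\<exists>W. open W \<and> f ` V = M \<inter> W" by (simp only: openin_open)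
  then show ?thesis using that by blast
qed

lemma chart_sub: "chart V f \<Longrightarrow> f ` V \<subseteq> M"
  using openin_imp_subset unfolding local_parametrization_def by blast

text \<open>Any orthonormal conormals at f y give the same projection, and in the chart it has the
  smooth formula P.\<close>

lemma tangent_proj_chart:
  assumes c: "chart V f" and y: "y \<in> V"
  shows "tangent_proj codim M (f y) k l = immersion.P f k l y"
proof -
  interpret immersion f V by (rule local_parametrization_immersion[OF c])
  note fM = chart_sub[OF c]
  then have fy: "f y \<in> M" using y by auto
  define r where "r = unit_defining codim M (f y)"
  have "unit_defining_at codim M (f y) r" unfolding r_def unit_defining_def using unit_defining_ex[OF fy] by (rule someI_ex)
  then obtain U where U: "f y \<in> U" "zero_set_of codim M U r"
     and on: "\<forall>y\<in>M \<inter> U. \<forall>i<codim. \<forall>j<codim. grad (r i) y \<bullet> grad (r j) y = (if i = j then 1 else 0)"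
    unfolding unit_defining_at_grad by blast
  show ?thesis
    using P_grad[OF fM U(2) y U(1) on, of k l] mn fy by (simp add: tangent_proj_def r_def codim)
qed

lemma mean_curvature_chart:
  assumes c: "chart V f" and y: "y \<in> V"
  shows "mean_curvature CARD('m) M (f y) $ l = immersion.h f l y"
proof -
  note fM = chart_sub[OF c]
  have "f y \<in> M" using fM y by auto
  then obtain \<rho> where "unit_defining_at codim M (f y) \<rho>" using unit_defining_ex by blast
  from mean_curvature_eq[OF local_parametrization_immersion[OF c] fM y mn this[unfolded codim]] show ?thesis .
qed

lemma continuous_on_charts:
  fixes F :: "_ \<Rightarrow> 'c::topological_space"
  assumes "\<And>V f. chart V f \<Longrightarrow> continuous_on V (\<lambda>y. F (f y))"
  shows "continuous_on M F"
  unfolding continuous_on_eq_continuous_within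
proof
  fix x assume x: "x \<in> M"
  obtain V f where c: "chart V f" "x \<in> f ` V" using chart_ex[OF x] by blast
  obtain W where W: "open W" "f ` V = M \<inter> W" using chart_open[OF c(1)] .
  obtain g where g: "homeomorphism V (f ` V) f g" using c by (auto simp: local_parametrization_def)
  have "continuous_on (f ` V) (\<lambda>z. F (f (g z)))"
    by (rule continuous_on_compose2[OF assms[OF c(1)]]) (use g in \<open>auto simp: homeomorphism_def\<close>)
  then have "continuous_on (f ` V) F"
    by (rule continuous_on_eq) (use g in \<open>auto simp: homeomorphism_def\<close>)
  then have "continuous (at x within (M \<inter> W)) F"
    using c(2) W(2) by (simp add: continuous_on_eq_continuous_within)
  moreover have "at x within (M \<inter> W) = at x within M"
    by (rule at_within_nhd[of x W]) (use W c(2) in auto)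
  ultimately show "continuous (at x within M) F" by simp
qed

lemma continuous_tangent_proj: "continuous_on M (\<lambda>x. tangent_proj codim M x k l)"
proof (rule continuous_on_charts)
  fix V f assume c: "chart V f"
  interpret immersion f V by (rule local_parametrization_immersion[OF c])
  show "continuous_on V (\<lambda>y. tangent_proj codim M (f y) k l)"
    by (rule continuous_on_eq[OF smooth_on_continuous[OF smooth_P]]) (simp add: tangent_proj_chart[OF c])
qed

lemma continuous_normal_form: "continuous_on M (\<lambda>x. normal_form codim M x K L)"
proof -
  have "continuous_on M (\<lambda>x. (1 / fact codim) * coeff_of (pform (\<lambda>k l. (if k = l then 1 else 0) - tangent_proj codim M x k l) ^ codim) K L)"
    by (intro continuous_intros continuous_on_pform_power continuous_tangent_proj)
  then show ?thesis
    by (rule continuous_on_eq) (simp add: normal_form_eq scaleR_superform.rep_eq)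
qed

text \<open>On a ball with compact closure in the chart domain the area density is bounded; the part
  of W off M is null.\<close>

lemma finite_near:
  assumes x: "x \<in> M"
  shows "\<exists>W. open W \<and> x \<in> W \<and> emeasure \<mu> W < \<infinity>"
proof -
  obtain V f where c: "chart V f" "x \<in> f ` V" using chart_ex[OF x] by blast
  interpret immersion f V by (rule local_parametrization_immersion[OF c(1)])
  obtain y where y: "y \<in> V" "f y = x" using c by auto
  obtain r where r: "r > 0" "cball y r \<subseteq> V" using openV y open_contains_cball by blast
  have c2: "chart (ball y r) f"
    by (rule local_parametrization_restrict[OF c(1)]) (use r ball_subset_cball in auto)
  obtain W where W: "open W" "f ` ball y r = M \<inter> W" using chart_open[OF c2] .
  have "x \<in> f ` ball y r" using y r by auto
  then have xW: "x \<in> W" using W by auto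
  have "bounded (s ` cball y r)"
    by (intro compact_imp_bounded compact_continuous_image continuous_on_subset[OF smooth_on_continuous[OF smooth_s]] r) auto
  then have "\<exists>B. \<forall>z\<in>cball y r. \<bar>s z\<bar> \<le> B" by (simp add: bounded_iff)
  then obtain B where B: "\<And>z. z \<in> cball y r \<Longrightarrow> \<bar>s z\<bar> \<le> B" by blast
  have B': "s z \<le> B" if "z \<in> ball y r" for z using B[of z] that by simp
  have Wb: "W \<in> sets borel" using W by simp
  have "emeasure \<mu> W \<le> emeasure \<mu> ((W \<inter> f ` ball y r) \<union> - M)"
    by (rule emeasure_mono) (use W M_borel sets_\<mu> Wb in auto)
  also have "\<dots> \<le> emeasure \<mu> (W \<inter> f ` ball y r) + emeasure \<mu> (- M)"
    by (rule emeasure_subadditive) (use W M_borel sets_\<mu> Wb in auto)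
  also have "\<dots> = (\<integral>\<^sup>+ z\<in>ball y r. (ennreal (s z) * indicator W (f z)) \<partial>lborel)"
    using is_surface c2 Wb null_\<mu> unfolding is_surface_measure_def by simp
  also have "\<dots> \<le> (\<integral>\<^sup>+ z. ennreal B * indicator (ball y r) z \<partial>lborel)"
    by (intro nn_integral_mono) (use B' in \<open>simp add: indicator_def ennreal_leI\<close>)
  also have "\<dots> = ennreal B * emeasure lborel (ball y r)"
    by (rule nn_integral_cmult_indicator) auto
  also have "\<dots> < \<infinity>"
    using emeasure_bounded_finite[OF bounded_ball[of y r]] by (simp add: ennreal_mult_less_top)
  finally show ?thesis using W xW by blast
qed

text \<open>C \<inter> M is compact and hence covered by finitely many open sets of finite measure;
  the rest of C is null.\<close>

lemma emeasure_compact_finite: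
  assumes C: "compact C" "C \<subseteq> \<Omega>"
  shows "emeasure \<mu> C < \<infinity>"
proof -
  define \<W> where "\<W> = {W. open W \<and> emeasure \<mu> W < \<infinity>}"
  have "C \<inter> M \<subseteq> \<Union>\<W>"
  proof
    fix x assume "x \<in> C \<inter> M"
    then have "x \<in> M" by simp
    from finite_near[OF this] obtain W where "open W" "x \<in> W" "emeasure \<mu> W < \<infinity>" by blast
    then show "x \<in> \<Union>\<W>" unfolding \<W>_def by blast
  qed
  moreover have "open W" if "W \<in> \<W>" for W using that by (simp add: \<W>_def)
  ultimately obtain T where T: "T \<subseteq> \<W>" "finite T" "C \<inter> M \<subseteq> \<Union>T"
    by (rule compactE[OF compact_Int_M[OF C]])
  have Cb: "C \<in> sets borel" using C by (simp add: borel_compact)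
  have Tb: "W \<in> sets \<mu>" if "W \<in> T" for W
  proof -
    have "open W" using T(1) that by (auto simp: \<W>_def)
    then show ?thesis by (simp add: sets_\<mu>)
  qed
  have "T \<subseteq> sets \<mu>" using Tb by blast
  with T(2) have Ub1: "\<Union>T \<in> sets \<mu>" by (rule sets.finite_Union)
  have Ub: "\<Union>T \<in> sets \<mu>" "- M \<in> sets \<mu>"
    by (rule Ub1) (simp add: sets_\<mu> M_borel borel_comp)
  have "emeasure \<mu> C \<le> emeasure \<mu> (\<Union>T \<union> - M)"
    by (rule emeasure_mono[OF _ sets.Un[OF Ub]]) (use T(3) in blast)
  also have "\<dots> \<le> emeasure \<mu> (\<Union>T) + emeasure \<mu> (- M)"
    by (rule emeasure_subadditive[OF Ub])
  also have "\<dots> \<le> (\<Sum>W\<in>T. emeasure \<mu> W)"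
  proof -
    have "(\<lambda>W. W) ` T \<subseteq> sets \<mu>" using Tb by auto
    from emeasure_subadditive_finite[OF T(2) this] show ?thesis by (simp add: null_\<mu>)
  qed
  also have "\<dots> < \<infinity>"
  proof -
    have "emeasure \<mu> W < \<infinity>" if "W \<in> T" for W using T(1) that unfolding \<W>_def by blast
    then show ?thesis using T(2) by simp
  qed
  finally show ?thesis .
qed

lemma measurable_M:
  fixes F :: "_ \<Rightarrow> real"
  assumes F: "continuous_on M F" "\<And>x. x \<notin> M \<Longrightarrow> F x = 0"
  shows "F \<in> borel_measurable borel"
proof -
  have "(\<lambda>x. indicator M x *\<^sub>R F x) \<in> borel_measurable borel"
    by (rule borel_measurable_continuous_on_indicator[OF M_borel F(1)])
  moreover have "(\<lambda>x. indicator M x *\<^sub>R F x) = F"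
  proof
    show "indicator M x *\<^sub>R F x = F x" for x using F(2)[of x] by (cases "x \<in> M") auto
  qed
  ultimately show ?thesis by (simp only:)
qed

lemma integrable_M:
  fixes F :: "_ \<Rightarrow> real"
  assumes F: "continuous_on M F" "\<And>x. x \<notin> M \<Longrightarrow> F x = 0"
    and C: "compact C" "C \<subseteq> \<Omega>" and \<phi>: "continuous_on UNIV \<phi>" "\<And>x. x \<notin> C \<Longrightarrow> \<phi> x = 0"
  shows "integrable \<mu> (\<lambda>x. F x * \<phi> x)"
proof -
  have m: "(\<lambda>x. F x * \<phi> x) \<in> borel_measurable \<mu>"
  proof -
    have "(\<lambda>x. F x * \<phi> x) \<in> borel_measurable borel"
      by (intro borel_measurable_times measurable_M F borel_measurable_continuous_onI \<phi>)
    then show ?thesis using measurable_cong_sets[OF sets_\<mu> refl] by blast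
  qed
  have "compact ((\<lambda>x. F x * \<phi> x) ` (C \<inter> M))"
    by (intro compact_continuous_image compact_Int_M C continuous_intros
      continuous_on_subset[OF F(1)] continuous_on_subset[OF \<phi>(1)]) auto
  from compact_imp_bounded[OF this] have "\<exists>B. \<forall>x\<in>C \<inter> M. norm (F x * \<phi> x) \<le> B"
    by (simp add: bounded_iff)
  then obtain B where B: "\<And>x. x \<in> C \<inter> M \<Longrightarrow> norm (F x * \<phi> x) \<le> B" by blast
  have Cs: "C \<in> sets \<mu>" using C sets_\<mu> by (simp add: borel_compact)
  have b: "norm (F x * \<phi> x) \<le> max B 0" if "x \<in> C" for x
    using B[of x] F(2)[of x] that by (cases "x \<in> M") auto
  have "set_integrable \<mu> C (\<lambda>x. F x * \<phi> x)"
    unfolding set_integrable_def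
    by (rule integrableI_bounded_set_indicator[OF Cs m emeasure_compact_finite[OF C]]) (use b in auto)
  moreover have "(\<lambda>x. indicator C x *\<^sub>R (F x * \<phi> x)) = (\<lambda>x. F x * \<phi> x)"
  proof
    show "indicator C x *\<^sub>R (F x * \<phi> x) = F x * \<phi> x" for x using \<phi>(2)[of x] by (cases "x \<in> C") auto
  qed
  ultimately show ?thesis by (simp only: set_integrable_def)
qed

definition test_fun where
  "test_fun (\<phi> :: _ \<Rightarrow> real) \<longleftrightarrow> smooth_on UNIV \<phi> \<and> (\<exists>C. compact C \<and> C \<subseteq> \<Omega> \<and> (\<forall>x. x \<notin> C \<longrightarrow> \<phi> x = 0))"

text \<open>The first variation of area along the field \<phi> e_l, that is, the integral over M of
  its tangential divergence.\<close>

definition variation where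
  "variation l \<phi> = (\<Sum>k\<in>UNIV. \<integral>x. tangent_proj codim M x k l * partial k \<phi> x \<partial>\<mu>)"

lemma integrable_test:
  assumes F: "continuous_on M F" "\<And>x. x \<notin> M \<Longrightarrow> F x = 0" and \<phi>: "test_fun \<phi>"
  shows "integrable \<mu> (\<lambda>x. F x * partial k \<phi> x)"
proof -
  obtain C where C: "compact C" "C \<subseteq> \<Omega>" "\<And>x. x \<notin> C \<Longrightarrow> \<phi> x = 0" using \<phi> by (auto simp: test_fun_def)
  show ?thesis
    by (rule integrable_M[OF F C(1,2)])
      (use \<phi> partial_eq_0_outside[OF compact_imp_closed[OF C(1)] C(3)] in
        \<open>auto simp: test_fun_def intro: smooth_on_continuous smooth_on_partial\<close>)
qed

lemma tangent_proj_outside: "x \<notin> M \<Longrightarrow> tangent_proj codim M x k l = 0"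
  by (simp add: tangent_proj_def)

text \<open>The factor relating the current to \<open>variation\<close> is non-zero, and the
  d\<xi>_l-components of test superforms can be prescribed independently.\<close>

lemma d_closed_iff:
  "d_closed_on \<Omega> (current_wedge_form (submanifold_current TYPE('m) M) (\<lambda>_. swedge_power beta (CARD('m) - 1)))
   \<longleftrightarrow> (\<forall>\<phi> l. test_fun \<phi> \<longrightarrow> variation l \<phi> = 0)"
proof -
  have key: "current_apply (current_d (current_wedge_form (submanifold_current TYPE('m) M) (\<lambda>_. swedge_power beta (CARD('m) - 1)))) \<alpha>
     = - (csign CARD('n) * top_const TYPE('n) CARD('m)) * (\<Sum>l\<in>UNIV. variation l (\<lambda>x. \<alpha> x {} {l}))"
    if \<alpha>: "test_superform \<Omega> \<alpha>" for \<alpha>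
  proof -
    have t: "test_fun (\<lambda>x. \<alpha> x I J)" for I J using \<alpha> by (auto simp: test_superform_def test_fun_def)
    have z: "normal_form codim M x K L = 0" if "x \<notin> M" for x K L
      using that by (simp add: normal_form_def sscalar_0)
    show ?thesis
      unfolding submanifold_current_def variation_def \<mu>[symmetric] codim[symmetric]
      by (rule current_apply_submanifold[OF unit_defining_ex])
        (use mn codim t integrable_test[OF continuous_normal_form z t] in \<open>auto simp: test_fun_def Suc_leI\<close>)
  qed
  show ?thesis
  proof
    assume L: "d_closed_on \<Omega> (current_wedge_form (submanifold_current TYPE('m) M) (\<lambda>_. swedge_power beta (CARD('m) - 1)))"
    show "\<forall>\<phi> l. test_fun \<phi> \<longrightarrow> variation l \<phi> = 0"
    proof (intro allI impI)
      fix \<phi> l assume \<phi>: "test_fun \<phi>"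
      \<comment> \<open>The test form \<phi> d\<xi>_l isolates one component.\<close>
      define \<alpha> :: "_ \<Rightarrow> 'n sform" where "\<alpha> x = (\<lambda>I J. if I = {} \<and> J = {l} then \<phi> x else 0)" for x
      have z: "test_fun (\<lambda>_. 0)" by (auto simp: test_fun_def smooth_on_const intro!: exI[of _ "{}"])
      have \<alpha>: "test_superform \<Omega> \<alpha>"
        unfolding test_superform_def
      proof (intro conjI allI)
        show "smooth_on UNIV (\<lambda>x. \<alpha> x I J)" for I J
        proof (cases "I = {} \<and> J = {l}")
          case True
          then have "(\<lambda>x. \<alpha> x I J) = \<phi>" by (simp add: \<alpha>_def)
          then show ?thesis using \<phi> by (simp only: test_fun_def)
        next
          case False
          then have "(\<lambda>x. \<alpha> x I J) = (\<lambda>_. 0)" by (auto simp: \<alpha>_def)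
          then show ?thesis using z by (simp only: test_fun_def)
        qed
      qed (use \<phi> in \<open>auto simp: \<alpha>_def test_fun_def\<close>)
      have v0: "variation l' (\<lambda>x. \<alpha> x {} {l'}) = (if l' = l then variation l \<phi> else 0)" for l'
        by (simp add: \<alpha>_def variation_def)
      have "csign CARD('n) \<noteq> 0" "top_const TYPE('n) CARD('m) \<noteq> 0"
        by (simp_all add: csign_def top_const_ne_0 Suc_leI)
      moreover have "- (csign CARD('n) * top_const TYPE('n) CARD('m)) * (\<Sum>l'\<in>UNIV. variation l' (\<lambda>x. \<alpha> x {} {l'})) = 0"
        using L \<alpha> key[OF \<alpha>] unfolding d_closed_on_def scurrent_zero_on_def by metis
      ultimately show "variation l \<phi> = 0" by (simp add: v0)
    qed
  next
    assume R: "\<forall>\<phi> l. test_fun \<phi> \<longrightarrow> variation l \<phi> = 0"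
    show "d_closed_on \<Omega> (current_wedge_form (submanifold_current TYPE('m) M) (\<lambda>_. swedge_power beta (CARD('m) - 1)))"
      unfolding d_closed_on_def scurrent_zero_on_def
    proof (intro allI impI)
      fix \<alpha> assume \<alpha>: "test_superform \<Omega> \<alpha>"
      have "test_fun (\<lambda>x. \<alpha> x {} {l})" for l using \<alpha> by (auto simp: test_superform_def test_fun_def)
      then show "current_apply (current_d (current_wedge_form (submanifold_current TYPE('m) M) (\<lambda>_. swedge_power beta (CARD('m) - 1)))) \<alpha> = 0"
        unfolding key[OF \<alpha>] using R by simp
    qed
  qed
qed

text \<open>In the chart the integrand becomes the derivatives of \<phi> composed with f, contracted
  with B, to which \<open>first_variation\<close> applies. The integrability statement is there for
  the bump argument in \<open>mean_curvature_zero\<close>.\<close>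

lemma variation_chart:
  assumes c: "chart V f" and \<phi>: "smooth_on UNIV \<phi>" and K: "compact K" "K \<subseteq> \<Omega>" "\<And>x. x \<notin> K \<Longrightarrow> \<phi> x = 0" "K \<inter> M \<subseteq> f ` V"
  shows "variation l \<phi> = (\<integral>y. indicator V y * (area_density f y * \<phi> (f y) * immersion.h f l y) \<partial>lborel)"
    and "\<And>g. continuous_on V g \<Longrightarrow> integrable lborel (\<lambda>y. indicator V y * (g y * \<phi> (f y)))"
proof -
  interpret immersion f V by (rule local_parametrization_immersion[OF c])
  obtain g where g: "homeomorphism V (f ` V) f g" using c by (auto simp: local_parametrization_def)
  note fM = chart_sub[OF c]
  \<comment> \<open>A compact part of the chart domain outside which \<phi> composed with f vanishes
    on V.\<close>
  define K' where "K' = g ` (K \<inter> M)"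
  have cg: "continuous_on (K \<inter> M) g"
    using continuous_on_subset[OF homeomorphism_cont2[OF g] K(4)] .
  have K': "compact K'" unfolding K'_def
    by (rule compact_continuous_image[OF cg compact_Int_M[OF K(1,2)]])
  have K'V: "K' \<subseteq> V"
    unfolding K'_def using image_mono[OF K(4), of g] homeomorphism_image2[OF g] by simp
  have out: "f y \<notin> K" if "y \<in> V - K'" for y
  proof
    assume "f y \<in> K"
    then have "f y \<in> K \<inter> M" using fM that by auto
    then have "g (f y) \<in> K'" by (auto simp: K'_def)
    then show False using that homeomorphism_apply1[OF g, of y] by simp
  qed
  have c\<phi>: "continuous_on V (\<lambda>y. \<phi> (f y))"
    by (rule continuous_on_compose2[OF smooth_on_continuous[OF \<phi>] continuous_f]) auto
  have cp\<phi>: "continuous_on V (\<lambda>y. partial k \<phi> (f y))" for k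
    by (rule continuous_on_compose2[OF smooth_on_continuous[OF smooth_on_partial[OF \<phi>]] continuous_f]) auto
  have p0: "partial k \<phi> x = 0" if "x \<notin> K" for k x
    by (rule partial_eq_0_outside[OF compact_imp_closed[OF K(1)] K(3) that])
  show "integrable lborel (\<lambda>y. indicator V y * (u y * \<phi> (f y)))" if "continuous_on V u" for u
    by (rule integrable_compact_support[OF _ K' K'V]) (use that c\<phi> out K(3) in \<open>auto intro!: continuous_intros\<close>)
  have tm: "(\<integral>x. tangent_proj codim M x k l * partial k \<phi> x \<partial>\<mu>)
      = (\<integral>y. indicator V y * (s y * (P k l y * partial k \<phi> (f y))) \<partial>lborel)" for k
  proof -
    have "(\<integral>x. tangent_proj codim M x k l * partial k \<phi> x \<partial>\<mu>)
      = (\<integral>y. indicator V y * (s y * (tangent_proj codim M (f y) k l * partial k \<phi> (f y))) \<partial>lborel)"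
    proof (rule surface_integral_chart[OF is_surface M_borel c])
      show "(\<lambda>x. tangent_proj codim M x k l * partial k \<phi> x) \<in> borel_measurable borel"
        by (intro borel_measurable_times measurable_M continuous_tangent_proj tangent_proj_outside
          borel_measurable_continuous_onI smooth_on_continuous smooth_on_partial \<phi>)
      show "tangent_proj codim M x k l * partial k \<phi> x = 0" if "x \<in> M - f ` V" for x
        using p0[of x k] that K(4) by auto
    qed
    also have "\<dots> = (\<integral>y. indicator V y * (s y * (P k l y * partial k \<phi> (f y))) \<partial>lborel)"
      by (intro Bochner_Integration.integral_cong refl) (auto simp: indicator_def tangent_proj_chart[OF c])
    finally show ?thesis .
  qed
  have i: "integrable lborel (\<lambda>y. indicator V y * (s y * (P k l y * partial k \<phi> (f y))))" for k
    by (rule integrable_compact_support[OF _ K' K'V])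
      (use cp\<phi> out p0 smooth_on_continuous[OF smooth_s] smooth_on_continuous[OF smooth_P] in \<open>auto intro!: continuous_intros\<close>)
  have F: "Ck_on 1 V (\<lambda>y. \<phi> (f y))"
    by (rule smooth_on_Ck[OF smooth_on_compose[OF openV open_UNIV smooth_f \<phi>]]) auto
  have "variation l \<phi> = (\<integral>y. (\<Sum>k\<in>UNIV. indicator V y * (s y * (P k l y * partial k \<phi> (f y)))) \<partial>lborel)"
    unfolding variation_def tm by (rule Bochner_Integration.integral_sum[symmetric]) (rule i)
  also have "\<dots> = (\<integral>y. indicator V y * (s y * (\<Sum>b\<in>UNIV. B y $ l $ b * partial b (\<lambda>y. \<phi> (f y)) y)) \<partial>lborel)"
  proof (intro Bochner_Integration.integral_cong refl)
    fix y
    show "(\<Sum>k\<in>UNIV. indicator V y * (s y * (P k l y * partial k \<phi> (f y))))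
      = indicator V y * (s y * (\<Sum>b\<in>UNIV. B y $ l $ b * partial b (\<lambda>y. \<phi> (f y)) y))"
    proof (cases "y \<in> V")
      case True
      \<comment> \<open>By symmetry P = A B^T; the factor A then turns the gradient of \<phi> into
        chart derivatives by the chain rule.\<close>
      have "(\<Sum>k\<in>UNIV. P k l y * partial k \<phi> (f y)) = (\<Sum>k\<in>UNIV. \<Sum>b\<in>UNIV. B y $ l $ b * (partial k \<phi> (f y) * A y $ k $ b))"
        by (intro sum.cong refl) (subst P_sym[OF True], simp add: P_def sum_distrib_left mult_ac)
      also have "\<dots> = (\<Sum>b\<in>UNIV. \<Sum>k\<in>UNIV. B y $ l $ b * (partial k \<phi> (f y) * A y $ k $ b))" by (rule sum.swap)
      also have "\<dots> = (\<Sum>b\<in>UNIV. B y $ l $ b * partial b (\<lambda>y. \<phi> (f y)) y)"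
        using chain_partial[OF True smooth_on_differentiable[OF \<phi> UNIV_I]] by (simp add: sum_distrib_left)
      finally show ?thesis using True by (simp add: sum_distrib_left[symmetric])
    qed simp
  qed
  also have "\<dots> = (\<integral>y. indicator V y * (s y * \<phi> (f y) * h l y) \<partial>lborel)"
    by (rule first_variation[OF F K' K'V]) (use out K(3) in auto)
  finally show "variation l \<phi> = (\<integral>y. indicator V y * (s y * \<phi> (f y) * h l y) \<partial>lborel)" .
qed

lemma variation_sum:
  assumes "finite D" "\<And>i. i \<in> D \<Longrightarrow> test_fun (\<psi> i)"
  shows "variation l (\<lambda>x. \<Sum>i\<in>D. \<psi> i x) = (\<Sum>i\<in>D. variation l (\<psi> i))"
proof -
  have d: "\<psi> i differentiable (at x)" if "i \<in> D" for i x
    using assms(2)[OF that] smooth_on_differentiable[of UNIV "\<psi> i" x] by (simp add: test_fun_def)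
  have "(\<integral>x. tangent_proj codim M x k l * partial k (\<lambda>x. \<Sum>i\<in>D. \<psi> i x) x \<partial>\<mu>)
      = (\<Sum>i\<in>D. \<integral>x. tangent_proj codim M x k l * partial k (\<psi> i) x \<partial>\<mu>)" for k
  proof -
    have "(\<integral>x. tangent_proj codim M x k l * partial k (\<lambda>x. \<Sum>i\<in>D. \<psi> i x) x \<partial>\<mu>)
      = (\<integral>x. (\<Sum>i\<in>D. tangent_proj codim M x k l * partial k (\<psi> i) x) \<partial>\<mu>)"
      by (simp add: partial_sum[OF d] sum_distrib_left)
    also have "\<dots> = (\<Sum>i\<in>D. \<integral>x. tangent_proj codim M x k l * partial k (\<psi> i) x \<partial>\<mu>)"
      by (rule Bochner_Integration.integral_sum) (intro integrable_test continuous_tangent_proj tangent_proj_outside assms(2))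
    finally show ?thesis .
  qed
  then show ?thesis unfolding variation_def by (simp add: sum.swap[of _ D])
qed

text \<open>A small ball either meets M only inside one chart, where the integrand contains h = 0,
  or misses M altogether. A radius is given at every point of \<Omega>, ready for covering a compact
  support.\<close>

lemma variation_local_zero:
  assumes H: "\<forall>x\<in>M. mean_curvature CARD('m) M x = 0" and x: "x \<in> \<Omega>"
  shows "\<exists>\<epsilon>>0. \<forall>\<phi>. smooth_on UNIV \<phi> \<longrightarrow> (\<forall>z. z \<notin> cball x \<epsilon> \<longrightarrow> \<phi> z = 0) \<longrightarrow> variation l \<phi> = 0"
proof (cases "x \<in> M")
  case True
  obtain V f where c: "chart V f" "x \<in> f ` V" using chart_ex[OF True] by blast
  interpret immersion f V by (rule local_parametrization_immersion[OF c(1)])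
  obtain W where W: "open W" "f ` V = M \<inter> W" using chart_open[OF c(1)] .
  have "open (W \<inter> \<Omega>)" "x \<in> W \<inter> \<Omega>" using W open\<Omega> c(2) x by auto
  then obtain \<epsilon> where e: "\<epsilon> > 0" "cball x \<epsilon> \<subseteq> W \<inter> \<Omega>"
    unfolding open_contains_cball by blast
  have h0: "h l y = 0" if "y \<in> V" for y
  proof -
    have "f y \<in> M" using chart_sub[OF c(1)] that by auto
    then have "mean_curvature CARD('m) M (f y) = 0" using H by blast
    then show ?thesis using mean_curvature_chart[OF c(1) that, of l] by simp
  qed
  have "variation l \<phi> = 0" if "smooth_on UNIV \<phi>" "\<forall>z. z \<notin> cball x \<epsilon> \<longrightarrow> \<phi> z = 0" for \<phi>
  proof -
    have "variation l \<phi> = (\<integral>y. indicator V y * (area_density f y * \<phi> (f y) * h l y) \<partial>lborel)"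
      by (rule variation_chart(1)[OF c(1) that(1) compact_cball]) (use that(2) e W in auto)
    also have "\<dots> = (\<integral>y. 0 \<partial>(lborel :: (real^'m) measure))"
      by (intro Bochner_Integration.integral_cong refl) (auto simp: indicator_def h0)
    finally show ?thesis by simp
  qed
  then show ?thesis using e(1) by blast
next
  case False
  then have "x \<in> \<Omega> - M" using x by simp
  then obtain \<epsilon> where e: "\<epsilon> > 0" "cball x \<epsilon> \<subseteq> \<Omega> - M"
    using open_diff unfolding open_contains_cball by blast
  have "variation l \<phi> = 0" if "\<forall>z. z \<notin> cball x \<epsilon> \<longrightarrow> \<phi> z = 0" for \<phi>
  proof -
    have z: "tangent_proj codim M z k l * partial k \<phi> z = 0" for z k
    proof (cases "z \<in> M")
      case True
      then have "partial k \<phi> z = 0"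
        by (intro partial_eq_0_outside[of "cball x \<epsilon>"]) (use that e in auto)
      then show ?thesis by simp
    qed (simp add: tangent_proj_def)
    show ?thesis unfolding variation_def z by simp
  qed
  then show ?thesis using e(1) by blast
qed

lemma variation_zero:
  assumes H: "\<forall>x\<in>M. mean_curvature CARD('m) M x = 0" and \<phi>: "test_fun \<phi>"
  shows "variation l \<phi> = 0"
proof -
  obtain C where C: "compact C" "C \<subseteq> \<Omega>" "\<And>x. x \<notin> C \<Longrightarrow> \<phi> x = 0" and s\<phi>: "smooth_on UNIV \<phi>"
    using \<phi> unfolding test_fun_def by blast
  define Q where "Q x \<epsilon> \<longleftrightarrow> \<epsilon> > 0 \<and> (\<forall>\<phi>. smooth_on UNIV \<phi> \<longrightarrow> (\<forall>z. z \<notin> cball x \<epsilon> \<longrightarrow> \<phi> z = 0) \<longrightarrow> variation l \<phi> = 0)" for x \<epsilon>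
  define r where "r x = (SOME \<epsilon>. Q x \<epsilon>)" for x
  have r: "Q x (r x)" if "x \<in> \<Omega>" for x
  proof -
    have "\<exists>\<epsilon>. Q x \<epsilon>" using variation_local_zero[OF H that] unfolding Q_def by blast
    then show ?thesis unfolding r_def by (rule someI_ex)
  qed
  have rpos: "r x > 0" if "x \<in> C" for x
  proof -
    have "x \<in> \<Omega>" using that C(2) by blast
    from r[OF this] show ?thesis unfolding Q_def by (rule conjunct1)
  qed
  have "C \<subseteq> (\<Union>x\<in>C. ball x (r x))" using rpos centre_in_ball by blast
  then obtain D where D: "D \<subseteq> C" "finite D" "C \<subseteq> (\<Union>x\<in>D. ball x (r x))"
    by (rule compactE_image[OF C(1) open_ball])
  define S where "S z = (\<Sum>i\<in>D. bump i (r i) z)" for z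
  have sS: "smooth_on UNIV S" unfolding S_def[abs_def] by (intro smooth_on_sum smooth_on_bump open_UNIV)
  have Spos: "S z > 0" if zC: "z \<in> C" for z
  proof -
    obtain i where i: "i \<in> D" "z \<in> ball i (r i)" using D(3) zC by blast
    have ri: "r i > 0" by (rule rpos) (use i D(1) in blast)
    have "bump i (r i) z > 0" using bump_pos_iff[OF ri] i(2) by blast
    then show ?thesis unfolding S_def by (rule sum_pos2[OF D(2) i(1)]) (rule bump_nonneg)
  qed
  \<comment> \<open>The bumps divided by S form a partition of unity only on C, where S > 0; off C
    the factor \<phi> is 0, so the default value \<open>inverse 0 = 0\<close> does no harm.\<close>
  define \<psi> where "\<psi> i z = \<phi> z * bump i (r i) z * inverse (S z)" for i z
  have oS: "open {z. S z \<in> {0<..}}"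
    using open_preimage[OF open_UNIV smooth_on_continuous[OF sS], of "{0<..}"] by simp
  have s\<psi>: "smooth_on UNIV (\<psi> i)" for i
    unfolding smooth_on_def
  proof (intro allI Ck_on_local[OF open_UNIV])
    fix k z
    show "\<exists>U. open U \<and> z \<in> U \<and> Ck_on k U (\<psi> i)"
    proof (cases "z \<in> C")
      case True
      have "Ck_on k {z. S z \<in> {0<..}} (\<psi> i)"
        unfolding \<psi>_def[abs_def]
        by (intro Ck_on_mult Ck_on_inverse oS)
          (use Ck_on_subset[OF smooth_on_Ck[OF s\<phi>]] Ck_on_subset[OF Ck_on_bump] Ck_on_subset[OF smooth_on_Ck[OF sS]] in auto)
      then show ?thesis using Spos[OF True] oS by blast
    next
      case False
      have o: "open (- C)" using compact_imp_closed[OF C(1)] by auto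
      have "Ck_on k (- C) (\<psi> i)"
        by (subst Ck_on_cong[OF o, of "\<psi> i" "\<lambda>_. 0"]) (use C(3) o in \<open>auto simp: \<psi>_def\<close>)
      then show ?thesis using False o by blast
    qed
  qed
  have t\<psi>: "test_fun (\<psi> i)" for i
  proof -
    have "\<psi> i z = 0" if "z \<notin> C" for z using C(3)[OF that] by (simp add: \<psi>_def)
    then show ?thesis unfolding test_fun_def using s\<psi> C(1,2) by blast
  qed
  have v\<psi>: "variation l (\<psi> i) = 0" if "i \<in> D" for i
  proof -
    have i: "i \<in> \<Omega>" "r i > 0" using that D(1) C(2) rpos by blast+
    have "\<psi> i z = 0" if "z \<notin> cball i (r i)" for z
      using bump_eq_0[OF i(2), of z i] that by (auto simp: \<psi>_def)
    then show ?thesis using r[OF i(1)] s\<psi> unfolding Q_def by blast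
  qed
  have "\<phi> = (\<lambda>z. \<Sum>i\<in>D. \<psi> i z)"
  proof
    fix z
    have e: "(\<Sum>i\<in>D. \<psi> i z) = \<phi> z * (S z * inverse (S z))"
      by (simp add: \<psi>_def S_def sum_distrib_left sum_distrib_right mult.assoc)
    show "\<phi> z = (\<Sum>i\<in>D. \<psi> i z)"
      unfolding e using Spos[of z] C(3)[of z] by (cases "z \<in> C") auto
  qed
  then have "variation l \<phi> = (\<Sum>i\<in>D. variation l (\<psi> i))" using variation_sum[OF D(2) t\<psi>] by simp
  then show ?thesis using v\<psi> by simp
qed

lemma mean_curvature_zero:
  assumes v: "\<And>\<phi> l. test_fun \<phi> \<Longrightarrow> variation l \<phi> = 0" and x: "x \<in> M"
  shows "mean_curvature CARD('m) M x = 0"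
proof -
  obtain V f where c: "chart V f" "x \<in> f ` V" using chart_ex[OF x] by blast
  interpret immersion f V by (rule local_parametrization_immersion[OF c(1)])
  obtain W where W: "open W" "f ` V = M \<inter> W" using chart_open[OF c(1)] .
  obtain y0 where y0: "y0 \<in> V" "f y0 = x" using c by auto
  obtain g where g: "homeomorphism V (f ` V) f g" using c by (auto simp: local_parametrization_def)
  have h0: "h l y0 = 0" for l
  proof (rule ccontr)
    assume ne: "h l y0 \<noteq> 0"
    \<comment> \<open>With this sign \<sigma> h_l is positive at y0 and, by continuity, on an open
      set of chart points.\<close>
    define \<sigma> where "\<sigma> = sgn (h l y0)"
    have \<sigma>: "\<sigma> * h l y0 > 0" using ne by (simp add: \<sigma>_def sgn_if)
    have "open {y \<in> V. \<sigma> * h l y \<in> {0<..}}"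
      by (rule open_preimage[OF openV]) (auto intro!: continuous_intros smooth_on_continuous[OF smooth_h])
    \<comment> \<open>The restricted chart has relatively open image in M, so a small enough ball
      around x meets M only where \<sigma> h_l > 0; other parts of M cannot come close to x.\<close>
    then have "chart {y \<in> V. \<sigma> * h l y \<in> {0<..}} f"
      by (rule local_parametrization_restrict[OF c(1)]) auto
    from chart_open[OF this] obtain W' where W': "open W'" "f ` {y \<in> V. \<sigma> * h l y \<in> {0<..}} = M \<inter> W'" .
    have "x \<in> f ` {y \<in> V. \<sigma> * h l y \<in> {0<..}}" using y0 \<sigma> by auto
    then have xW': "x \<in> W'" "x \<in> W" "x \<in> \<Omega>" using W' W c(2) x M_sub by auto
    have "open (W' \<inter> W \<inter> \<Omega>)" "x \<in> W' \<inter> W \<inter> \<Omega>" using W W' open\<Omega> xW' by auto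
    then obtain \<epsilon> where e: "\<epsilon> > 0" "cball x \<epsilon> \<subseteq> W' \<inter> W \<inter> \<Omega>"
      unfolding open_contains_cball by blast
    let ?b = "bump x \<epsilon>"
    have b0: "?b z = 0" if "z \<notin> cball x \<epsilon>" for z
      by (rule bump_eq_0[OF e(1)]) (use that in auto)
    have tb: "test_fun ?b" unfolding test_fun_def
    proof (intro conjI exI[of _ "cball x \<epsilon>"] allI impI)
      show "cball x \<epsilon> \<subseteq> \<Omega>" using e(2) by blast
    qed (rule smooth_on_bump compact_cball b0; assumption?)+
    have KM: "cball x \<epsilon> \<inter> M \<subseteq> f ` V" "cball x \<epsilon> \<subseteq> \<Omega>" using e W by auto
    have var: "variation l ?b = (\<integral>y. indicator V y * (s y * ?b (f y) * h l y) \<partial>lborel)"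
      by (rule variation_chart(1)[OF c(1) smooth_on_bump compact_cball KM(2) b0 KM(1)])
    let ?G = "\<lambda>y. \<sigma> * (s y * ?b (f y) * h l y)"
    have cu: "continuous_on V (\<lambda>y. \<sigma> * s y * h l y)"
      by (intro continuous_intros smooth_on_continuous[OF smooth_s] smooth_on_continuous[OF smooth_h])
    have "integrable lborel (\<lambda>y. indicator V y * ((\<sigma> * s y * h l y) * ?b (f y)))"
      by (rule variation_chart(2)[OF c(1) smooth_on_bump compact_cball KM(2) b0 KM(1) cu])
    then have iG: "integrable lborel (\<lambda>y. indicator V y * ?G y)" by (simp add: mult_ac)
    have cG: "continuous_on V ?G"
      by (intro continuous_intros smooth_on_continuous[OF smooth_s] smooth_on_continuous[OF smooth_h]
          continuous_on_compose2[OF smooth_on_continuous[OF smooth_on_bump] continuous_f]) auto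
    have nG: "0 \<le> ?G y" if y: "y \<in> V" for y
    proof (cases "f y \<in> cball x \<epsilon>")
      case True
      then have "f y \<in> f ` {y \<in> V. \<sigma> * h l y \<in> {0<..}}" using W' W e y by auto
      then obtain y' where y': "y' \<in> V" "\<sigma> * h l y' > 0" "f y' = f y" by auto
      \<comment> \<open>Injectivity of the chart is what transfers the sign condition from the image
        point back to y itself.\<close>
      then have "y' = y" using homeomorphism_apply1[OF g] y by metis
      then have "0 \<le> s y * ?b (f y) * (\<sigma> * h l y)" using y' s_pos[OF y] bump_nonneg[of x \<epsilon> "f y"] by simp
      then show ?thesis by (simp add: mult_ac)
    qed (simp add: b0)
    have "(\<integral>y. indicator V y * ?G y \<partial>lborel) = \<sigma> * variation l ?b"
      unfolding var integral_mult_right_zero[symmetric] by (simp add: mult_ac)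
    also have "\<dots> = 0" using v[OF tb] by simp
    finally have "?G y0 = 0"
      using continuous_nonneg_integral_0[OF openV cG nG iG _ y0(1)] by blast
    moreover have "s y0 * ?b (f y0) > 0"
      using s_pos[OF y0(1)] bump_pos_iff[OF e(1), of x x] e(1) y0(2) by simp
    ultimately show False using ne by (auto simp: \<sigma>_def sgn_eq_0_iff)
  qed
  show ?thesis
    using mean_curvature_chart[OF c(1) y0(1)] h0 y0(2) by (simp add: vec_eq_iff)
qed

end

theorem corollary5p2:
  fixes M \<Omega> :: "(real^'n::{finite,linorder}) set"
  assumes "open \<Omega>"
    and "closedin (top_of_set \<Omega>) M"
    and "smooth_submanifold CARD('m::finite) M"
  shows "d_closed_on \<Omega>
           (current_wedge_form (submanifold_current TYPE('m) M) (\<lambda>_. swedge_power beta (CARD('m) - 1)))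
         \<longleftrightarrow> minimal_submanifold CARD('m) M"
proof -
  interpret closed_submanifold M \<Omega> "surface_measure TYPE('m) M" "CARD('n) - CARD('m)" "TYPE('m)"
    using assms by unfold_locales simp_all
  show ?thesis
    unfolding d_closed_iff minimal_submanifold_def
    using smoothM variation_zero mean_curvature_zero by blast
qed

end
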